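(* Let $G$ be an abelian group. Then the following statements are equivalent. (a) $\mathcal{B}_{\pm}(G)$ is finitely generated. (b) $\mathcal{B}_{\pm}(G)$ is a C-monoid defined in $\mathcal{F}(G)$. (c) $\mathcal{B}_{\pm}(G)$ is a C-monoid. (d) $\mathcal{B}_{\pm}(G)$ is a Mori monoid and $\mathcal{C}_v\big(\widehat{\mathcal{B}_{\pm}(G)}\big)$ is finitely generated. (e) $G$ is finite.
   Context: Groups are written additively. A monoid is a commutative cancellative semigroup with identity, written multiplicatively; $H^\times$ is the group of invertible elements and $\mathsf{q}(H)$ the quotient group of a monoid $H$. $\mathcal{F}(G)$ is the multiplicatively written free abelian monoid with basis $G$; its elements $S=g_1\cdot\ldots\cdot g_\ell$ are called sequences over $G$. $\mathcal{B}_{\pm}(G)\subset\mathcal{F}(G)$ is the submonoid of all plus-minus weighted zero-sum sequences, i.e. all $S=g_1\cdot\ldots\cdot g_\ell$ for which there are $\varepsilon_1,\ldots,\varepsilon_\ell\in\{-1,1\}$ with $\varepsilon_1g_1+\ldots+\varepsilon_\ell g_\ell=0$ in $G$ (the empty sequence is included). For a monoid $H$: for subsets $I,J\subset\mathsf{q}(H)$, $(I:J)=\{x\in\mathsf{q}(H)\colon xJ\subset I\}$, $I^{-1}=(H:I)$, $I_v=(I^{-1})^{-1}$. A subset $I\subset H$ is a divisorial ideal ($v$-ideal) if $I=I_v$. $H$ is a Mori monoid if it satisfies the ascending chain condition on divisorial ideals. The complete integral closure is $\widehat{H}=\{x\in\mathsf{q}(H)\colon\text{there is }c\in H\text{ with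 }cx^n\in H\text{ for all }n\in\mathbb{N}\}$, where $\mathbb{N}$ denotes the positive integers. $\mathcal{F}_v(H)$ denotes the semigroup of fractional $v$-ideals of $H$ (the subsets $cI$ with $c\in\mathsf{q}(H)$ and $I$ a $v$-ideal of $H$) under $v$-multiplication $(I,J)\mapsto (IJ)_v$, and $\mathcal{C}_v(H)=\mathcal{F}_v(H)^\times/\{aH\colon a\in\mathsf{q}(H)\}$ is the $v$-class group of $H$. A monoid $F$ is factorial if $F_{\mathrm{red}}=\{aF^\times\colon a\in F\}$ is free abelian. Let $F$ be a factorial monoid and $H\subset F$ a submonoid. Elements $y,y'\in F$ are $H$-equivalent if for all $x\in F$ we have $xy\in H$ if and only if $xy'\in H$; this is a congruence relation on $F$, and $[y]$ denotes the class of $y$. The reduced class semigroup of $H$ in $F$ is $\mathcal{C}^*(H,F)=\{[y]\colon y\in(F\setminus F^\times)\cup\{1\}\}$. A monoid $H$ is a C-monoid defined in $F$ if it is a submonoid of the factorial monoid $F$ with $H\cap F^\times=H^\times$ and $\mathcal{C}^*(H,F)$ finite; $H$ is a C-monoid if it is a C-monoid defined in some factorial monoid $F$. *)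

theory Defs
  imports "HOL-Algebra.Divisibility" "HOL-Algebra.FiniteProduct" "HOL-Algebra.Generated_Groups" "HOL-Library.Multiset"
begin

section \<open>Sequences and plus-minus weighted zero-sum sequences\<close>

text \<open>Sequences over \<open>X\<close> are finite multisets, and their product is the sum of multisets.\<close>

definition free_abelian_monoid :: "'a set \<Rightarrow> 'a multiset monoid" where
  "free_abelian_monoid X = \<lparr>carrier = {s. set_mset s \<subseteq> X}, mult = (+), one = {#}\<rparr>"

text \<open>Groups are written multiplicatively, so \<open>\<epsilon>\<^sub>1 g\<^sub>1 + \<dots> + \<epsilon>\<^sub>l g\<^sub>l = 0\<close> becomes a product of
  powers with exponents \<open>1\<close> and \<open>-1\<close>.\<close>

definition pm_zero_sum_sequences :: "('a, 'm) monoid_scheme \<Rightarrow> 'a multiset set" where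
  "pm_zero_sum_sequences G =
     {mset gs |gs. set gs \<subseteq> carrier G \<and>
        (\<exists>\<epsilon> :: nat \<Rightarrow> int. (\<forall>i<length gs. \<epsilon> i \<in> {-1, 1}) \<and>
           (\<Otimes>\<^bsub>G\<^esub>i\<in>{..<length gs}. (gs ! i) [^]\<^bsub>G\<^esub> \<epsilon> i) = \<one>\<^bsub>G\<^esub>)}"

definition pm_zero_sum_monoid :: "('a, 'm) monoid_scheme \<Rightarrow> 'a multiset monoid" where
  "pm_zero_sum_monoid G =
     (free_abelian_monoid (carrier G))\<lparr>carrier := pm_zero_sum_sequences G\<rparr>"

section \<open>Finite generation\<close>

definition fin_gen_monoid :: "('a, 'm) monoid_scheme \<Rightarrow> bool" where
  "fin_gen_monoid H \<longleftrightarrow>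
     (\<exists>E. finite E \<and> E \<subseteq> carrier H \<and> \<Inter>{N. submonoid N H \<and> E \<subseteq> N} = carrier H)"

definition fin_gen_group :: "('a, 'm) monoid_scheme \<Rightarrow> bool" where
  "fin_gen_group G \<longleftrightarrow> (\<exists>E. finite E \<and> E \<subseteq> carrier G \<and> generate G E = carrier G)"

section \<open>The quotient group of a monoid\<close>

definition fraction_rel :: "('a, 'm) monoid_scheme \<Rightarrow> (('a \<times> 'a) \<times> ('a \<times> 'a)) set" where
  "fraction_rel H =
     {((a, b), (c, d)). a \<in> carrier H \<and> b \<in> carrier H \<and> c \<in> carrier H \<and> d \<in> carrier H \<and>
        a \<otimes>\<^bsub>H\<^esub> d = c \<otimes>\<^bsub>H\<^esub> b}"

definition quotient_group :: "('a, 'm) monoid_scheme \<Rightarrow> ('a \<times> 'a) set monoid" where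
  "quotient_group H =
     \<lparr>carrier = (carrier H \<times> carrier H) // fraction_rel H,
      mult = (\<lambda>X Y. \<Union>(a, b)\<in>X. \<Union>(c, d)\<in>Y. fraction_rel H `` {(a \<otimes>\<^bsub>H\<^esub> c, b \<otimes>\<^bsub>H\<^esub> d)}),
      one = fraction_rel H `` {(\<one>\<^bsub>H\<^esub>, \<one>\<^bsub>H\<^esub>)}\<rparr>"

definition quotient_embed :: "('a, 'm) monoid_scheme \<Rightarrow> 'a \<Rightarrow> ('a \<times> 'a) set" where
  "quotient_embed H a = fraction_rel H `` {(a, \<one>\<^bsub>H\<^esub>)}"

text \<open>The copy of \<open>H\<close> inside its quotient group.\<close>

definition embedded :: "('a, 'm) monoid_scheme \<Rightarrow> ('a \<times> 'a) set set" where
  "embedded H = quotient_embed H ` carrier H"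

section \<open>Divisorial ideals, complete integral closure and the v-class group\<close>

text \<open>Below, \<open>Q\<close> is an abelian group and \<open>H\<close> (a subset of its carrier) a submonoid of which \<open>Q\<close> is
  the quotient group, i.e. every element of \<open>Q\<close> is a fraction of elements of \<open>H\<close>. Since the
  complete integral closure of \<open>H\<close> lies between \<open>H\<close> and \<open>Q\<close>, it has the same quotient group \<open>Q\<close>.\<close>

definition ideal_colon :: "('q, 'm) monoid_scheme \<Rightarrow> 'q set \<Rightarrow> 'q set \<Rightarrow> 'q set" where
  "ideal_colon Q I J = {x \<in> carrier Q. x <#\<^bsub>Q\<^esub> J \<subseteq> I}"

definition v_closure :: "('q, 'm) monoid_scheme \<Rightarrow> 'q set \<Rightarrow> 'q set \<Rightarrow> 'q set" where
  "v_closure Q H I = ideal_colon Q H (ideal_colon Q H I)"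

definition divisorial_ideal :: "('q, 'm) monoid_scheme \<Rightarrow> 'q set \<Rightarrow> 'q set \<Rightarrow> bool" where
  "divisorial_ideal Q H I \<longleftrightarrow> I \<subseteq> H \<and> v_closure Q H I = I"

definition mori_monoid :: "('a, 'm) monoid_scheme \<Rightarrow> bool" where
  "mori_monoid H \<longleftrightarrow> comm_monoid_cancel H \<and>
     (\<forall>I :: nat \<Rightarrow> ('a \<times> 'a) set set.
        (\<forall>n. divisorial_ideal (quotient_group H) (embedded H) (I n)) \<and> (\<forall>n. I n \<subseteq> I (Suc n)) \<longrightarrow>
        (\<exists>N. \<forall>n\<ge>N. I n = I N))"

definition complete_integral_closure :: "('q, 'm) monoid_scheme \<Rightarrow> 'q set \<Rightarrow> 'q set" where
  "complete_integral_closure Q H =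
     {x \<in> carrier Q. \<exists>c\<in>H. \<forall>n::nat. n \<ge> 1 \<longrightarrow> c \<otimes>\<^bsub>Q\<^esub> x [^]\<^bsub>Q\<^esub> n \<in> H}"

definition fractional_v_ideals :: "('q, 'm) monoid_scheme \<Rightarrow> 'q set \<Rightarrow> 'q set monoid" where
  "fractional_v_ideals Q H =
     \<lparr>carrier = {c <#\<^bsub>Q\<^esub> I |c I. c \<in> carrier Q \<and> divisorial_ideal Q H I},
      mult = (\<lambda>I J. v_closure Q H (I <#>\<^bsub>Q\<^esub> J)),
      one = H\<rparr>"

definition v_class_group :: "('q, 'm) monoid_scheme \<Rightarrow> 'q set \<Rightarrow> 'q set set monoid" where
  "v_class_group Q H =
     units_of (fractional_v_ideals Q H) Mod {a <#\<^bsub>Q\<^esub> H |a. a \<in> carrier Q}"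

section \<open>C-monoids\<close>

definition equivalence_class :: "('f, 'm) monoid_scheme \<Rightarrow> 'f set \<Rightarrow> 'f \<Rightarrow> 'f set" where
  "equivalence_class F H y =
     {y' \<in> carrier F. \<forall>x\<in>carrier F. x \<otimes>\<^bsub>F\<^esub> y \<in> H \<longleftrightarrow> x \<otimes>\<^bsub>F\<^esub> y' \<in> H}"

definition reduced_class_semigroup :: "('f, 'm) monoid_scheme \<Rightarrow> 'f set \<Rightarrow> 'f set set" where
  "reduced_class_semigroup F H =
     equivalence_class F H ` ((carrier F - Units F) \<union> {\<one>\<^bsub>F\<^esub>})"

definition C_monoid_defined_in :: "('f, 'm) monoid_scheme \<Rightarrow> 'f set \<Rightarrow> bool" where
  "C_monoid_defined_in F H \<longleftrightarrow> factorial_monoid F \<and> submonoid H F \<and>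
     H \<inter> Units F = Units (F\<lparr>carrier := H\<rparr>) \<and> finite (reduced_class_semigroup F H)"

text \<open>Containment of \<open>H\<close> in the factorial monoid \<open>F\<close> is up to isomorphism. A formula cannot quantify
  over types, so the type in which the carrier of \<open>F\<close> lives is a parameter. Instances at
  \<open>'a multiset + 'f\<close> with a free type variable \<open>'f\<close> have room for the free abelian monoid over
  a set of elements of type \<open>'a\<close> and, as \<open>'f\<close> varies, for every factorial monoid.\<close>

definition C_monoid :: "'f itself \<Rightarrow> ('a, 'm) monoid_scheme \<Rightarrow> bool" where
  "C_monoid TF H \<longleftrightarrow>
     (\<exists>(F :: 'f monoid) \<phi>. \<phi> \<in> hom H F \<and> inj_on \<phi> (carrier H) \<and>
        C_monoid_defined_in F (\<phi> ` carrier H))"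

end

theory Submission
  imports Defs Complex_Main
begin

text \<open>
  The group \<open>G\<close> is written additively in all comments; \<open>\<sigma>(S)\<close> is the sum of a sequence \<open>S\<close>,
  \<open>F(G)\<close> is the free abelian monoid over \<open>G\<close>, and \<open>B\<close> is the monoid of plus-minus weighted zero-sum
  sequences. Every condition is compared with finiteness of \<open>G\<close>.

  A sequence lies in \<open>B\<close> iff it splits into two parts with equal sums
  (\<open>pm_zero_sum_iff\<close>). Three consequences are used everywhere: \<open>S\<^sup>2 \<in> B\<close> for every sequence \<open>S\<close>;
  the sum of an element of \<open>B\<close> lies in \<open>2G\<close>; and if \<open>\<sigma>(S) = 2h\<close>, then \<open>S h\<^sup>2\<close> and \<open>h\<^sup>2\<close> lie in
  \<open>B\<close>. Hence the quotient group of \<open>B\<close> consists of the fractions of sequences with sum in \<open>2G\<close>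
  (\<open>exists_with_val\<close>), and its complete integral closure \<open>K\<close> consists of those fractions that are
  sequences (\<open>K_iff\<close>).

  Let \<open>G\<close> be finite. A sequence in \<open>B\<close> with an element \<open>g\<close> of multiplicity at least
  \<open>2 |G|\<close> has the factor \<open>g\<close> to the power \<open>|G|\<close>, with a cofactor in \<open>B\<close>, so \<open>B\<close> is finitely
  generated. The class of \<open>S\<close> in \<open>F(G)\<close> modulo \<open>B\<close> depends only on the set of signed sums of \<open>S\<close>, a
  subset of \<open>G\<close>, so \<open>B\<close> is a C-monoid in \<open>F(G)\<close> (\<open>C_monoid_if_finite\<close>). If \<open>S\<close> divides
  \<open>T\<close> in \<open>F(G)\<close> and the multiplicities of each element in them have equal parity, then \<open>T / S\<close> is a square and so lies in
  \<open>B\<close>; with Dickson's lemma this gives the ascending chain condition (\<open>mori_if_finite\<close>). A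
  nonempty divisorial ideal of \<open>K\<close> is cut out by one element of the quotient group of \<open>F(G)\<close>, and the sum of
  that element determines the class of the ideal, so the class group is finite.

  Let conversely \<open>G\<close> be infinite. Since \<open>g\<^sup>2 \<in> B\<close> for all \<open>g\<close>, no finite set generates \<open>B\<close>. For
  the other conditions the infinitude of \<open>G\<close> is tested on \<open>2G\<close> and on \<open>G / 2G\<close>.

  If \<open>2G\<close> is infinite, there are \<open>b\<^sub>n \<in> B\<close> and sequences \<open>x\<^sub>k\<close> with \<open>b\<^sub>n x\<^sub>k \<in> B\<close> for \<open>k < n\<close>,
  but \<open>b\<^sub>n x\<^sub>n \<notin> B\<close>, and a common \<open>c\<close> with \<open>c x\<^sub>k \<in> B\<close> (\<open>separating_sequences\<close>). The
  divisorial ideals generated by \<open>c x\<^sub>0, \<dots>, c x\<^sub>n\<close> then form a strictly ascending chain, and the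
  \<open>b\<^sub>n\<close> are pairwise inequivalent, even with respect to an arbitrary factorial overmonoid, because
  \<open>x\<^sub>k\<^sup>2 \<in> B\<close> and factorial monoids are root closed.

  So let \<open>2G\<close> be finite. Sending a divisorial ideal of \<open>K\<close> to the sum of its greatest common
  divisor in the quotient group of \<open>F(G)\<close> maps the class group onto \<open>G / 2G\<close>; if it is finitely
  generated, then \<open>G\<close> is generated by a finite set together with \<open>2G\<close>, hence finite
  (\<open>finite_if_fin_gen_class_group\<close>). If \<open>B\<close> is a C-monoid in a factorial monoid, divisibility
  there implies divisibility in \<open>F(G)\<close> (\<open>saturated\<close>); an element \<open>g\<close> is the greatest common divisor
  in \<open>F(G)\<close> of two elements of \<open>B\<close>, and the corresponding greatest common divisors in the factorial monoid
  are inequivalent for \<open>g\<close> from different cosets of \<open>2G\<close> (\<open>gcd_detects\<close>).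
\<close>

section \<open>Sums of sequences\<close>

context comm_group
begin

definition sigma :: "'a multiset \<Rightarrow> 'a" where
  "sigma s = (\<Otimes>g\<in>set_mset s. g [^] count s g)"

definition doubles :: "'a set" where
  "doubles = (\<lambda>h. h \<otimes> h) ` carrier G"

lemma sigma_superset:
  assumes "set_mset s \<subseteq> A" "finite A" "A \<subseteq> carrier G"
  shows "sigma s = (\<Otimes>g\<in>A. g [^] count s g)"
  unfolding sigma_def
  by (rule finprod_mono_neutral_cong_left) (use assms in \<open>auto simp: not_in_iff\<close>)

lemma sigma_closed [simp]: "set_mset s \<subseteq> carrier G \<Longrightarrow> sigma s \<in> carrier G"
  unfolding sigma_def by (rule finprod_closed) auto

lemma sigma_empty [simp]: "sigma {#} = \<one>"
  by (simp add: sigma_def)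

lemma sigma_single [simp]: "g \<in> carrier G \<Longrightarrow> sigma {#g#} = g"
  by (simp add: sigma_def)

lemma sigma_union [simp]:
  assumes "set_mset s \<subseteq> carrier G" "set_mset t \<subseteq> carrier G"
  shows "sigma (s + t) = sigma s \<otimes> sigma t"
proof -
  let ?A = "set_mset s \<union> set_mset t"
  have "sigma (s + t) = (\<Otimes>g\<in>?A. g [^] count (s + t) g)"
    by (rule sigma_superset) (use assms in auto)
  also have "\<dots> = (\<Otimes>g\<in>?A. (g [^] count s g) \<otimes> (g [^] count t g))"
    by (rule finprod_cong') (use assms in \<open>auto simp: nat_pow_mult subset_iff\<close>)
  also have "\<dots> = (\<Otimes>g\<in>?A. g [^] count s g) \<otimes> (\<Otimes>g\<in>?A. g [^] count t g)"
    by (rule finprod_multf) (use assms in auto)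
  also have "\<dots> = sigma s \<otimes> sigma t"
    using assms sigma_superset[of s ?A] sigma_superset[of t ?A] by auto
  finally show ?thesis .
qed

lemma sigma_add_mset [simp]:
  assumes "g \<in> carrier G" "set_mset s \<subseteq> carrier G"
  shows "sigma (add_mset g s) = g \<otimes> sigma s"
  using sigma_union[of "{#g#}" s] assms by simp

lemma doubles_subset: "doubles \<subseteq> carrier G"
  by (auto simp: doubles_def)

lemma doublesI: "h \<in> carrier G \<Longrightarrow> h \<otimes> h \<in> doubles"
  by (auto simp: doubles_def)

lemma doublesE:
  assumes "x \<in> doubles" obtains h where "h \<in> carrier G" "x = h \<otimes> h"
  using assms unfolding doubles_def by blast

lemma subgroup_doubles: "subgroup doubles G"
proof
  show "doubles \<subseteq> carrier G" by (rule doubles_subset)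
  show "\<one> \<in> doubles" using doublesI[of \<one>] by simp
  show "x \<otimes> y \<in> doubles" if xy: "x \<in> doubles" "y \<in> doubles" for x y
  proof -
    obtain h where h: "h \<in> carrier G" "x = h \<otimes> h" using doublesE xy by blast
    obtain k where k: "k \<in> carrier G" "y = k \<otimes> k" using doublesE xy by blast
    have "x \<otimes> y = (h \<otimes> k) \<otimes> (h \<otimes> k)" using h k by (simp add: m_ac)
    then show ?thesis using doublesI[of "h \<otimes> k"] h k by simp
  qed
  show "inv x \<in> doubles" if x: "x \<in> doubles" for x
  proof -
    obtain h where h: "h \<in> carrier G" "x = h \<otimes> h" using doublesE x by blast
    have "inv x = inv h \<otimes> inv h" using h by (simp add: inv_mult)
    then show ?thesis using doublesI[of "inv h"] h by simp
  qed
qed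

text \<open>The positions with sign \<open>1\<close> and with sign \<open>-1\<close> form two subsequences; in this way the signs,
  which depend on an ordering of the sequence, are replaced by a decomposition of a multiset.\<close>

lemma signed_list_split:
  assumes "set gs \<subseteq> carrier G" "\<And>i. i < length gs \<Longrightarrow> \<epsilon> i \<in> {-1, 1 :: int}"
  shows "\<exists>a b. mset gs = a + b \<and>
           (\<Otimes>i\<in>{..<length gs}. (gs ! i) [^] \<epsilon> i) = sigma a \<otimes> inv (sigma b)"
  using assms
proof (induction gs rule: rev_induct)
  case Nil
  then show ?case by simp
next
  case (snoc g gs)
  have "set gs \<subseteq> carrier G" "\<And>i. i < length gs \<Longrightarrow> \<epsilon> i \<in> {-1, 1}"
    using snoc.prems(1) snoc.prems(2) by (simp_all del: insert_iff)
  from snoc.IH[OF this] obtain a b where ab: "mset gs = a + b"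
    "(\<Otimes>i\<in>{..<length gs}. (gs ! i) [^] \<epsilon> i) = sigma a \<otimes> inv (sigma b)"
    by blast
  have "set_mset (a + b) \<subseteq> carrier G"
    using snoc.prems ab(1) by (metis (no_types, lifting) set_append set_mset_mset le_supE)
  then have s: "set_mset a \<subseteq> carrier G" "set_mset b \<subseteq> carrier G" by auto
  have g: "g \<in> carrier G" using snoc.prems by simp
  have "(\<Otimes>i\<in>{..<length (gs @ [g])}. ((gs @ [g]) ! i) [^] \<epsilon> i)
      = (g [^] \<epsilon> (length gs)) \<otimes> (\<Otimes>i\<in>{..<length gs}. ((gs @ [g]) ! i) [^] \<epsilon> i)"
    using snoc.prems(1) by (simp add: lessThan_Suc finprod_insert Pi_def nth_append subset_iff)
  also have "(\<Otimes>i\<in>{..<length gs}. ((gs @ [g]) ! i) [^] \<epsilon> i)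
      = (\<Otimes>i\<in>{..<length gs}. (gs ! i) [^] \<epsilon> i)"
    by (rule finprod_cong') (use snoc.prems(1) in \<open>auto simp: nth_append subset_iff\<close>)
  finally have *: "(\<Otimes>i\<in>{..<length (gs @ [g])}. ((gs @ [g]) ! i) [^] \<epsilon> i)
      = (g [^] \<epsilon> (length gs)) \<otimes> (sigma a \<otimes> inv (sigma b))" using ab by simp
  show ?case
  proof (cases "\<epsilon> (length gs) = 1")
    case True
    then show ?thesis
      using * ab(1) s g int_pow_1[OF g] by (intro exI[of _ "add_mset g a"] exI[of _ b]) (simp add: m_assoc)
  next
    case False
    then have "\<epsilon> (length gs) = -1" using snoc.prems(2)[of "length gs"] by auto
    then have "g [^] \<epsilon> (length gs) = inv g" using g by (simp add: int_pow_neg)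
    then show ?thesis
      using * ab(1) s g by (intro exI[of _ a] exI[of _ "add_mset g b"]) (simp add: inv_mult m_ac)
  qed
qed

text \<open>Converse of the previous lemma: each decomposition of the multiset comes from signs on any given
  ordering, by choosing for the last element a part that contains it.\<close>

lemma signed_list_realize:
  assumes "set gs \<subseteq> carrier G" "mset gs = a + b"
  shows "\<exists>\<epsilon>. (\<forall>i. \<epsilon> i \<in> {-1, 1 :: int}) \<and>
           (\<Otimes>i\<in>{..<length gs}. (gs ! i) [^] \<epsilon> i) = sigma a \<otimes> inv (sigma b)"
  using assms
proof (induction gs arbitrary: a b rule: rev_induct)
  case Nil
  then show ?case by (intro exI[of _ "\<lambda>_. 1"]) simp
next
  case (snoc g gs)
  have sub: "set_mset (a + b) \<subseteq> carrier G" using snoc.prems by (metis set_mset_mset)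
  then have s: "set_mset a \<subseteq> carrier G" "set_mset b \<subseteq> carrier G" by auto
  have g: "g \<in> carrier G" and gs: "set gs \<subseteq> carrier G" using snoc.prems by auto
  have step: "(\<Otimes>i\<in>{..<length (gs @ [g])}. ((gs @ [g]) ! i) [^] (\<epsilon>(length gs := e)) i)
      = (g [^] e) \<otimes> (\<Otimes>i\<in>{..<length gs}. (gs ! i) [^] \<epsilon> i)" for \<epsilon> and e :: int
  proof -
    have "(\<Otimes>i\<in>{..<length gs}. ((gs @ [g]) ! i) [^] (\<epsilon>(length gs := e)) i)
      = (\<Otimes>i\<in>{..<length gs}. (gs ! i) [^] \<epsilon> i)"
      by (rule finprod_cong') (use gs in \<open>auto simp: nth_append subset_iff\<close>)
    moreover have "(\<Otimes>i\<in>{..<length (gs @ [g])}. ((gs @ [g]) ! i) [^] (\<epsilon>(length gs := e)) i)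
      = (g [^] e) \<otimes> (\<Otimes>i\<in>{..<length gs}. ((gs @ [g]) ! i) [^] (\<epsilon>(length gs := e)) i)"
      using gs g by (simp add: lessThan_Suc finprod_insert Pi_def nth_append subset_iff)
    ultimately show ?thesis by simp
  qed
  have "g \<in># a + b" using snoc.prems(2) by (metis in_multiset_in_set set_append UnI2 list.set_intros(1))
  then consider "g \<in># a" | "g \<in># b" by auto
  then show ?case
  proof cases
    case 1
    define a' where "a' = a - {#g#}"
    have a: "a = add_mset g a'" using 1 by (simp add: a'_def)
    obtain \<epsilon> where e: "\<forall>i. \<epsilon> i \<in> {-1, 1 :: int}"
      "(\<Otimes>i\<in>{..<length gs}. (gs ! i) [^] \<epsilon> i) = sigma a' \<otimes> inv (sigma b)"
      using snoc.IH[OF gs, of a' b] snoc.prems(2) a by auto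
    show ?thesis
      by (intro exI[of _ "\<epsilon>(length gs := 1)"]) (use step[of \<epsilon> 1] e a s g in \<open>simp add: m_assoc\<close>)
  next
    case 2
    define b' where "b' = b - {#g#}"
    have b: "b = add_mset g b'" using 2 by (simp add: b'_def)
    obtain \<epsilon> where e: "\<forall>i. \<epsilon> i \<in> {-1, 1 :: int}"
      "(\<Otimes>i\<in>{..<length gs}. (gs ! i) [^] \<epsilon> i) = sigma a \<otimes> inv (sigma b')"
      using snoc.IH[OF gs, of a b'] snoc.prems(2) b by auto
    show ?thesis
      by (intro exI[of _ "\<epsilon>(length gs := -1)"])
        (use step[of \<epsilon> "-1"] e b s g in \<open>simp add: int_pow_neg inv_mult m_ac\<close>)
  qed
qed

lemma eq_if_mult_inv_one:
  assumes "x \<in> carrier G" "y \<in> carrier G" "x \<otimes> inv y = \<one>"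
  shows "x = y"
proof -
  have "x = (x \<otimes> inv y) \<otimes> y" using assms(1,2) by (simp add: m_assoc)
  then show ?thesis using assms by simp
qed

lemma pm_zero_sum_iff:
  "s \<in> pm_zero_sum_sequences G \<longleftrightarrow>
     set_mset s \<subseteq> carrier G \<and> (\<exists>a b. s = a + b \<and> sigma a = sigma b)"
proof
  assume "s \<in> pm_zero_sum_sequences G"
  then obtain gs \<epsilon> where g: "s = mset gs" "set gs \<subseteq> carrier G"
    "\<forall>i<length gs. \<epsilon> i \<in> {-1, 1 :: int}"
    "(\<Otimes>i\<in>{..<length gs}. (gs ! i) [^] \<epsilon> i) = \<one>"
    unfolding pm_zero_sum_sequences_def by auto
  from signed_list_split[OF g(2)] g(3) obtain a b where ab: "mset gs = a + b"
    "(\<Otimes>i\<in>{..<length gs}. (gs ! i) [^] \<epsilon> i) = sigma a \<otimes> inv (sigma b)" by blast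
  have "set_mset (a + b) \<subseteq> carrier G" using ab g by (metis set_mset_mset)
  then have "sigma a \<in> carrier G" "sigma b \<in> carrier G" by auto
  moreover have "sigma a \<otimes> inv (sigma b) = \<one>" by (rule trans[OF ab(2)[symmetric] g(4)])
  ultimately have "sigma a = sigma b" by (rule eq_if_mult_inv_one)
  then show "set_mset s \<subseteq> carrier G \<and> (\<exists>a b. s = a + b \<and> sigma a = sigma b)"
    using ab g \<open>set_mset (a + b) \<subseteq> carrier G\<close> by auto
next
  assume "set_mset s \<subseteq> carrier G \<and> (\<exists>a b. s = a + b \<and> sigma a = sigma b)"
  then obtain a b where ab: "set_mset s \<subseteq> carrier G" "s = a + b" "sigma a = sigma b" by blast
  obtain gs where gs: "mset gs = s" using ex_mset by blast
  have "set gs \<subseteq> carrier G" using gs ab(1) by (metis set_mset_mset)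
  from signed_list_realize[OF this] gs ab obtain \<epsilon> where
    e: "\<forall>i. \<epsilon> i \<in> {-1, 1 :: int}" and
    p: "(\<Otimes>i\<in>{..<length gs}. (gs ! i) [^] \<epsilon> i) = sigma a \<otimes> inv (sigma b)"
    by blast
  have "sigma a \<otimes> inv (sigma b) = \<one>" using ab by (auto intro: r_inv)
  with p have "(\<Otimes>i\<in>{..<length gs}. (gs ! i) [^] \<epsilon> i) = \<one>" by (rule trans)
  then show "s \<in> pm_zero_sum_sequences G"
    unfolding pm_zero_sum_sequences_def using gs e \<open>set gs \<subseteq> carrier G\<close> by blast
qed

lemma pm_carrier: "s \<in> pm_zero_sum_sequences G \<Longrightarrow> set_mset s \<subseteq> carrier G"
  by (simp add: pm_zero_sum_iff)

lemma pmI: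
  "set_mset a \<subseteq> carrier G \<Longrightarrow> set_mset b \<subseteq> carrier G \<Longrightarrow> sigma a = sigma b
    \<Longrightarrow> a + b \<in> pm_zero_sum_sequences G"
  by (auto simp: pm_zero_sum_iff)

lemma pm_empty [simp]: "{#} \<in> pm_zero_sum_sequences G"
  by (auto simp: pm_zero_sum_iff)

lemma pm_double: "set_mset s \<subseteq> carrier G \<Longrightarrow> s + s \<in> pm_zero_sum_sequences G"
  by (rule pmI) auto

lemma pm_add:
  assumes "s \<in> pm_zero_sum_sequences G" "t \<in> pm_zero_sum_sequences G"
  shows "s + t \<in> pm_zero_sum_sequences G"
proof -
  obtain a b where 1: "s = a + b" "sigma a = sigma b" "set_mset s \<subseteq> carrier G"
    using assms by (auto simp: pm_zero_sum_iff)
  obtain c d where 2: "t = c + d" "sigma c = sigma d" "set_mset t \<subseteq> carrier G"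
    using assms by (auto simp: pm_zero_sum_iff)
  have "(a + c) + (b + d) \<in> pm_zero_sum_sequences G"
    by (rule pmI) (use 1 2 in auto)
  then show ?thesis using 1 2 by (simp add: ac_simps)
qed

lemma sigma_pm:
  assumes "s \<in> pm_zero_sum_sequences G"
  shows "sigma s \<in> doubles"
proof -
  obtain a b where 1: "s = a + b" "sigma a = sigma b" "set_mset s \<subseteq> carrier G"
    using assms by (auto simp: pm_zero_sum_iff)
  then show ?thesis by (auto simp: doubles_def)
qed

text \<open>This is what makes the quotient group of the monoid computable: a sequence with sum in \<open>2G\<close> is a
  quotient of two plus-minus weighted zero-sum sequences.\<close>

lemma pm_if_sigma_double:
  assumes "set_mset s \<subseteq> carrier G" "h \<in> carrier G" "sigma s = h \<otimes> h"
  shows "s + {#h, h#} \<in> pm_zero_sum_sequences G"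
  by (rule pmI) (use assms in auto)

section \<open>Signed sums\<close>

definition signed_sums :: "'a multiset \<Rightarrow> 'a set" where
  "signed_sums s = {sigma a \<otimes> inv (sigma b) |a b. s = a + b}"

text \<open>Riesz refinement for multisets: two decompositions of a multiset have a common refinement.\<close>

lemma multiset_refinement:
  assumes "a + b = s + (t :: 'a multiset)"
  obtains a1 a2 b1 b2 where "a = a1 + a2" "b = b1 + b2" "s = a1 + b1" "t = a2 + b2"
proof
  have c: "count a x + count b x = count s x + count t x" for x
    using assms by (metis count_union)
  show "a = (a \<inter># s) + (a - s)" by (auto simp: multiset_eq_iff)
  show "s = (a \<inter># s) + (s - a)" by (auto simp: multiset_eq_iff)
  have "count b x = (count s x - count a x) + (count b x - (count s x - count a x))"
    "count t x = (count a x - count s x) + (count b x - (count s x - count a x))" for x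
    using c[of x] by linarith+
  then show "b = (s - a) + (b - (s - a))" "t = (a - s) + (b - (s - a))"
    unfolding multiset_eq_iff by simp_all
qed

lemma signed_sumsI: "s = a + b \<Longrightarrow> x = sigma a \<otimes> inv (sigma b) \<Longrightarrow> x \<in> signed_sums s"
  unfolding signed_sums_def by blast

lemma signed_sums_union:
  assumes "set_mset s \<subseteq> carrier G" "set_mset t \<subseteq> carrier G"
  shows "signed_sums (s + t) = {x \<otimes> y |x y. x \<in> signed_sums s \<and> y \<in> signed_sums t}"
proof (intro equalityI subsetI)
  fix z assume "z \<in> signed_sums (s + t)"
  then obtain a b where "s + t = a + b" and z: "z = sigma a \<otimes> inv (sigma b)"
    unfolding signed_sums_def by blast
  then have ab: "a + b = s + t" by simp
  obtain a1 a2 b1 b2 where d: "a = a1 + a2" "b = b1 + b2" "s = a1 + b1" "t = a2 + b2"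
    using multiset_refinement[OF ab(1)] by blast
  have c: "set_mset a1 \<subseteq> carrier G" "set_mset a2 \<subseteq> carrier G"
     "set_mset b1 \<subseteq> carrier G" "set_mset b2 \<subseteq> carrier G" using assms d by auto
  have "z = (sigma a1 \<otimes> inv (sigma b1)) \<otimes> (sigma a2 \<otimes> inv (sigma b2))"
    using c d z by (simp add: inv_mult m_ac)
  then show "z \<in> {x \<otimes> y |x y. x \<in> signed_sums s \<and> y \<in> signed_sums t}"
    using d signed_sumsI by blast
next
  fix z assume "z \<in> {x \<otimes> y |x y. x \<in> signed_sums s \<and> y \<in> signed_sums t}"
  then obtain a1 a2 b1 b2 where d: "s = a1 + b1" "t = a2 + b2"
    "z = (sigma a1 \<otimes> inv (sigma b1)) \<otimes> (sigma a2 \<otimes> inv (sigma b2))"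
    unfolding signed_sums_def by blast
  have c: "set_mset a1 \<subseteq> carrier G" "set_mset a2 \<subseteq> carrier G"
     "set_mset b1 \<subseteq> carrier G" "set_mset b2 \<subseteq> carrier G" using assms d by auto
  have "z = sigma (a1 + a2) \<otimes> inv (sigma (b1 + b2))"
    using c d(3) by (simp add: inv_mult m_ac)
  moreover have "s + t = (a1 + a2) + (b1 + b2)" using d by (simp add: ac_simps)
  ultimately show "z \<in> signed_sums (s + t)" by (rule signed_sumsI[rotated])
qed

lemma pm_iff_one_in_signed_sums:
  assumes "set_mset s \<subseteq> carrier G"
  shows "s \<in> pm_zero_sum_sequences G \<longleftrightarrow> \<one> \<in> signed_sums s"
proof -
  have "sigma a = sigma b \<longleftrightarrow> \<one> = sigma a \<otimes> inv (sigma b)" if "s = a + b" for a b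
    using that assms eq_if_mult_inv_one[of "sigma a" "sigma b"] by auto
  then show ?thesis using assms unfolding pm_zero_sum_iff signed_sums_def by blast
qed

text \<open>Whether \<open>S T\<close> has plus-minus weighted sum zero depends on \<open>S\<close> only through its signed sums.\<close>

lemma pm_union_iff:
  assumes "set_mset s \<subseteq> carrier G" "set_mset t \<subseteq> carrier G"
  shows "s + t \<in> pm_zero_sum_sequences G \<longleftrightarrow> (\<exists>x\<in>signed_sums s. \<exists>y\<in>signed_sums t. x \<otimes> y = \<one>)"
proof -
  have "set_mset (s + t) \<subseteq> carrier G" using assms by simp
  then have "s + t \<in> pm_zero_sum_sequences G \<longleftrightarrow> \<one> \<in> signed_sums (s + t)"
    by (rule pm_iff_one_in_signed_sums)
  then show ?thesis unfolding signed_sums_union[OF assms] mem_Collect_eq by metis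
qed

lemma signed_sums_subset: "set_mset s \<subseteq> carrier G \<Longrightarrow> signed_sums s \<subseteq> carrier G"
  by (auto simp: signed_sums_def)

end

lemma free_monoid_simps [simp]:
  "carrier (free_abelian_monoid X) = {s. set_mset s \<subseteq> X}"
  "mult (free_abelian_monoid X) = (+)"
  "one (free_abelian_monoid X) = {#}"
  by (simp_all add: free_abelian_monoid_def)

lemma pm_monoid_simps [simp]:
  "carrier (pm_zero_sum_monoid G) = pm_zero_sum_sequences G"
  "mult (pm_zero_sum_monoid G) = (+)"
  "one (pm_zero_sum_monoid G) = {#}"
  by (simp_all add: free_abelian_monoid_def pm_zero_sum_monoid_def)

section \<open>Free abelian monoids\<close>

lemma comm_monoid_cancel_via_multisets:
  fixes F (structure)
  assumes inj: "inj_on \<delta> (carrier F)"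
    and closed: "\<And>x y. x \<in> carrier F \<Longrightarrow> y \<in> carrier F \<Longrightarrow> x \<otimes> y \<in> carrier F"
    and mult: "\<And>x y. x \<in> carrier F \<Longrightarrow> y \<in> carrier F \<Longrightarrow> \<delta> (x \<otimes> y) = \<delta> x + (\<delta> y :: 'b multiset)"
    and one: "\<one> \<in> carrier F" "\<delta> \<one> = {#}"
  shows "comm_monoid_cancel F"
proof -
  have eqI: "x = y" if "x \<in> carrier F" "y \<in> carrier F" "\<delta> x = \<delta> y" for x y
    using inj that by (auto dest: inj_onD)
  have "comm_monoid F"
    by (rule comm_monoidI) (auto intro!: eqI simp: closed one mult ac_simps)
  then show ?thesis
    by (rule comm_monoid_cancelI) (metis add_right_cancel eqI mult)
qed

text \<open>The monoid is given together with an isomorphism \<open>\<delta>\<close> onto multisets, so that the result applies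
  both to sequences and to their copy in a sum type. Divisibility becomes inclusion of multisets, so
  divisor chains terminate by size, and an irreducible element is a singleton, which is prime.\<close>

lemma factorial_monoid_if_free:
  fixes F (structure)
  assumes bij: "bij_betw \<delta> (carrier F) {s. set_mset s \<subseteq> X}"
    and closed: "\<And>x y. x \<in> carrier F \<Longrightarrow> y \<in> carrier F \<Longrightarrow> x \<otimes> y \<in> carrier F"
    and mult: "\<And>x y. x \<in> carrier F \<Longrightarrow> y \<in> carrier F \<Longrightarrow> \<delta> (x \<otimes> y) = \<delta> x + (\<delta> y :: 'b multiset)"
    and one: "\<one> \<in> carrier F" "\<delta> \<one> = {#}"
  shows "factorial_monoid F" "Units F = {\<one>}"
proof -
  have inj: "inj_on \<delta> (carrier F)" using bij by (rule bij_betw_imp_inj_on)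
  interpret comm_monoid_cancel F
    by (rule comm_monoid_cancel_via_multisets[OF inj closed mult one])
  have eqI: "x = y" if "x \<in> carrier F" "y \<in> carrier F" "\<delta> x = \<delta> y" for x y
    using inj that by (auto dest: inj_onD)
  have sub: "set_mset (\<delta> x) \<subseteq> X" if "x \<in> carrier F" for x
    using bij that by (auto dest: bij_betwE)
  have surj: "\<exists>x\<in>carrier F. \<delta> x = s" if "set_mset s \<subseteq> X" for s
    using bij that unfolding bij_betw_def by (metis imageE mem_Collect_eq)
  have dvd: "x divides y \<longleftrightarrow> \<delta> x \<subseteq># \<delta> y" if "x \<in> carrier F" "y \<in> carrier F" for x y
  proof
    assume "x divides y"
    then show "\<delta> x \<subseteq># \<delta> y" using that mult by (auto simp: factor_def)
  next
    assume le: "\<delta> x \<subseteq># \<delta> y"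
    have "set_mset (\<delta> y - \<delta> x) \<subseteq> X" using sub[OF that(2)] by (auto dest: in_diffD)
    then obtain z where z: "z \<in> carrier F" "\<delta> z = \<delta> y - \<delta> x" using surj by blast
    then have "y = x \<otimes> z" using that le by (intro eqI) (auto simp: closed mult)
    then show "x divides y" using z by auto
  qed
  have unit: "x \<in> Units F \<longleftrightarrow> x = \<one>" for x
  proof
    assume "x \<in> Units F"
    then obtain y where "x \<in> carrier F" "y \<in> carrier F" "x \<otimes> y = \<one>" unfolding Units_def by blast
    then have "\<delta> x + \<delta> y = {#}" using mult[of x y] one by simp
    then have "\<delta> x = {#}" by simp
    then show "x = \<one>" using \<open>x \<in> carrier F\<close> one by (intro eqI) auto
  qed simp
  then show "Units F = {\<one>}" by auto
  have unit': "x \<in> Units F \<longleftrightarrow> \<delta> x = {#}" if "x \<in> carrier F" for x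
    using unit eqI that one by metis
  have dcc: "divisor_chain_condition_monoid F"
  proof
    have "{(x, y). x \<in> carrier F \<and> y \<in> carrier F \<and> properfactor F x y} \<subseteq> measure (\<lambda>x. size (\<delta> x))"
    proof clarify
      fix x y assume xy: "x \<in> carrier F" "y \<in> carrier F" "properfactor F x y"
      then have "\<delta> x \<subseteq># \<delta> y" "\<not> \<delta> y \<subseteq># \<delta> x" by (auto simp: properfactor_def dvd)
      then have "\<delta> x \<subset># \<delta> y" by (auto simp: subset_mset_def)
      then show "(x, y) \<in> measure (\<lambda>x. size (\<delta> x))" by (simp add: mset_subset_size)
    qed
    then show "wf {(x, y). x \<in> carrier F \<and> y \<in> carrier F \<and> properfactor F x y}"
      using wf_subset wf_measure by blast
  qed
  have prime: "primeness_condition_monoid F"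
  proof
    fix a assume a: "a \<in> carrier F" "irreducible F a"
    then have nu: "a \<notin> Units F" by (auto simp: irreducible_def)
    then obtain g where g: "g \<in># \<delta> a" using a unit' by (metis multiset_nonemptyE)
    then have "set_mset {#g#} \<subseteq> X" using sub a by auto
    then obtain c where c: "c \<in> carrier F" "\<delta> c = {#g#}" using surj by blast
    have "c divides a" using c a g by (simp add: dvd)
    moreover have "c \<notin> Units F" using c unit' by simp
    ultimately have "a divides c" using a c by (auto simp: irreducible_def properfactor_def)
    then have ag: "\<delta> a = {#g#}" using dvd a c g by (metis mset_subset_eq_single subset_mset.antisym)
    show "prime F a"
      using nu a by (auto simp: prime_def dvd ag mult closed)
  qed
  show "factorial_monoid F" using dcc prime factorial_condition_one by blast
qed

context comm_group
begin

section \<open>Finite generation\<close>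

text \<open>Of at least \<open>2 |G|\<close> copies of \<open>g\<close>, at least \<open>|G|\<close> carry the same sign, and \<open>|G|\<close> such copies
  contribute \<open>0\<close> to the weighted sum.\<close>

lemma pm_remove_power:
  assumes s: "s \<in> pm_zero_sum_sequences G" and fin: "finite (carrier G)"
    and big: "2 * order G \<le> count s g"
  shows "s - replicate_mset (order G) g \<in> pm_zero_sum_sequences G"
proof -
  let ?r = "replicate_mset (order G) g"
  obtain a b where ab: "s = a + b" "sigma a = sigma b" "set_mset s \<subseteq> carrier G"
    using s by (auto simp: pm_zero_sum_iff)
  have n: "order G > 0" using fin order_gt_0_iff_finite by blast
  then have "g \<in># s" using big by (metis count_greater_zero_iff gr0I le_0_eq mult_is_0 not_gr_zero zero_neq_numeral)
  then have g: "g \<in> carrier G" using ab by auto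
  have r: "set_mset ?r \<subseteq> carrier G" "sigma ?r = \<one>"
    using g n order_def[of G] power_order_eq_one[OF fin g] by (auto simp: sigma_def order_def split: if_splits)
  have drop: "sigma (c - ?r) = sigma c" if c: "set_mset c \<subseteq> carrier G" "?r \<subseteq># c" for c
  proof -
    have d: "set_mset (c - ?r) \<subseteq> carrier G" using c(1) by (auto dest: in_diffD)
    have "sigma c = sigma ((c - ?r) + ?r)" using c(2) by simp
    also have "\<dots> = sigma (c - ?r)" using d r by simp
    finally show ?thesis by simp
  qed
  have sub: "set_mset (c - ?r) \<subseteq> carrier G" if c: "set_mset c \<subseteq> carrier G" for c
    using c by (auto dest: in_diffD)
  have "count a g + count b g \<ge> 2 * order G" using big ab by simp
  then consider "order G \<le> count a g" | "order G \<le> count b g" by linarith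
  then show ?thesis
  proof cases
    case 1
    then have le: "?r \<subseteq># a" by (simp add: count_le_replicate_mset_subset_eq)
    have "(a - ?r) + b \<in> pm_zero_sum_sequences G"
      by (rule pmI) (use ab le drop sub in auto)
    moreover have "s - ?r = (a - ?r) + b"
      using le by (simp add: ab(1) multiset_eq_iff subseteq_mset_def)
    ultimately show ?thesis by simp
  next
    case 2
    then have le: "?r \<subseteq># b" by (simp add: count_le_replicate_mset_subset_eq)
    have "a + (b - ?r) \<in> pm_zero_sum_sequences G"
      by (rule pmI) (use ab le drop sub in auto)
    moreover have "s - ?r = a + (b - ?r)"
      using le by (simp add: ab(1) multiset_eq_iff subseteq_mset_def)
    ultimately show ?thesis by simp
  qed
qed

lemma finite_bounded_multisets:
  assumes "finite X"
  shows "finite {s :: 'a multiset. set_mset s \<subseteq> X \<and> (\<forall>g. count s g < n)}"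
proof -
  have "count ` {s :: 'a multiset. set_mset s \<subseteq> X \<and> (\<forall>g. count s g < n)}
      \<subseteq> {f. \<forall>x. (x \<in> X \<longrightarrow> f x \<in> {..<n}) \<and> (x \<notin> X \<longrightarrow> f x = 0)}"
    by (auto simp: subset_iff not_in_iff)
  then have "finite (count ` {s :: 'a multiset. set_mset s \<subseteq> X \<and> (\<forall>g. count s g < n)})"
    by (rule finite_subset) (rule finite_set_of_finite_funs[OF assms finite_lessThan])
  then show ?thesis by (rule finite_imageD) (simp add: count_inject inj_on_def)
qed

text \<open>If the group is finite, the elements with all multiplicities below \<open>2 |G|\<close> generate. If the monoid is
  generated by a finite set, only finitely many group elements occur in it at all, whereas every \<open>g\<close>
  occurs in \<open>g\<^sup>2\<close>.\<close>

theorem fin_gen_pm_iff: "fin_gen_monoid (pm_zero_sum_monoid G) \<longleftrightarrow> finite (carrier G)"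
proof
  assume "fin_gen_monoid (pm_zero_sum_monoid G)"
  then obtain E where E: "finite E" "E \<subseteq> pm_zero_sum_sequences G"
    "\<Inter>{N. submonoid N (pm_zero_sum_monoid G) \<and> E \<subseteq> N} = pm_zero_sum_sequences G"
    by (auto simp: fin_gen_monoid_def)
  let ?X = "\<Union>s\<in>E. set_mset s"
  \<comment> \<open>The submonoid of sequences supported on the elements that occur in generators.\<close>
  let ?N = "{s \<in> pm_zero_sum_sequences G. set_mset s \<subseteq> ?X}"
  have "submonoid ?N (pm_zero_sum_monoid G)"
    by (rule submonoid.intro) (auto intro: pm_add)
  moreover have "E \<subseteq> ?N" using E by auto
  ultimately have N: "pm_zero_sum_sequences G \<subseteq> ?N" using E(3) by blast
  have "carrier G \<subseteq> ?X"
  proof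
    fix g assume "g \<in> carrier G"
    then have "{#g#} + {#g#} \<in> pm_zero_sum_sequences G" by (intro pm_double) auto
    then show "g \<in> ?X" using N by auto
  qed
  then show "finite (carrier G)" by (rule finite_subset) (use E in auto)
next
  assume fin: "finite (carrier G)"
  let ?n = "order G"
  let ?B = "pm_zero_sum_sequences G"
  have n: "?n > 0" using fin order_gt_0_iff_finite by blast
  let ?E = "{s \<in> ?B. \<forall>g. count s g < 2 * ?n}"
  have "?E \<subseteq> {s. set_mset s \<subseteq> carrier G \<and> (\<forall>g. count s g < 2 * ?n)}"
    using pm_carrier by blast
  then have E: "finite ?E" by (rule finite_subset) (rule finite_bounded_multisets[OF fin])
  have gen: "s \<in> N" if N: "submonoid N (pm_zero_sum_monoid G)" "?E \<subseteq> N" and s: "s \<in> ?B" for N s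
    using s
  proof (induction "size s" arbitrary: s rule: less_induct)
    case less
    show ?case
    proof (cases "\<forall>g. count s g < 2 * ?n")
      case True
      then show ?thesis using less.prems N by blast
    next
      case False
      then obtain g where g: "2 * ?n \<le> count s g" by (auto simp: not_less)
      let ?r = "replicate_mset ?n g"
      have le: "?r \<subseteq># s" using g by (simp flip: count_le_replicate_mset_subset_eq)
      have "s - ?r \<in> ?B" by (rule pm_remove_power[OF less.prems fin g])
      moreover have "size (s - ?r) < size s"
        using le n by (simp add: size_Diff_submset) (metis n size_mset_mono size_replicate_mset diff_less less_le_trans)
      ultimately have 1: "s - ?r \<in> N" by (intro less.hyps) auto
      have gc: "g \<in> carrier G" using le n pm_carrier[OF less.prems]
        by (metis in_replicate_mset mset_subset_eqD subsetD gr0_conv_Suc nat.distinct(1))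
      have "?r + {#} \<in> ?B"
        by (rule pmI) (use gc n power_order_eq_one[OF fin gc] in \<open>auto simp: sigma_def order_def split: if_splits\<close>)
      then have "?r \<in> ?E" using n by auto
      then have "?r \<in> N" using N by blast
      then have "(s - ?r) + ?r \<in> N" using 1 submonoid.m_closed[OF N(1)] by fastforce
      then show ?thesis using le by simp
    qed
  qed
  have B: "submonoid ?B (pm_zero_sum_monoid G)"
    by (rule submonoid.intro) (auto intro: pm_add)
  have "\<Inter>{N. submonoid N (pm_zero_sum_monoid G) \<and> ?E \<subseteq> N} = ?B"
  proof (intro equalityI)
    show "\<Inter>{N. submonoid N (pm_zero_sum_monoid G) \<and> ?E \<subseteq> N} \<subseteq> ?B"
      using B by (intro Inter_lower) simp
    show "?B \<subseteq> \<Inter>{N. submonoid N (pm_zero_sum_monoid G) \<and> ?E \<subseteq> N}"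
      using gen by blast
  qed
  then show "fin_gen_monoid (pm_zero_sum_monoid G)"
    unfolding fin_gen_monoid_def pm_monoid_simps using E by (intro exI[of _ ?E] conjI) simp_all
qed

section \<open>C-monoids over finite groups\<close>

text \<open>The class of an element is determined by the signed sums of the corresponding sequence, and a finite
  group has only finitely many subsets.\<close>

lemma C_monoid_if_finite:
  fixes F :: "('f, 'x) monoid_scheme"
  assumes fin: "finite (carrier G)"
    and bij: "bij_betw \<delta> (carrier F) {s. set_mset s \<subseteq> carrier G}"
    and closed: "\<And>x y. x \<in> carrier F \<Longrightarrow> y \<in> carrier F \<Longrightarrow> x \<otimes>\<^bsub>F\<^esub> y \<in> carrier F"
    and mult: "\<And>x y. x \<in> carrier F \<Longrightarrow> y \<in> carrier F \<Longrightarrow> \<delta> (x \<otimes>\<^bsub>F\<^esub> y) = \<delta> x + \<delta> y"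
    and one: "\<one>\<^bsub>F\<^esub> \<in> carrier F" "\<delta> \<one>\<^bsub>F\<^esub> = {#}"
  shows "C_monoid_defined_in F {x \<in> carrier F. \<delta> x \<in> pm_zero_sum_sequences G}"
proof -
  let ?H = "{x \<in> carrier F. \<delta> x \<in> pm_zero_sum_sequences G}"
  note free = factorial_monoid_if_free[OF bij closed mult one]
  have sub: "submonoid ?H F"
    by (rule submonoid.intro) (auto simp: closed mult one pm_add)
  interpret F: factorial_monoid F by (rule free(1))
  have "Units (F\<lparr>carrier := ?H\<rparr>) \<subseteq> Units F"
    by (auto simp: Units_def)
  then have units: "?H \<inter> Units F = Units (F\<lparr>carrier := ?H\<rparr>)"
    using free(2) one by (auto simp: Units_def)
  have class_eq: "equivalence_class F ?H x = equivalence_class F ?H y"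
    if xy: "x \<in> carrier F" "y \<in> carrier F" "signed_sums (\<delta> x) = signed_sums (\<delta> y)" for x y
  proof -
    have c: "set_mset (\<delta> z) \<subseteq> carrier G" if "z \<in> carrier F" for z
      using bij that by (auto dest: bij_betwE)
    have "z \<otimes>\<^bsub>F\<^esub> x \<in> ?H \<longleftrightarrow> z \<otimes>\<^bsub>F\<^esub> y \<in> ?H" if "z \<in> carrier F" for z
      using that xy by (simp add: closed mult pm_union_iff c)
    then show ?thesis by (simp add: equivalence_class_def)
  qed
  let ?A = "(carrier F - Units F) \<union> {\<one>\<^bsub>F\<^esub>}"
  have A: "?A \<subseteq> carrier F" using one by auto
  have "reduced_class_semigroup F ?H
      = (\<lambda>X. equivalence_class F ?H (SOME y. y \<in> ?A \<and> signed_sums (\<delta> y) = X))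
          ` (\<lambda>y. signed_sums (\<delta> y)) ` ?A"
  proof -
    have "equivalence_class F ?H x
        = equivalence_class F ?H (SOME y. y \<in> ?A \<and> signed_sums (\<delta> y) = signed_sums (\<delta> x))"
      if "x \<in> ?A" for x
    proof -
      have "\<exists>y. y \<in> ?A \<and> signed_sums (\<delta> y) = signed_sums (\<delta> x)" using that by blast
      from someI_ex[OF this] show ?thesis using A that by (intro class_eq) auto
    qed
    then show ?thesis unfolding reduced_class_semigroup_def image_image by (intro image_cong) auto
  qed
  moreover have "(\<lambda>y. signed_sums (\<delta> y)) ` ?A \<subseteq> Pow (carrier G)"
    using A bij signed_sums_subset by (auto dest!: bij_betwE)
  then have "finite ((\<lambda>y. signed_sums (\<delta> y)) ` ?A)"
    by (rule finite_subset) (simp add: fin)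
  ultimately have "finite (reduced_class_semigroup F ?H)" by simp
  then show ?thesis unfolding C_monoid_defined_in_def using free(1) sub units by blast
qed

lemma C_monoid_in_free_if_finite:
  assumes "finite (carrier G)"
  shows "C_monoid_defined_in (free_abelian_monoid (carrier G)) (pm_zero_sum_sequences G)"
proof -
  have "C_monoid_defined_in (free_abelian_monoid (carrier G))
      {x \<in> carrier (free_abelian_monoid (carrier G)). id x \<in> pm_zero_sum_sequences G}"
    by (rule C_monoid_if_finite[OF assms]) (auto simp: bij_betw_def)
  moreover have "{x \<in> carrier (free_abelian_monoid (carrier G)). id x \<in> pm_zero_sum_sequences G}
    = pm_zero_sum_sequences G" using pm_carrier by auto
  ultimately show ?thesis by simp
qed

lemma C_monoid_pm_if_finite:
  assumes "finite (carrier G)"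
  shows "C_monoid TYPE('a multiset + 'f) (pm_zero_sum_monoid G)"
proof -
  define F :: "('a multiset + 'f) monoid" where
    "F = \<lparr>carrier = Inl ` {s. set_mset s \<subseteq> carrier G},
          mult = (\<lambda>x y. Inl (projl x + projl y)), one = Inl {#}\<rparr>"
  have "C_monoid_defined_in F {x \<in> carrier F. projl x \<in> pm_zero_sum_sequences G}"
    by (rule C_monoid_if_finite[OF assms]) (auto simp: bij_betw_def F_def inj_on_def image_image)
  moreover have "{x \<in> carrier F. projl x \<in> pm_zero_sum_sequences G}
    = Inl ` carrier (pm_zero_sum_monoid G)" using pm_carrier by (auto simp: F_def)
  ultimately have C: "C_monoid_defined_in F (Inl ` carrier (pm_zero_sum_monoid G))" by simp
  have hom: "Inl \<in> hom (pm_zero_sum_monoid G) F"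
  proof (rule homI)
    fix s t assume "s \<in> carrier (pm_zero_sum_monoid G)" "t \<in> carrier (pm_zero_sum_monoid G)"
    then show "Inl s \<in> carrier F"
      "Inl (s \<otimes>\<^bsub>pm_zero_sum_monoid G\<^esub> t) = Inl s \<otimes>\<^bsub>F\<^esub> Inl t"
      using pm_carrier[of s] by (simp_all add: F_def)
  qed
  show ?thesis unfolding C_monoid_def
    by (rule exI[of _ F], rule exI[of _ Inl], intro conjI hom C inj_Inl)
qed

end

section \<open>Sequences that separate infinitely many elements\<close>

context comm_group
begin

lemma signed_sums_empty: "signed_sums {#} = {\<one>}"
  by (auto simp: signed_sums_def)

lemma signed_sums_single:
  assumes "g \<in> carrier G"
  shows "signed_sums {#g#} = {g, inv g}"
proof
  show "signed_sums {#g#} \<subseteq> {g, inv g}"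
  proof
  fix x assume "x \<in> signed_sums {#g#}"
  then obtain a b where ab: "{#g#} = a + b" "x = sigma a \<otimes> inv (sigma b)"
    unfolding signed_sums_def by blast
  then have "a = {#g#} \<and> b = {#} \<or> a = {#} \<and> b = {#g#}" by (metis union_is_single)
  then show "x \<in> {g, inv g}" using ab assms by auto
  qed
  have "g \<in> signed_sums {#g#}" by (rule signed_sumsI[of _ "{#g#}" "{#}"]) (simp_all add: assms)
  moreover have "inv g \<in> signed_sums {#g#}"
    by (rule signed_sumsI[of _ "{#}" "{#g#}"]) (simp_all add: assms)
  ultimately show "{g, inv g} \<subseteq> signed_sums {#g#}" by simp
qed

lemma signed_sums_pair:
  assumes "g \<in> carrier G" "h \<in> carrier G"
  shows "signed_sums {#g, h#} = {g \<otimes> h, g \<otimes> inv h, inv g \<otimes> h, inv g \<otimes> inv h}"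
proof -
  have "signed_sums ({#g#} + {#h#}) = {x \<otimes> y |x y. x \<in> {g, inv g} \<and> y \<in> {h, inv h}}"
    using assms by (subst signed_sums_union) (simp_all add: signed_sums_single)
  then show ?thesis by (auto simp: add_mset_commute)
qed

lemma signed_sums_inv:
  assumes "set_mset s \<subseteq> carrier G" "x \<in> signed_sums s"
  shows "inv x \<in> signed_sums s"
proof -
  obtain a b where ab: "s = a + b" "x = sigma a \<otimes> inv (sigma b)"
    using assms(2) unfolding signed_sums_def by blast
  then have "inv x = sigma b \<otimes> inv (sigma a)" using assms(1) by (simp add: inv_mult m_comm)
  then show ?thesis using ab by (intro signed_sumsI[of _ b a]) auto
qed

lemma finite_signed_sums: "finite (signed_sums s)"
proof -
  have "signed_sums s \<subseteq> (\<lambda>a. sigma a \<otimes> inv (sigma (s - a))) ` {a. a \<subseteq># s}"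
  proof
    fix x assume "x \<in> signed_sums s"
    then obtain a b where "s = a + b" "x = sigma a \<otimes> inv (sigma b)"
      unfolding signed_sums_def by blast
    then show "x \<in> (\<lambda>a. sigma a \<otimes> inv (sigma (s - a))) ` {a. a \<subseteq># s}"
      by (intro image_eqI[of _ _ a]) simp_all
  qed
  moreover have "{a. a \<subseteq># s} \<subseteq> {a. set_mset a \<subseteq> set_mset s \<and> (\<forall>g. count a g < Suc (size s))}"
  proof clarify
    fix a assume a: "a \<subseteq># s"
    have "count a g \<le> size s" for g
      using a count_le_size[of a g] size_mset_mono[OF a] by linarith
    then show "set_mset a \<subseteq> set_mset s \<and> (\<forall>g. count a g < Suc (size s))"
      using set_mset_mono[OF a] by (simp add: le_imp_less_Suc)
  qed
  then have "finite {a. a \<subseteq># s}"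
    by (rule finite_subset) (rule finite_bounded_multisets, simp)
  ultimately show ?thesis using finite_subset by blast
qed

lemma mult_inv_cancel_middle:
  assumes "a \<in> carrier G" "b \<in> carrier G" "h \<in> carrier G"
  shows "(a \<otimes> inv h) \<otimes> (b \<otimes> h) = a \<otimes> b"
proof -
  have "(a \<otimes> inv h) \<otimes> (b \<otimes> h) = (a \<otimes> b) \<otimes> (inv h \<otimes> h)"
    using assms by (simp add: m_ac del: l_inv r_inv)
  then show ?thesis using assms by simp
qed

text \<open>The obstruction caused by an infinite \<open>2G\<close>. Fix \<open>h\<close> with \<open>2h \<noteq> 0\<close> and choose \<open>y\<^sub>0, y\<^sub>1, \<dots>\<close> such that
  \<open>2y\<^sub>n\<close> is no signed sum of \<open>h\<^sup>2 b\<^sub>n\<close>, where \<open>b\<^sub>n = y\<^sub>0\<^sup>2 \<cdots> y\<^sub>n\<^sub>-\<^sub>1\<^sup>2\<close>. Put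
  \<open>x\<^sub>n = (y\<^sub>n - h)(y\<^sub>n + h)\<close> and \<open>c = h\<^sup>2\<close>. The signed sums of \<open>x\<^sub>n\<close> are \<open>\<plusminus>2y\<^sub>n\<close> and \<open>\<plusminus>2h\<close>: the
  factor \<open>y\<^sub>k\<^sup>2\<close> of \<open>b\<^sub>n\<close> cancels the former for \<open>k < n\<close>, \<open>c\<close> cancels the latter, and \<open>b\<^sub>n\<close> has neither
  \<open>2y\<^sub>n\<close> nor \<open>2h\<close> among its signed sums.\<close>

lemma separating_sequences:
  assumes inf: "infinite doubles"
  obtains c and b x :: "nat \<Rightarrow> 'a multiset" where
    "c \<in> pm_zero_sum_sequences G"
    "\<forall>n. b n \<in> pm_zero_sum_sequences G" "\<forall>n>0. b n \<noteq> {#}"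
    "\<forall>n. set_mset (x n) \<subseteq> carrier G" "\<forall>n. c + x n \<in> pm_zero_sum_sequences G"
    "\<forall>n. \<forall>k<n. b n + x k \<in> pm_zero_sum_sequences G"
    "\<forall>n. b n + x n \<notin> pm_zero_sum_sequences G"
proof -
  have avoid: "\<exists>y\<in>carrier G. y \<otimes> y \<notin> Y" if "finite Y" for Y
  proof (rule ccontr)
    assume "\<not> ?thesis"
    then have "doubles \<subseteq> Y" by (auto simp: doubles_def)
    then show False using inf that finite_subset by blast
  qed
  obtain h where h: "h \<in> carrier G" "h \<otimes> h \<noteq> \<one>" using avoid[of "{\<one>}"] by blast
  have "\<forall>s. \<exists>y. y \<in> carrier G \<and> y \<otimes> y \<notin> signed_sums ({#h, h#} + s)"
    using avoid[OF finite_signed_sums] by blast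
  then obtain f where f: "\<And>s. f s \<in> carrier G"
    "\<And>s. f s \<otimes> f s \<notin> signed_sums ({#h, h#} + s)" by metis
  define b where "b = rec_nat {#} (\<lambda>_ s. s + {#f s, f s#})"
  have b0: "b 0 = {#}" and bS: "b (Suc n) = b n + {#f (b n), f (b n)#}" for n
    by (simp_all add: b_def)
  define y where "y n = f (b n)" for n
  define x where "x n = {#y n \<otimes> inv h, y n \<otimes> h#}" for n
  have y: "y n \<in> carrier G" "y n \<otimes> y n \<notin> signed_sums ({#h, h#} + b n)" for n
    using f by (auto simp: y_def)
  have bS': "b (Suc n) = b n + {#y n, y n#}" for n using bS by (simp add: y_def)
  have bc: "set_mset (b n) \<subseteq> carrier G" for n
    by (induction n) (use b0 bS' y in auto)
  have pair: "{#y n, y n#} \<in> pm_zero_sum_sequences G" for n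
    using pm_double[of "{#y n#}"] y(1) by simp
  have bB: "b n \<in> pm_zero_sum_sequences G" for n
  proof (induction n)
    case (Suc n)
    then show ?case unfolding bS' by (rule pm_add[OF _ pair])
  qed (simp add: b0)
  have xc: "set_mset (x n) \<subseteq> carrier G" for n using y h by (auto simp: x_def)
  have cB: "{#h, h#} \<in> pm_zero_sum_sequences G" using pm_double[of "{#h#}"] h by simp
  have cx: "{#h, h#} + x n \<in> pm_zero_sum_sequences G" for n
  proof -
    have "{#y n \<otimes> inv h, h, h#} + {#y n \<otimes> h#} \<in> pm_zero_sum_sequences G"
    proof (rule pmI)
      have "inv h \<otimes> (h \<otimes> h) = h" using h by (simp flip: m_assoc)
      then show "sigma {#y n \<otimes> inv h, h, h#} = sigma {#y n \<otimes> h#}"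
        using y h by (simp add: m_assoc)
    qed (use y h in auto)
    moreover have "{#y n \<otimes> inv h, h, h#} + {#y n \<otimes> h#} = {#h, h#} + x n"
      by (simp add: x_def)
    ultimately show ?thesis by (simp only:)
  qed
  have yx: "{#y n, y n#} + x n \<in> pm_zero_sum_sequences G" for n
  proof (rule pmI)
    have "sigma (x n) = (y n \<otimes> inv h) \<otimes> (y n \<otimes> h)"
      using y(1) h(1) unfolding x_def by simp
    then show "sigma {#y n, y n#} = sigma (x n)"
      using y(1) h(1) by (simp add: mult_inv_cancel_middle)
  qed (use y xc in auto)
  have bx: "b n + x k \<in> pm_zero_sum_sequences G" if "k < n" for k n
    using that
  proof (induction n)
    case (Suc n)
    show ?case
    proof (cases "k = n")
      case True
      have "b n + ({#y n, y n#} + x n) \<in> pm_zero_sum_sequences G" by (rule pm_add[OF bB yx])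
      then show ?thesis unfolding bS' True by (simp add: ac_simps)
    next
      case False
      then have "(b n + x k) + {#y n, y n#} \<in> pm_zero_sum_sequences G"
        using Suc by (intro pm_add[OF _ pair]) auto
      then show ?thesis unfolding bS' by (simp add: ac_simps)
    qed
  qed simp
  have sc: "signed_sums (b n) \<subseteq> carrier G" for n by (rule signed_sums_subset[OF bc])
  \<comment> \<open>If \<open>2h\<close> were a signed sum involving \<open>y\<^sub>n\<^sup>2\<close>, solving for \<open>2y\<^sub>n\<close> would contradict its choice.\<close>
  have hh: "h \<otimes> h \<notin> signed_sums (b n)" for n
  proof (induction n)
    case 0
    then show ?case using h by (simp add: b0 signed_sums_empty)
  next
    case (Suc n)
    show ?case
    proof
      assume "h \<otimes> h \<in> signed_sums (b (Suc n))"
      then obtain w v where wv: "w \<in> signed_sums (b n)" "v \<in> signed_sums {#y n, y n#}"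
        "h \<otimes> h = w \<otimes> v" using y bc by (auto simp: bS' signed_sums_union simp del: union_mset_add_mset_right)
      have w: "w \<in> carrier G" using wv sc by blast
      have wi: "inv w \<in> signed_sums (b n)" using signed_sums_inv[OF bc wv(1)] .
      have mem: "p \<otimes> q \<in> signed_sums ({#h, h#} + b n)"
        if "p \<in> signed_sums {#h, h#}" "q \<in> signed_sums (b n)" for p q
        using that h bc by (subst signed_sums_union) auto
      have p: "h \<otimes> h \<in> signed_sums {#h, h#}" "inv h \<otimes> inv h \<in> signed_sums {#h, h#}"
        using h by (auto simp: signed_sums_pair)
      have "v = y n \<otimes> y n \<or> v = \<one> \<or> v = inv (y n) \<otimes> inv (y n)"
        using wv(2) y by (auto simp: signed_sums_pair)
      then consider "v = y n \<otimes> y n" | "v = \<one>" | "v = inv (y n) \<otimes> inv (y n)" by blast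
      then show False
      proof cases
        case 1
        have "y n \<otimes> y n = (y n \<otimes> y n \<otimes> w) \<otimes> inv w" using w y(1) by (simp add: m_assoc)
        then have "y n \<otimes> y n = (w \<otimes> (y n \<otimes> y n)) \<otimes> inv w" using w y(1) by (simp add: m_comm)
        then have "y n \<otimes> y n = (h \<otimes> h) \<otimes> inv w" using 1 wv by simp
        then show False using mem[OF p(1) wi] y(2)[of n] by metis
      next
        case 2
        then show False using wv w Suc by simp
      next
        case 3
        have "h \<otimes> h = w \<otimes> inv (y n \<otimes> y n)" using wv(3) 3 y(1) by (simp add: inv_mult)
        then have "w = h \<otimes> h \<otimes> (y n \<otimes> y n)" using w y(1) h(1) inv_solve_right[of "h \<otimes> h" w "y n \<otimes> y n"] by simp
        then have "y n \<otimes> y n = inv (h \<otimes> h) \<otimes> w" using w y(1) h(1)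
          inv_solve_left[of "y n \<otimes> y n" "h \<otimes> h" w] by simp
        then have "y n \<otimes> y n = (inv h \<otimes> inv h) \<otimes> w" using h by (simp add: inv_mult)
        then show False using mem[OF p(2) wv(1)] y(2)[of n] by metis
      qed
    qed
  qed
  have yy: "y n \<otimes> y n \<notin> signed_sums (b n)" for n
  proof
    assume a: "y n \<otimes> y n \<in> signed_sums (b n)"
    have "\<one> \<in> signed_sums {#h, h#}" using h by (auto simp: signed_sums_pair)
    then have "\<one> \<otimes> (y n \<otimes> y n) \<in> signed_sums ({#h, h#} + b n)"
      using a h bc by (subst signed_sums_union) auto
    then show False using y by simp
  qed
  have bnx: "b n + x n \<notin> pm_zero_sum_sequences G" for n
  proof
    assume "b n + x n \<in> pm_zero_sum_sequences G"
    then obtain w v where wv: "w \<in> signed_sums (b n)" "v \<in> signed_sums (x n)" "w \<otimes> v = \<one>"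
      using pm_union_iff[OF bc xc] by blast
    have w: "w \<in> carrier G" using wv sc by blast
    have vc: "v \<in> carrier G" using wv signed_sums_subset[OF xc] by blast
    have "v = inv w" using wv(3) w vc by (metis inv_equality m_comm)
    then have vb: "v \<in> signed_sums (b n)" "inv v \<in> signed_sums (b n)"
      using signed_sums_inv[OF bc wv(1)] wv(1) w by auto
    have "(y n \<otimes> inv h) \<otimes> (y n \<otimes> h) = y n \<otimes> y n"
      using y h by (intro mult_inv_cancel_middle) auto
    moreover have "(y n \<otimes> inv h) \<otimes> inv (y n \<otimes> h) = inv (h \<otimes> h)"
      using mult_inv_cancel_middle[of "inv h" "inv h" "y n"] y(1) h(1)
      by (simp add: inv_mult m_comm)
    moreover have "inv (y n \<otimes> inv h) \<otimes> (y n \<otimes> h) = h \<otimes> h"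
      using mult_inv_cancel_middle[of h h "y n"] y(1) h(1)
      by (simp add: inv_mult m_comm)
    moreover have "inv (y n \<otimes> inv h) \<otimes> inv (y n \<otimes> h) = inv (y n \<otimes> y n)"
      using mult_inv_cancel_middle[of "inv (y n)" "inv (y n)" h] y(1) h(1)
      by (simp add: inv_mult m_comm)
    ultimately have "v \<in> {y n \<otimes> y n, inv (h \<otimes> h), h \<otimes> h, inv (y n \<otimes> y n)}"
      using wv(2) y h unfolding x_def by (simp add: signed_sums_pair)
    then show False using vb hh yy y h by auto
  qed
  have "b n \<noteq> {#}" if "n > 0" for n using that bS' by (cases n) auto
  then have "\<forall>n>0. b n \<noteq> {#}" by blast
  then show ?thesis
    using that[of "{#h, h#}" b x, OF cB _ _ _ _ _ _] bB xc cx bx bnx by blast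
qed

end

section \<open>C-monoids over infinite groups\<close>

text \<open>Root closedness: after cancelling the greatest common divisor, the cofactor of \<open>a\<close> is coprime to that of
  \<open>b\<close> and divides its square, so it is a unit.\<close>

lemma (in gcd_condition_monoid) divides_if_square_divides:
  assumes c: "a \<in> carrier G" "b \<in> carrier G" and d: "(a \<otimes> a) divides (b \<otimes> b)"
  shows "a divides b"
proof -
  define d where "d = somegcd G a b"
  have dc: "d \<in> carrier G" using c by (simp add: d_def)
  obtain a' where a': "a' \<in> carrier G" "a = d \<otimes> a'"
    using gcd_divides_l[OF c] by (auto simp: d_def factor_def)
  obtain b' where b': "b' \<in> carrier G" "b = d \<otimes> b'"
    using gcd_divides_r[OF c] by (auto simp: d_def factor_def)
  have "d \<otimes> somegcd G a' b' \<sim> somegcd G (d \<otimes> a') (d \<otimes> b')"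
    by (rule gcd_mult) (use a' b' dc in auto)
  also have "somegcd G (d \<otimes> a') (d \<otimes> b') = d"
    unfolding a'(2)[symmetric] b'(2)[symmetric] by (rule d_def[symmetric])
  finally have "d \<otimes> somegcd G a' b' \<sim> d \<otimes> \<one>" using dc by simp
  then have rel: "somegcd G a' b' \<sim> \<one>"
    by (rule assoc_l_cancel[rotated 3]) (use a' b' dc in auto)
  have "(d \<otimes> d) \<otimes> (a' \<otimes> a') divides (d \<otimes> d) \<otimes> (b' \<otimes> b')"
    using d a' b' dc by (simp add: m_ac)
  then have "(a' \<otimes> a') divides (b' \<otimes> b')" using a' b' dc by (subst (asm) divides_mult_l) auto
  then have "a' divides (b' \<otimes> b')" using a' b'
    by (metis divides_trans dividesI' m_closed)
  then have "a' divides somegcd G a' (b' \<otimes> b')" using a' b' by (intro gcd_divides) auto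
  also have "somegcd G a' (b' \<otimes> b') \<sim> \<one>" using rel a' b' by (intro relprime_mult) auto
  finally have "a' divides \<one>" using a' b' by simp
  then have "a' \<in> Units G" using a' by (simp add: Unit_eq_dividesone)
  then have "a' divides b'" using b'(1) by (rule unit_divides)
  then show ?thesis using a' b' dc by simp
qed

locale pm_in_C_monoid = comm_group G + F: factorial_monoid F
  for G :: "('a, 'm) monoid_scheme" (structure) and F :: "('f, 'x) monoid_scheme" +
  fixes \<phi> :: "'a multiset \<Rightarrow> 'f"
  assumes phi_hom: "\<phi> \<in> hom (pm_zero_sum_monoid G) F"
    and phi_inj: "inj_on \<phi> (pm_zero_sum_sequences G)"
    and C_monoid: "C_monoid_defined_in F (\<phi> ` pm_zero_sum_sequences G)"
begin

abbreviation "B \<equiv> pm_zero_sum_sequences G"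

lemma phi_closed [simp]: "s \<in> B \<Longrightarrow> \<phi> s \<in> carrier F"
  using phi_hom by (auto simp: hom_def)

lemma phi_add: "s \<in> B \<Longrightarrow> t \<in> B \<Longrightarrow> \<phi> (s + t) = \<phi> s \<otimes>\<^bsub>F\<^esub> \<phi> t"
  using phi_hom by (auto simp: hom_def)

lemma phi_eq: "s \<in> B \<Longrightarrow> t \<in> B \<Longrightarrow> \<phi> s = \<phi> t \<Longrightarrow> s = t"
  using phi_inj by (auto dest: inj_onD)

lemma phi_empty [simp]: "\<phi> {#} = \<one>\<^bsub>F\<^esub>"
proof -
  have "submonoid (\<phi> ` B) F" using C_monoid by (simp add: C_monoid_defined_in_def)
  then obtain s where s: "s \<in> B" "\<phi> s = \<one>\<^bsub>F\<^esub>" using submonoid.one_closed by fastforce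
  then have "\<phi> (s + s) = \<phi> s" by (simp add: phi_add)
  then have "s + s = s" using phi_eq[OF pm_add[OF s(1) s(1)] s(1)] by simp
  then show ?thesis using s by simp
qed

lemma phi_Units:
  assumes "s \<in> B" "\<phi> s \<in> Units F"
  shows "s = {#}"
proof -
  have "\<phi> s \<in> Units (F\<lparr>carrier := \<phi> ` B\<rparr>)"
    using C_monoid assms unfolding C_monoid_defined_in_def by blast
  then obtain t where t: "t \<in> B" "\<phi> s \<otimes>\<^bsub>F\<^esub> \<phi> t = \<one>\<^bsub>F\<^esub>" by (auto simp: Units_def)
  then have "\<phi> (s + t) = \<phi> {#}" using assms by (simp add: phi_add)
  then have "s + t = {#}" using phi_eq[OF pm_add[OF assms(1) t(1)] pm_empty] by simp
  then show ?thesis by simp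
qed

lemma zero_pm: "{#\<one>#} \<in> B"
  using pmI[of "{#\<one>#}" "{#}"] by simp

definition "e = \<phi> {#\<one>#}"

lemma e_closed [simp]: "e \<in> carrier F"
  using zero_pm by (simp add: e_def)

text \<open>The reduced class semigroup only counts the classes of nonunits and of \<open>1\<close>. Multiplying by the image \<open>e\<close> of the
  one-term sequence \<open>0\<close> moves any element among the nonunits, and it preserves the image of
  \<open>\<phi>\<close> because this sequence lies in \<open>B\<close>.\<close>

lemma e_mult_nonunit:
  assumes "x \<in> carrier F"
  shows "e \<otimes>\<^bsub>F\<^esub> x \<in> carrier F - Units F"
proof -
  have "e \<notin> Units F" using phi_Units[OF zero_pm] by (auto simp: e_def)
  then show ?thesis using F.unit_factor[of e x] assms by auto
qed

lemma class_imp_equiv: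
  assumes "y \<in> carrier F" "y' \<in> carrier F"
    "equivalence_class F (\<phi> ` B) y = equivalence_class F (\<phi> ` B) y'"
    "x \<in> carrier F" "x \<otimes>\<^bsub>F\<^esub> y \<in> \<phi> ` B"
  shows "x \<otimes>\<^bsub>F\<^esub> y' \<in> \<phi> ` B"
proof -
  have "y' \<in> equivalence_class F (\<phi> ` B) y'" using assms by (simp add: equivalence_class_def)
  then have "y' \<in> equivalence_class F (\<phi> ` B) y" using assms by simp
  then show ?thesis using assms by (simp add: equivalence_class_def)
qed

lemma finite_classes:
  assumes "\<And>i. i \<in> I \<Longrightarrow> f i \<in> carrier F - Units F"
  shows "finite ((\<lambda>i. equivalence_class F (\<phi> ` B) (f i)) ` I)"
proof -
  have "(\<lambda>i. equivalence_class F (\<phi> ` B) (f i)) ` I \<subseteq> reduced_class_semigroup F (\<phi> ` B)"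
    using assms by (auto simp: reduced_class_semigroup_def)
  moreover have "finite (reduced_class_semigroup F (\<phi> ` B))"
    using C_monoid by (simp add: C_monoid_defined_in_def)
  ultimately show ?thesis by (rule finite_subset)
qed

lemma class_repeats:
  fixes f :: "nat \<Rightarrow> 'f"
  assumes "\<And>n. n > 0 \<Longrightarrow> f n \<in> carrier F - Units F"
  obtains m n where "0 < m" "m < n"
    "equivalence_class F (\<phi> ` B) (f m) = equivalence_class F (\<phi> ` B) (f n)"
proof -
  let ?h = "\<lambda>i. equivalence_class F (\<phi> ` B) (f i)"
  have "finite (?h ` {0<..})" by (rule finite_classes) (use assms in auto)
  moreover have "infinite {0::nat<..}" by (rule infinite_Ioi)
  ultimately have "\<not> inj_on ?h {0<..}" using finite_imageD by blast
  then obtain i j where "i > 0" "j > 0" "i \<noteq> j" "?h i = ?h j" by (auto simp: inj_on_def)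
  then show ?thesis using that[of i j] that[of j i] by (cases i j rule: linorder_cases) auto
qed

lemma pm_repeat: "s \<in> B \<Longrightarrow> repeat_mset n s \<in> B"
  by (induction n) (auto intro: pm_add)

text \<open>Let \<open>\<phi>(V) = \<phi>(U) X\<close>. Two of the elements \<open>e X\<^sup>n\<close> are equivalent, so their classes are
  eventually periodic in \<open>n\<close>, and one common denominator \<open>P = \<phi>(U\<^sup>j)\<close> brings all of them into the image
  of \<open>\<phi>\<close>. Hence \<open>U\<^sup>n\<close> divides \<open>U\<^sup>j 0 V\<^sup>n\<close> for all \<open>n\<close>, and comparing multiplicities for large \<open>n\<close>
  gives that \<open>U\<close> divides \<open>V\<close>.\<close>

lemma saturated:
  assumes U: "U \<in> B" and V: "V \<in> B" and dvd: "\<phi> U divides\<^bsub>F\<^esub> \<phi> V"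
  shows "U \<subseteq># V"
proof -
  obtain X where X: "X \<in> carrier F" "\<phi> V = \<phi> U \<otimes>\<^bsub>F\<^esub> X" using dvd by (auto simp: factor_def)
  have XU: "\<phi> (repeat_mset n U) \<otimes>\<^bsub>F\<^esub> X [^]\<^bsub>F\<^esub> n = \<phi> (repeat_mset n V)" for n
  proof (induction n)
    case (Suc n)
    have "\<phi> (repeat_mset (Suc n) U) \<otimes>\<^bsub>F\<^esub> X [^]\<^bsub>F\<^esub> Suc n
      = (\<phi> U \<otimes>\<^bsub>F\<^esub> X) \<otimes>\<^bsub>F\<^esub> (\<phi> (repeat_mset n U) \<otimes>\<^bsub>F\<^esub> X [^]\<^bsub>F\<^esub> n)"
      using U X(1) pm_repeat[OF U] by (simp add: phi_add F.m_ac)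
    then show ?case using Suc V pm_repeat[OF V] by (simp add: phi_add flip: X(2))
  qed simp
  have nonunit: "e \<otimes>\<^bsub>F\<^esub> X [^]\<^bsub>F\<^esub> n \<in> carrier F - Units F" for n :: nat
    by (rule e_mult_nonunit) (simp add: X(1))
  obtain i j :: nat where "0 < i" and ij: "i < j" "equivalence_class F (\<phi> ` B) (e \<otimes>\<^bsub>F\<^esub> X [^]\<^bsub>F\<^esub> i)
      = equivalence_class F (\<phi> ` B) (e \<otimes>\<^bsub>F\<^esub> X [^]\<^bsub>F\<^esub> j)"
    by (rule class_repeats[of "\<lambda>n. e \<otimes>\<^bsub>F\<^esub> X [^]\<^bsub>F\<^esub> n", OF nonunit])
  define P where "P = \<phi> (repeat_mset j U)"
  have P: "P \<in> carrier F" using pm_repeat[OF U] by (simp add: P_def)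
  have mem: "P \<otimes>\<^bsub>F\<^esub> (e \<otimes>\<^bsub>F\<^esub> X [^]\<^bsub>F\<^esub> n) \<in> \<phi> ` B" for n :: nat
  proof (induction n rule: less_induct)
    case (less n)
    show ?case
    proof (cases "n \<le> j")
      case True
      have "repeat_mset j U = repeat_mset (j - n) U + repeat_mset n U"
        using True by (simp flip: repeat_mset_distrib)
      then have "P \<otimes>\<^bsub>F\<^esub> (e \<otimes>\<^bsub>F\<^esub> X [^]\<^bsub>F\<^esub> n)
        = \<phi> (repeat_mset (j - n) U) \<otimes>\<^bsub>F\<^esub> e \<otimes>\<^bsub>F\<^esub> (\<phi> (repeat_mset n U) \<otimes>\<^bsub>F\<^esub> X [^]\<^bsub>F\<^esub> n)"
        using U X(1) pm_repeat[OF U] by (simp add: P_def phi_add F.m_ac)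
      also have "\<dots> = \<phi> (repeat_mset (j - n) U + {#\<one>#} + repeat_mset n V)"
        using pm_repeat[OF U] pm_repeat[OF V] zero_pm by (simp add: XU phi_add pm_add e_def del: union_mset_add_mset_right)
      finally show ?thesis using pm_repeat[OF U] pm_repeat[OF V] zero_pm pm_add by blast
    next
      case False
      define m where "m = n - j"
      have n: "n = m + j" "i + m < n" using False ij(1) by (auto simp: m_def)
      have shift: "(P \<otimes>\<^bsub>F\<^esub> X [^]\<^bsub>F\<^esub> m) \<otimes>\<^bsub>F\<^esub> (e \<otimes>\<^bsub>F\<^esub> X [^]\<^bsub>F\<^esub> k)
          = P \<otimes>\<^bsub>F\<^esub> (e \<otimes>\<^bsub>F\<^esub> X [^]\<^bsub>F\<^esub> (m + k))" for k :: nat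
        using P X(1) by (simp add: F.m_ac flip: F.nat_pow_mult)
      have "(P \<otimes>\<^bsub>F\<^esub> X [^]\<^bsub>F\<^esub> m) \<otimes>\<^bsub>F\<^esub> (e \<otimes>\<^bsub>F\<^esub> X [^]\<^bsub>F\<^esub> i) \<in> \<phi> ` B"
        using less.IH[OF n(2)] shift[of i] by (simp add: add.commute)
      then have "(P \<otimes>\<^bsub>F\<^esub> X [^]\<^bsub>F\<^esub> m) \<otimes>\<^bsub>F\<^esub> (e \<otimes>\<^bsub>F\<^esub> X [^]\<^bsub>F\<^esub> j) \<in> \<phi> ` B"
        by (rule class_imp_equiv[OF _ _ ij(2), rotated 3]) (use P X(1) in auto)
      then show ?thesis using shift[of j] n(1) by simp
    qed
  qed
  show ?thesis
  proof (rule mset_subset_eqI, rule ccontr)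
    fix g assume g: "\<not> count U g \<le> count V g"
    \<comment> \<open>Large enough that \<open>n\<close> exceeds the contribution \<open>j * count U g + 1\<close> of \<open>U\<^sup>j 0\<close>.\<close>
    define n where "n = j * count U g + 2"
    obtain S where S: "S \<in> B" "P \<otimes>\<^bsub>F\<^esub> (e \<otimes>\<^bsub>F\<^esub> X [^]\<^bsub>F\<^esub> n) = \<phi> S" using mem[of n] by blast
    have "\<phi> (repeat_mset j U + {#\<one>#} + repeat_mset n V)
       = P \<otimes>\<^bsub>F\<^esub> e \<otimes>\<^bsub>F\<^esub> (\<phi> (repeat_mset n U) \<otimes>\<^bsub>F\<^esub> X [^]\<^bsub>F\<^esub> n)"
      using pm_repeat[OF U] pm_repeat[OF V] zero_pm by (simp add: XU phi_add pm_add P_def e_def del: union_mset_add_mset_right)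
    also have "\<dots> = \<phi> (repeat_mset n U) \<otimes>\<^bsub>F\<^esub> (P \<otimes>\<^bsub>F\<^esub> (e \<otimes>\<^bsub>F\<^esub> X [^]\<^bsub>F\<^esub> n))"
      using pm_repeat[OF U] P X(1) by (simp add: F.m_ac)
    also have "\<dots> = \<phi> (repeat_mset n U + S)"
      using S pm_repeat[OF U] by (simp add: phi_add)
    finally have "repeat_mset j U + {#\<one>#} + repeat_mset n V = repeat_mset n U + S"
      using pm_repeat[OF U] pm_repeat[OF V] zero_pm S(1) pm_add by (intro phi_eq) blast+
    then have "count (repeat_mset j U + {#\<one>#} + repeat_mset n V) g = count (repeat_mset n U + S) g"
      by simp
    then have "n * count U g \<le> j * count U g + 1 + n * count V g"
      by (auto split: if_splits)
    moreover have "n * count V g + n \<le> n * count U g"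
      using g by (metis Suc_leI add.commute mult_Suc_right mult_le_mono2 not_le)
    ultimately show False by (simp add: n_def)
  qed
qed

text \<open>With the separating sequences, the elements \<open>\<phi>(b\<^sub>n)\<close> would be pairwise inequivalent: for \<open>m < n\<close> they are
  told apart by \<open>X = \<phi>(c x\<^sub>m) / \<phi>(c)\<close>. This quotient exists in \<open>F\<close> since its square is \<open>\<phi>(x\<^sub>m\<^sup>2)\<close> and
  \<open>F\<close> is root closed.\<close>

lemma finite_doubles: "finite doubles"
proof (rule ccontr)
  assume "infinite doubles"
  then obtain c and b x :: "nat \<Rightarrow> 'a multiset" where s0: "c \<in> B"
    "\<forall>n. b n \<in> B" "\<forall>n>0. b n \<noteq> {#}"
    "\<forall>n. set_mset (x n) \<subseteq> carrier G" "\<forall>n. c + x n \<in> B"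
    "\<forall>n. \<forall>k<n. b n + x k \<in> B" "\<forall>n. b n + x n \<notin> B"
    by (rule separating_sequences)
  then have s: "c \<in> B" "\<And>n. b n \<in> B" "\<And>n. n > 0 \<Longrightarrow> b n \<noteq> {#}"
    "\<And>n. set_mset (x n) \<subseteq> carrier G" "\<And>n. c + x n \<in> B"
    "\<And>k n. k < n \<Longrightarrow> b n + x k \<in> B" "\<And>n. b n + x n \<notin> B"
    by simp_all
  have nonunit: "\<phi> (b n) \<in> carrier F - Units F" if "n > 0" for n
    using s(2) s(3)[OF that] phi_Units by auto
  obtain m n where "0 < m" and mn: "m < n"
    "equivalence_class F (\<phi> ` B) (\<phi> (b m)) = equivalence_class F (\<phi> ` B) (\<phi> (b n))"
    by (rule class_repeats[of "\<lambda>n. \<phi> (b n)", OF nonunit])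
  have "\<phi> (c + x m) \<otimes>\<^bsub>F\<^esub> \<phi> (c + x m) = \<phi> ((c + c) + (x m + x m))"
    using s(5)[of m] by (simp add: ac_simps flip: phi_add)
  also have "\<dots> = (\<phi> c \<otimes>\<^bsub>F\<^esub> \<phi> c) \<otimes>\<^bsub>F\<^esub> \<phi> (x m + x m)"
    using s(1) pm_double[OF s(4)] by (simp add: phi_add pm_add)
  finally have "(\<phi> c \<otimes>\<^bsub>F\<^esub> \<phi> c) divides\<^bsub>F\<^esub> (\<phi> (c + x m) \<otimes>\<^bsub>F\<^esub> \<phi> (c + x m))"
    using pm_double[OF s(4)] by auto
  then have "\<phi> c divides\<^bsub>F\<^esub> \<phi> (c + x m)"
    by (rule F.divides_if_square_divides[rotated 2]) (intro phi_closed s(1,5))+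
  then obtain X where X: "X \<in> carrier F" "\<phi> (c + x m) = \<phi> c \<otimes>\<^bsub>F\<^esub> X" by (auto simp: factor_def)
  have "\<phi> c \<otimes>\<^bsub>F\<^esub> (X \<otimes>\<^bsub>F\<^esub> \<phi> (b n)) = \<phi> (b n) \<otimes>\<^bsub>F\<^esub> \<phi> (c + x m)"
    using phi_closed[OF s(1)] phi_closed[OF s(2)] X(1) by (simp add: X(2) F.m_ac)
  also have "\<dots> = \<phi> (c + (b n + x m))" using s(2,5) by (simp add: ac_simps flip: phi_add)
  also have "\<dots> = \<phi> c \<otimes>\<^bsub>F\<^esub> \<phi> (b n + x m)" using s mn(1) by (simp add: phi_add)
  finally have "X \<otimes>\<^bsub>F\<^esub> \<phi> (b n) = \<phi> (b n + x m)"
    by (rule F.l_cancel) (use s X(1) mn(1) in simp_all)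
  then have "X \<otimes>\<^bsub>F\<^esub> \<phi> (b n) \<in> \<phi> ` B" using s(6)[OF mn(1)] by simp
  then have "X \<otimes>\<^bsub>F\<^esub> \<phi> (b m) \<in> \<phi> ` B"
    by (rule class_imp_equiv[OF _ _ mn(2)[symmetric], rotated 3]) (intro phi_closed s(2) X(1))+
  then obtain t where t: "t \<in> B" "X \<otimes>\<^bsub>F\<^esub> \<phi> (b m) = \<phi> t" by blast
  have "\<phi> (c + t) = \<phi> c \<otimes>\<^bsub>F\<^esub> (X \<otimes>\<^bsub>F\<^esub> \<phi> (b m))" using s(1) t by (simp add: phi_add)
  also have "\<dots> = \<phi> (c + x m) \<otimes>\<^bsub>F\<^esub> \<phi> (b m)"
    using phi_closed[OF s(1)] phi_closed[OF s(2)] X(1) by (simp add: X(2) F.m_assoc)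
  also have "\<dots> = \<phi> (c + x m + b m)" by (rule phi_add[OF s(5) s(2), symmetric])
  finally have "c + t = c + x m + b m" by (rule phi_eq[rotated 2]) (intro pm_add s t)+
  then have "t = b m + x m" by (simp add: ac_simps)
  then show False using t(1) s(7)[of m] by simp
qed

text \<open>In the free monoid \<open>g\<close> is the greatest common divisor of \<open>g\<^sup>2\<close> and \<open>g s\<close>. The greatest common divisor
  \<open>d\<^sub>g\<close> of their images in \<open>F\<close> behaves like an image of \<open>g\<close>: if \<open>\<phi>(A) d\<^sub>h\<close> divides \<open>\<phi>(T) d\<^sub>g\<close>,
  then \<open>A h\<close> divides \<open>T g\<close>. Indeed \<open>\<phi>(A h\<^sup>2)\<close> divides \<open>\<phi>(P A) d\<^sub>h\<close> for \<open>P = h\<^sup>2\<close> and \<open>P = h t\<close>, so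
  it divides \<open>\<phi>(P T Q)\<close> for \<open>Q = g\<^sup>2\<close> and \<open>Q = g s\<close>; by saturation the divisibility holds for
  sequences, and the multiplicity of each element is compared with the best choice of \<open>P\<close> and \<open>Q\<close>.\<close>

lemma gcd_detects:
  assumes g: "g \<in> carrier G" "{#g#} + s \<in> B" "g \<notin># s"
    and h: "h \<in> carrier G" "{#h#} + t \<in> B" "h \<notin># t"
    and AT: "A \<in> B" "T \<in> B"
    and dvd: "(\<phi> A \<otimes>\<^bsub>F\<^esub> somegcd F (\<phi> {#h, h#}) (\<phi> ({#h#} + t))) divides\<^bsub>F\<^esub>
              (\<phi> T \<otimes>\<^bsub>F\<^esub> somegcd F (\<phi> {#g, g#}) (\<phi> ({#g#} + s)))"
  shows "A + {#h#} \<subseteq># T + {#g#}"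
proof -
  have gg: "{#g, g#} \<in> B" and hh: "{#h, h#} \<in> B"
    using pm_double[of "{#g#}"] pm_double[of "{#h#}"] g h by auto
  have tt: "t + t \<in> B" using pm_carrier[OF h(2)] by (intro pm_double) auto
  define dg where "dg = somegcd F (\<phi> {#g, g#}) (\<phi> ({#g#} + s))"
  define dh where "dh = somegcd F (\<phi> {#h, h#}) (\<phi> ({#h#} + t))"
  have d [simp]: "dg \<in> carrier F" "dh \<in> carrier F"
    using gg hh g h by (auto simp: dg_def dh_def)
  have dvd': "(\<phi> A \<otimes>\<^bsub>F\<^esub> dh) divides\<^bsub>F\<^esub> (\<phi> T \<otimes>\<^bsub>F\<^esub> dg)"
    using dvd unfolding dg_def dh_def .
  have main: "A + {#h, h#} \<subseteq># P + T + Q"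
    if P: "P \<in> {{#h, h#}, {#h#} + t}" and Q: "Q \<in> {{#g, g#}, {#g#} + s}" for P Q
  proof -
    have PB: "P \<in> B" using P hh h by blast
    have QB: "Q \<in> B" using Q gg g by blast
    have c1: "\<phi> (A + {#h, h#}) divides\<^bsub>F\<^esub> \<phi> (P + A + {#h, h#})"
    proof -
      have "\<phi> (P + A + {#h, h#}) = \<phi> ((A + {#h, h#}) + P)" by (simp add: ac_simps)
      also have "\<dots> = \<phi> (A + {#h, h#}) \<otimes>\<^bsub>F\<^esub> \<phi> P" by (rule phi_add[OF pm_add[OF AT(1) hh] PB])
      finally show ?thesis using PB by auto
    qed
    have c2: "\<phi> (A + {#h, h#}) divides\<^bsub>F\<^esub> \<phi> (P + A + ({#h#} + t))"
    proof (cases "P = {#h, h#}")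
      case True
      then have "P + A + ({#h#} + t) = (A + {#h, h#}) + ({#h#} + t)" by simp
      then have "\<phi> (P + A + ({#h#} + t)) = \<phi> (A + {#h, h#}) \<otimes>\<^bsub>F\<^esub> \<phi> ({#h#} + t)"
        using AT hh h by (simp only: phi_add pm_add)
      then show ?thesis using h by auto
    next
      case False
      then have "P = {#h#} + t" using P by blast
      then have "P + A + ({#h#} + t) = (A + {#h, h#}) + (t + t)" by simp
      then have "\<phi> (P + A + ({#h#} + t)) = \<phi> (A + {#h, h#}) \<otimes>\<^bsub>F\<^esub> \<phi> (t + t)"
        using AT hh tt by (simp only: phi_add pm_add)
      then show ?thesis using tt by auto
    qed
    have "\<phi> (A + {#h, h#}) divides\<^bsub>F\<^esub> somegcd F (\<phi> (P + A) \<otimes>\<^bsub>F\<^esub> \<phi> {#h, h#}) (\<phi> (P + A) \<otimes>\<^bsub>F\<^esub> \<phi> ({#h#} + t))"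
    proof -
      have PA: "P + A \<in> B" by (rule pm_add[OF PB AT(1)])
      show ?thesis
        unfolding phi_add[OF PA hh, symmetric] phi_add[OF PA h(2), symmetric]
        by (rule F.gcd_divides[OF c1 c2]) (intro phi_closed pm_add PB AT(1) hh h(2))+
    qed
    also have "somegcd F (\<phi> (P + A) \<otimes>\<^bsub>F\<^esub> \<phi> {#h, h#}) (\<phi> (P + A) \<otimes>\<^bsub>F\<^esub> \<phi> ({#h#} + t))
        \<sim>\<^bsub>F\<^esub> \<phi> (P + A) \<otimes>\<^bsub>F\<^esub> dh"
      unfolding dh_def by (rule F.associated_sym, rule F.gcd_mult) (use PB AT hh h pm_add in auto)
    also have "\<phi> (P + A) \<otimes>\<^bsub>F\<^esub> dh = \<phi> P \<otimes>\<^bsub>F\<^esub> (\<phi> A \<otimes>\<^bsub>F\<^esub> dh)"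
      using PB AT by (simp add: phi_add F.m_assoc)
    also have "\<dots> divides\<^bsub>F\<^esub> \<phi> P \<otimes>\<^bsub>F\<^esub> (\<phi> T \<otimes>\<^bsub>F\<^esub> dg)"
      using dvd' PB AT by simp
    also have "\<dots> divides\<^bsub>F\<^esub> \<phi> P \<otimes>\<^bsub>F\<^esub> (\<phi> T \<otimes>\<^bsub>F\<^esub> \<phi> Q)"
    proof -
      have "dg divides\<^bsub>F\<^esub> \<phi> Q"
        using Q F.gcd_divides_l[of "\<phi> {#g, g#}" "\<phi> ({#g#} + s)"]
          F.gcd_divides_r[of "\<phi> {#g, g#}" "\<phi> ({#g#} + s)"] gg g by (auto simp: dg_def)
      then show ?thesis using PB AT QB by simp
    qed
    also have "\<dots> = \<phi> (P + T + Q)" using PB AT QB by (simp add: phi_add pm_add F.m_assoc)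
    finally have "\<phi> (A + {#h, h#}) divides\<^bsub>F\<^esub> \<phi> (P + T + Q)"
      using phi_closed[OF pm_add[OF AT(1) hh]] by blast
    then show ?thesis by (rule saturated[rotated 2]) (intro pm_add PB AT hh QB)+
  qed
  show ?thesis
  proof (rule mset_subset_eqI)
    fix z
    define P where "P = (if z = h then {#h#} + t else {#h, h#})"
    define Q where "Q = (if z = g then {#g#} + s else {#g, g#})"
    have "A + {#h, h#} \<subseteq># P + T + Q" by (rule main) (auto simp: P_def Q_def)
    then have "count (A + {#h, h#}) z \<le> count (P + T + Q) z" by (rule mset_subset_eq_count)
    then show "count (A + {#h#}) z \<le> count (T + {#g#}) z"
      using g(3) h(3) by (auto simp: P_def Q_def not_in_iff split: if_splits)
  qed
qed

text \<open>Choose \<open>s\<close> with \<open>g s \<in> B\<close> and \<open>g\<close> not in \<open>s\<close>, namely \<open>s = u (g - u)\<close> with \<open>u \<noteq> g\<close> and \<open>u \<noteq> 0\<close>, and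
  let \<open>d\<^sub>g\<close> be the greatest common divisor of \<open>\<phi>(g\<^sup>2)\<close> and \<open>\<phi>(g s)\<close>. If \<open>e d\<^sub>g\<close> and \<open>e d\<^sub>h\<close> are
  equivalent, there are \<open>A, T \<in> B\<close> with \<open>\<phi>(T) d\<^sub>g = \<phi>(A) d\<^sub>h\<close>, so \<open>T g = A h\<close> and \<open>g - h \<in> 2G\<close>. As
  there are finitely many classes and \<open>2G\<close> is finite, so is the group.\<close>

theorem finite_carrier: "finite (carrier G)"
proof (rule ccontr)
  assume inf: "infinite (carrier G)"
  have "\<exists>s. {#g#} + s \<in> B \<and> g \<notin># s" if g: "g \<in> carrier G" for g
  proof -
    obtain u where u: "u \<in> carrier G" "u \<noteq> g" "u \<noteq> \<one>"
    proof -
      have "infinite (carrier G - {g, \<one>})" using inf by simp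
      then obtain u where "u \<in> carrier G - {g, \<one>}" by (metis ex_in_conv finite.emptyI)
      then show ?thesis using that by auto
    qed
    have "{#g#} + {#u, inv u \<otimes> g#} \<in> B"
    proof (rule pmI)
      have "u \<otimes> (inv u \<otimes> g) = g" using u g by (simp flip: m_assoc)
      then show "sigma {#g#} = sigma {#u, inv u \<otimes> g#}" using u g by simp
    qed (use u g in auto)
    moreover have "inv u \<otimes> g \<noteq> g" using u g by (metis inv_closed inv_eq_1_iff r_cancel_one')
    ultimately show ?thesis using u by (intro exI[of _ "{#u, inv u \<otimes> g#}"]) auto
  qed
  then obtain s where s: "\<And>g. g \<in> carrier G \<Longrightarrow> {#g#} + s g \<in> B"
    "\<And>g. g \<in> carrier G \<Longrightarrow> g \<notin># s g" by metis
  define d where "d g = somegcd F (\<phi> {#g, g#}) (\<phi> ({#g#} + s g))" for g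
  have gg: "{#g, g#} \<in> B" if "g \<in> carrier G" for g using pm_double[of "{#g#}"] that by simp
  have dc: "d g \<in> carrier F" if "g \<in> carrier G" for g
    using that s gg by (simp add: d_def)
  let ?c = "\<lambda>g. equivalence_class F (\<phi> ` B) (e \<otimes>\<^bsub>F\<^esub> d g)"
  have same: "g \<otimes> inv h \<in> doubles" if gh: "g \<in> carrier G" "h \<in> carrier G" "?c g = ?c h" for g h
  proof -
    have "d g divides\<^bsub>F\<^esub> \<phi> {#g, g#}" unfolding d_def using s gh gg by (intro F.gcd_divides_l) auto
    then obtain x where x: "x \<in> carrier F" "\<phi> {#g, g#} = d g \<otimes>\<^bsub>F\<^esub> x" by (auto simp: factor_def)
    define A where "A = {#\<one>#} + {#g, g#}"
    have A: "A \<in> B" unfolding A_def using zero_pm gg gh pm_add by blast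
    have "x \<otimes>\<^bsub>F\<^esub> (e \<otimes>\<^bsub>F\<^esub> d g) = e \<otimes>\<^bsub>F\<^esub> (d g \<otimes>\<^bsub>F\<^esub> x)"
      using x(1) dc gh by (simp add: F.m_ac)
    also have "\<dots> = \<phi> A" unfolding A_def
      using zero_pm gg gh by (simp only: phi_add e_def x(2))
    finally have eA: "x \<otimes>\<^bsub>F\<^esub> (e \<otimes>\<^bsub>F\<^esub> d g) = \<phi> A" .
    then have "x \<otimes>\<^bsub>F\<^esub> (e \<otimes>\<^bsub>F\<^esub> d g) \<in> \<phi> ` B" using A by blast
    then have "x \<otimes>\<^bsub>F\<^esub> (e \<otimes>\<^bsub>F\<^esub> d h) \<in> \<phi> ` B"
      by (rule class_imp_equiv[OF _ _ gh(3), rotated 3]) (use x dc gh in auto)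
    then obtain T where T: "T \<in> B" "x \<otimes>\<^bsub>F\<^esub> (e \<otimes>\<^bsub>F\<^esub> d h) = \<phi> T" by blast
    have eq: "\<phi> T \<otimes>\<^bsub>F\<^esub> d g = \<phi> A \<otimes>\<^bsub>F\<^esub> d h"
      unfolding eA[symmetric] T(2)[symmetric] using x(1) dc gh by (simp add: F.m_ac)
    have closed: "\<phi> T \<otimes>\<^bsub>F\<^esub> d g \<in> carrier F" using T dc gh by simp
    have "A + {#h#} \<subseteq># T + {#g#}"
      by (rule gcd_detects[OF gh(1) s[OF gh(1)] gh(2) s[OF gh(2)] A T(1)])
        (fold d_def, use eq closed in \<open>metis F.divides_refl\<close>)
    moreover have "T + {#g#} \<subseteq># A + {#h#}"
      by (rule gcd_detects[OF gh(2) s[OF gh(2)] gh(1) s[OF gh(1)] T(1) A])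
        (fold d_def, use eq closed in \<open>metis F.divides_refl\<close>)
    ultimately have "A + {#h#} = T + {#g#}" by simp
    then have "sigma (A + {#h#}) = sigma (T + {#g#})" by simp
    then have eq': "sigma A \<otimes> h = sigma T \<otimes> g"
      using pm_carrier[OF A] pm_carrier[OF T(1)] gh by (simp add: m_comm del: union_mset_add_mset_right)
    have c: "sigma A \<in> carrier G" "sigma T \<in> carrier G" using pm_carrier A T by auto
    have "g \<otimes> inv h = inv (sigma T) \<otimes> (sigma T \<otimes> g) \<otimes> inv h"
      using c gh by (simp add: m_assoc[symmetric])
    also have "inv (sigma T) \<otimes> (sigma T \<otimes> g) = inv (sigma T) \<otimes> (sigma A \<otimes> h)" by (simp only: eq')
    also have "inv (sigma T) \<otimes> (sigma A \<otimes> h) \<otimes> inv h = inv (sigma T) \<otimes> sigma A"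
      using c gh by (simp add: m_assoc)
    also have "inv (sigma T) \<otimes> sigma A = sigma A \<otimes> inv (sigma T)"
      using c by (simp add: m_comm)
    finally show ?thesis
      using sigma_pm[OF A] sigma_pm[OF T(1)] subgroup_doubles
      by (simp add: subgroup.m_closed subgroup.m_inv_closed)
  qed
  have "finite (?c ` carrier G)" by (rule finite_classes) (intro e_mult_nonunit dc)
  moreover have "finite (?c -` {k} \<inter> carrier G)" if k: "k \<in> ?c ` carrier G" for k
  proof -
    obtain h where h: "k = ?c h" "h \<in> carrier G" using k by (rule imageE)
    have "?c -` {k} \<inter> carrier G \<subseteq> (\<lambda>z. z \<otimes> h) ` doubles"
    proof
      fix g assume "g \<in> ?c -` {k} \<inter> carrier G"
      then have g: "g \<in> carrier G" "?c g = ?c h" by (simp_all add: h(1))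
      then have gh: "g \<otimes> inv h \<in> doubles" using same[OF g(1) h(2)] by blast
      have "g = (g \<otimes> inv h) \<otimes> h" using g(1) h(2) by (simp add: m_assoc)
      then show "g \<in> (\<lambda>z. z \<otimes> h) ` doubles" using gh by (rule image_eqI)
    qed
    then show ?thesis by (rule finite_subset) (simp add: finite_doubles)
  qed
  ultimately have "finite (?c -` (?c ` carrier G) \<inter> carrier G)"
    by (rule finite_finite_vimage_IntI)
  then have "finite (carrier G)" by (rule finite_subset[rotated]) auto
  then show False using inf by simp
qed

end

section \<open>The quotient group of a cancellative monoid\<close>

context comm_monoid_cancel
begin

abbreviation "fraction a b \<equiv> fraction_rel G `` {(a, b)}"

lemma equiv_fraction_rel: "equiv (carrier G \<times> carrier G) (fraction_rel G)"
proof (rule equivI)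
  show "refl_on (carrier G \<times> carrier G) (fraction_rel G)"
    by (rule refl_onI) (auto simp: fraction_rel_def)
  show "fraction_rel G \<subseteq> (carrier G \<times> carrier G) \<times> (carrier G \<times> carrier G)"
    by (auto simp: fraction_rel_def)
  show "sym (fraction_rel G)" by (rule symI) (auto simp: fraction_rel_def)
  show "trans (fraction_rel G)"
  proof (rule transI)
    fix x y z assume "(x, y) \<in> fraction_rel G" "(y, z) \<in> fraction_rel G"
    then obtain a b c d e f where xyz: "x = (a, b)" "y = (c, d)" "z = (e, f)" and
      m: "a \<in> carrier G" "b \<in> carrier G" "c \<in> carrier G" "d \<in> carrier G"
      "e \<in> carrier G" "f \<in> carrier G" and eq: "a \<otimes> d = c \<otimes> b" "c \<otimes> f = e \<otimes> d"
      by (auto simp: fraction_rel_def)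
    have "d \<otimes> (a \<otimes> f) = (a \<otimes> d) \<otimes> f" using m by (simp add: m_ac)
    also have "\<dots> = (c \<otimes> f) \<otimes> b" unfolding eq(1) using m by (simp add: m_ac)
    also have "\<dots> = d \<otimes> (e \<otimes> b)" unfolding eq(2) using m by (simp add: m_ac)
    finally have "a \<otimes> f = e \<otimes> b" by (rule l_cancel) (use m in simp_all)
    then show "(x, z) \<in> fraction_rel G" using xyz m by (simp add: fraction_rel_def)
  qed
qed

lemma frac_eq_iff:
  assumes "a \<in> carrier G" "b \<in> carrier G" "c \<in> carrier G" "d \<in> carrier G"
  shows "fraction a b = fraction c d \<longleftrightarrow> a \<otimes> d = c \<otimes> b"
  using eq_equiv_class_iff[OF equiv_fraction_rel, of "(a, b)" "(c, d)"] assms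
  by (simp add: fraction_rel_def)

lemma mem_frac_iff:
  assumes "a \<in> carrier G" "b \<in> carrier G"
  shows "(c, d) \<in> fraction a b \<longleftrightarrow> c \<in> carrier G \<and> d \<in> carrier G \<and> a \<otimes> d = c \<otimes> b"
  using assms by (simp add: fraction_rel_def)

lemma frac_carrier: "a \<in> carrier G \<Longrightarrow> b \<in> carrier G \<Longrightarrow> fraction a b \<in> carrier (quotient_group G)"
  unfolding quotient_group_def by (simp add: quotientI)

lemma quotient_cases:
  assumes "X \<in> carrier (quotient_group G)"
  obtains a b where "X = fraction a b" "a \<in> carrier G" "b \<in> carrier G"
  using assms unfolding quotient_group_def by (auto elim!: quotientE)

lemma frac_mult:
  assumes m: "a \<in> carrier G" "b \<in> carrier G" "c \<in> carrier G" "d \<in> carrier G"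
  shows "fraction a b \<otimes>\<^bsub>quotient_group G\<^esub> fraction c d = fraction (a \<otimes> c) (b \<otimes> d)"
proof -
  have eq: "fraction (a' \<otimes> c') (b' \<otimes> d') = fraction (a \<otimes> c) (b \<otimes> d)"
    if "(a', b') \<in> fraction a b" "(c', d') \<in> fraction c d" for a' b' c' d'
  proof -
    have a': "a' \<in> carrier G" "b' \<in> carrier G" "a \<otimes> b' = a' \<otimes> b"
      using that(1) unfolding mem_frac_iff[OF m(1,2)] by simp_all
    have c': "c' \<in> carrier G" "d' \<in> carrier G" "c \<otimes> d' = c' \<otimes> d"
      using that(2) unfolding mem_frac_iff[OF m(3,4)] by simp_all
    have "(a \<otimes> c) \<otimes> (b' \<otimes> d') = (a \<otimes> b') \<otimes> (c \<otimes> d')" using m a'(1,2) c'(1,2) by (simp add: m_ac)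
    also have "\<dots> = (a' \<otimes> c') \<otimes> (b \<otimes> d)"
      unfolding a'(3) c'(3) using m a'(1,2) c'(1,2) by (simp add: m_ac)
    finally show ?thesis using m a'(1,2) c'(1,2) by (simp add: frac_eq_iff)
  qed
  have "(a, b) \<in> fraction a b" "(c, d) \<in> fraction c d"
    unfolding mem_frac_iff[OF m(1,2)] mem_frac_iff[OF m(3,4)] using m by simp_all
  then have "(\<Union>(a', b')\<in>fraction a b. \<Union>(c', d')\<in>fraction c d. fraction (a' \<otimes> c') (b' \<otimes> d'))
      = fraction (a \<otimes> c) (b \<otimes> d)"
    using eq by fast
  then show ?thesis by (simp add: quotient_group_def)
qed

lemma frac_one: "\<one>\<^bsub>quotient_group G\<^esub> = fraction \<one> \<one>"
  by (simp add: quotient_group_def)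

lemma comm_group_quotient: "comm_group (quotient_group G)"
proof (rule comm_groupI)
  let ?Q = "quotient_group G"
  show "\<one>\<^bsub>?Q\<^esub> \<in> carrier ?Q" by (simp add: frac_one frac_carrier)
  show "x \<otimes>\<^bsub>?Q\<^esub> y \<in> carrier ?Q" if x: "x \<in> carrier ?Q" and y: "y \<in> carrier ?Q" for x y
  proof -
    obtain a b where 1: "x = fraction a b" "a \<in> carrier G" "b \<in> carrier G" by (rule quotient_cases[OF x])
    obtain c d where 2: "y = fraction c d" "c \<in> carrier G" "d \<in> carrier G" by (rule quotient_cases[OF y])
    show ?thesis unfolding 1(1) 2(1) using 1(2,3) 2(2,3) by (simp add: frac_mult frac_carrier)
  qed
  show "x \<otimes>\<^bsub>?Q\<^esub> y \<otimes>\<^bsub>?Q\<^esub> z = x \<otimes>\<^bsub>?Q\<^esub> (y \<otimes>\<^bsub>?Q\<^esub> z)"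
    if x: "x \<in> carrier ?Q" and y: "y \<in> carrier ?Q" and z: "z \<in> carrier ?Q" for x y z
  proof -
    obtain a b where 1: "x = fraction a b" "a \<in> carrier G" "b \<in> carrier G" by (rule quotient_cases[OF x])
    obtain c d where 2: "y = fraction c d" "c \<in> carrier G" "d \<in> carrier G" by (rule quotient_cases[OF y])
    obtain e f where 3: "z = fraction e f" "e \<in> carrier G" "f \<in> carrier G" by (rule quotient_cases[OF z])
    show ?thesis unfolding 1(1) 2(1) 3(1) using 1(2,3) 2(2,3) 3(2,3) by (simp add: frac_mult m_assoc)
  qed
  show "x \<otimes>\<^bsub>?Q\<^esub> y = y \<otimes>\<^bsub>?Q\<^esub> x" if x: "x \<in> carrier ?Q" and y: "y \<in> carrier ?Q" for x y
  proof -
    obtain a b where 1: "x = fraction a b" "a \<in> carrier G" "b \<in> carrier G" by (rule quotient_cases[OF x])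
    obtain c d where 2: "y = fraction c d" "c \<in> carrier G" "d \<in> carrier G" by (rule quotient_cases[OF y])
    show ?thesis unfolding 1(1) 2(1) using 1(2,3) 2(2,3) by (simp add: frac_mult m_comm)
  qed
  show "\<one>\<^bsub>?Q\<^esub> \<otimes>\<^bsub>?Q\<^esub> x = x" if x: "x \<in> carrier ?Q" for x
  proof -
    obtain a b where 1: "x = fraction a b" "a \<in> carrier G" "b \<in> carrier G" by (rule quotient_cases[OF x])
    show ?thesis unfolding 1(1) frac_one using 1(2,3) by (simp add: frac_mult)
  qed
  show "\<exists>y\<in>carrier ?Q. y \<otimes>\<^bsub>?Q\<^esub> x = \<one>\<^bsub>?Q\<^esub>" if x: "x \<in> carrier ?Q" for x
  proof -
    obtain a b where 1: "x = fraction a b" "a \<in> carrier G" "b \<in> carrier G" by (rule quotient_cases[OF x])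
    have "fraction b a \<otimes>\<^bsub>?Q\<^esub> x = \<one>\<^bsub>?Q\<^esub>"
      unfolding 1(1) frac_one using 1(2,3) by (simp add: frac_mult frac_eq_iff m_comm)
    then show ?thesis using frac_carrier[OF 1(3,2)] by blast
  qed
qed

end

lemma (in comm_group) comm_monoid_cancel_pm: "comm_monoid_cancel (pm_zero_sum_monoid G)"
  by (rule comm_monoid_cancel_via_multisets[of id]) (simp_all add: pm_add)

section \<open>Valuations and the complete integral closure\<close>

text \<open>A copy of the locale of abelian groups. The quotient group of \<open>B\<close> is again an abelian group; declaring
  this for all abelian groups would iterate the construction without end.\<close>

locale pm_monoid = comm_group
begin

abbreviation "B \<equiv> pm_zero_sum_sequences G"
abbreviation "Q \<equiv> quotient_group (pm_zero_sum_monoid G)"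
abbreviation "B' \<equiv> embedded (pm_zero_sum_monoid G)"
abbreviation "emb \<equiv> quotient_embed (pm_zero_sum_monoid G)"

sublocale pm: comm_monoid_cancel "pm_zero_sum_monoid G"
  by (rule comm_monoid_cancel_pm)

sublocale Q: comm_group Q
  by (rule pm.comm_group_quotient)

text \<open>The multiplicity of \<open>g\<close> in a fraction of sequences. The valuations determine an element of the quotient
  group, so that all computations there become computations with integers.\<close>

definition val :: "('a multiset \<times> 'a multiset) set \<Rightarrow> 'a \<Rightarrow> int" where
  "val X g = (case SOME p. p \<in> X of (s, t) \<Rightarrow> int (count s g) - int (count t g))"

lemma Q_cases:
  assumes "x \<in> carrier Q"
  obtains s t where "x = pm.fraction s t" "s \<in> B" "t \<in> B"
proof (rule pm.quotient_cases[OF assms])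
  fix a b assume "x = pm.fraction a b" "a \<in> carrier (pm_zero_sum_monoid G)" "b \<in> carrier (pm_zero_sum_monoid G)"
  then show ?thesis using that by simp
qed

lemma frac_in_Q: "s \<in> B \<Longrightarrow> t \<in> B \<Longrightarrow> pm.fraction s t \<in> carrier Q"
  using pm.frac_carrier by simp

lemma val_frac:
  assumes "s \<in> B" "t \<in> B"
  shows "val (pm.fraction s t) g = int (count s g) - int (count t g)"
proof -
  obtain a b where ab: "(SOME p. p \<in> pm.fraction s t) = (a, b)" by (cases "SOME p. p \<in> pm.fraction s t")
  have mem: "p \<in> pm.fraction s t \<longleftrightarrow> fst p \<in> B \<and> snd p \<in> B \<and> s + snd p = fst p + t" for p
    using pm.mem_frac_iff[of s t "fst p" "snd p"] assms by simp
  have "(s, t) \<in> pm.fraction s t" unfolding mem using assms by simp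
  then have "(a, b) \<in> pm.fraction s t" unfolding ab[symmetric] by (rule someI)
  then have "s + b = a + t" unfolding mem by simp
  then have "count (s + b) g = count (a + t) g" by (simp only:)
  then show ?thesis unfolding val_def ab by simp
qed

lemma val_mult:
  assumes "x \<in> carrier Q" "y \<in> carrier Q"
  shows "val (x \<otimes>\<^bsub>Q\<^esub> y) g = val x g + val y g"
proof -
  obtain a b where x: "x = pm.fraction a b" "a \<in> B" "b \<in> B" by (rule Q_cases[OF assms(1)])
  obtain c d where y: "y = pm.fraction c d" "c \<in> B" "d \<in> B" by (rule Q_cases[OF assms(2)])
  have "x \<otimes>\<^bsub>Q\<^esub> y = pm.fraction (a + c) (b + d)"
    unfolding x(1) y(1) using pm.frac_mult[of a b c d] x(2,3) y(2,3) by simp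
  then show ?thesis using x(2,3) y(2,3) by (simp add: x(1) y(1) val_frac pm_add)
qed

lemma val_one [simp]: "val \<one>\<^bsub>Q\<^esub> g = 0"
  using val_mult[of "\<one>\<^bsub>Q\<^esub>" "\<one>\<^bsub>Q\<^esub>" g] by simp

lemma val_inv:
  assumes "x \<in> carrier Q"
  shows "val (inv\<^bsub>Q\<^esub> x) g = - val x g"
  using val_mult[of x "inv\<^bsub>Q\<^esub> x" g] assms by simp

lemma val_pow:
  assumes "x \<in> carrier Q"
  shows "val (x [^]\<^bsub>Q\<^esub> n) g = int n * val x g"
  by (induction n) (simp_all add: val_mult assms algebra_simps)

lemma val_eqI:
  assumes "x \<in> carrier Q" "y \<in> carrier Q" "\<And>g. val x g = val y g"
  shows "x = y"
proof -
  obtain a b where x: "x = pm.fraction a b" "a \<in> B" "b \<in> B" by (rule Q_cases[OF assms(1)])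
  obtain c d where y: "y = pm.fraction c d" "c \<in> B" "d \<in> B" by (rule Q_cases[OF assms(2)])
  have "count (a + d) g = count (c + b) g" for g
    using assms(3)[of g] x(2,3) y(2,3) by (simp add: x(1) y(1) val_frac)
  then have "a + d = c + b" by (rule multiset_eqI)
  then show ?thesis using x(2,3) y(2,3) by (simp add: x(1) y(1) pm.frac_eq_iff)
qed

lemma emb_frac: "emb s = pm.fraction s {#}"
  by (simp add: quotient_embed_def)

lemma emb_in_Q [simp]: "s \<in> B \<Longrightarrow> emb s \<in> carrier Q"
  by (simp add: emb_frac frac_in_Q)

lemma val_emb [simp]: "s \<in> B \<Longrightarrow> val (emb s) g = int (count s g)"
  by (simp add: emb_frac val_frac)

lemma emb_in_embedded: "s \<in> B \<Longrightarrow> emb s \<in> B'"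
  by (simp add: embedded_def)

lemma embeddedE:
  assumes "x \<in> B'" obtains s where "s \<in> B" "x = emb s"
  using assms by (auto simp: embedded_def)

lemma embedded_iff:
  assumes "x \<in> carrier Q" "\<And>g. val x g = int (count s g)"
  shows "x \<in> B' \<longleftrightarrow> s \<in> B"
proof
  assume "x \<in> B'"
  then obtain t where t: "t \<in> B" "x = emb t" by (rule embeddedE)
  have "count s g = count t g" for g using assms(2)[of g] t by simp
  then have "s = t" by (rule multiset_eqI)
  then show "s \<in> B" using t by simp
next
  assume "s \<in> B"
  then have "x = emb s" using assms by (intro val_eqI) simp_all
  then show "x \<in> B'" using \<open>s \<in> B\<close> emb_in_embedded by simp
qed

lemma embedded_subset: "B' \<subseteq> carrier Q"
  by (auto simp: embedded_def)

text \<open>The fraction \<open>S / T\<close> is expanded to \<open>(S T h\<^sup>2) / (T\<^sup>2 h\<^sup>2)\<close> with \<open>2h = \<sigma>(S T)\<close>.\<close>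

lemma exists_with_val:
  assumes s: "set_mset s \<subseteq> carrier G" and t: "set_mset t \<subseteq> carrier G"
    and d: "sigma s \<otimes> inv (sigma t) \<in> doubles"
  obtains x where "x \<in> carrier Q" "\<And>g. val x g = int (count s g) - int (count t g)"
proof -
  have "sigma (s + t) = (sigma s \<otimes> inv (sigma t)) \<otimes> (sigma t \<otimes> sigma t)"
    using s t by (simp add: m_assoc) (simp add: m_assoc[symmetric])
  also have "\<dots> \<in> doubles"
    by (rule subgroup.m_closed[OF subgroup_doubles d doublesI]) (rule sigma_closed[OF t])
  finally obtain h where h: "h \<in> carrier G" "sigma (s + t) = h \<otimes> h" by (rule doublesE)
  have 1: "s + t + {#h, h#} \<in> B" by (rule pm_if_sigma_double) (use s t h in auto)
  have "{#h, h#} \<in> B" using pm_double[of "{#h#}"] h by simp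
  then have 2: "t + t + {#h, h#} \<in> B" by (rule pm_add[OF pm_double[OF t]])
  show ?thesis
    by (rule that[of "pm.fraction (s + t + {#h, h#}) (t + t + {#h, h#})"])
      (simp_all only: frac_in_Q[OF 1 2] val_frac[OF 1 2] count_union of_nat_add)
qed

abbreviation "K \<equiv> complete_integral_closure Q B'"

text \<open>If \<open>x = a / b\<close> has nonnegative valuations, then \<open>a = b w\<close> for a sequence \<open>w\<close>, and \<open>b x\<^sup>n = b w\<^sup>n\<close> is one
  of \<open>b\<close> and \<open>a\<close> times an even power of \<open>w\<close>, hence in \<open>B\<close>.\<close>

lemma K_iff: "x \<in> K \<longleftrightarrow> x \<in> carrier Q \<and> (\<forall>g. 0 \<le> val x g)"
proof
  assume "x \<in> K"
  then obtain c where x: "x \<in> carrier Q" and c: "c \<in> B'"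
    "\<forall>n::nat. n \<ge> 1 \<longrightarrow> c \<otimes>\<^bsub>Q\<^esub> x [^]\<^bsub>Q\<^esub> n \<in> B'"
    unfolding complete_integral_closure_def by blast
  obtain u where u: "u \<in> B" "c = emb u" using c(1) by (rule embeddedE)
  have "0 \<le> val x g" for g
  proof (rule ccontr)
    assume neg: "\<not> 0 \<le> val x g"
    define n where "n = count u g + 1"
    have "n \<ge> 1" by (simp add: n_def)
    then have "c \<otimes>\<^bsub>Q\<^esub> x [^]\<^bsub>Q\<^esub> n \<in> B'" using c(2) by blast
    then obtain w where w: "w \<in> B" "c \<otimes>\<^bsub>Q\<^esub> x [^]\<^bsub>Q\<^esub> n = emb w" by (rule embeddedE)
    have "int (count w g) = val (c \<otimes>\<^bsub>Q\<^esub> x [^]\<^bsub>Q\<^esub> n) g" using w by simp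
    also have "\<dots> = int (count u g) + int n * val x g" using u x by (simp add: val_mult val_pow)
    also have "\<dots> \<le> int (count u g) + int n * (- 1)"
      using neg by (intro add_left_mono mult_left_mono) auto
    also have "\<dots> < 0" by (simp add: n_def)
    finally show False by simp
  qed
  then show "x \<in> carrier Q \<and> (\<forall>g. 0 \<le> val x g)" using x by simp
next
  assume x: "x \<in> carrier Q \<and> (\<forall>g. 0 \<le> val x g)"
  then have xQ: "x \<in> carrier Q" by simp
  obtain a b where ab: "x = pm.fraction a b" "a \<in> B" "b \<in> B" by (rule Q_cases[OF xQ])
  have "count b g \<le> count a g" for g
    using x ab(2,3) by (simp add: ab(1) val_frac)
  then have le: "b \<subseteq># a" by (rule mset_subset_eqI)
  define w where "w = a - b"
  have a: "a = b + w" using le by (simp add: w_def)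
  have w: "set_mset w \<subseteq> carrier G" using pm_carrier[OF ab(2)] a by auto
  have vx: "val x g = int (count w g)" for g using ab(2,3) by (simp add: ab(1) val_frac a[symmetric]) (simp add: a)
  have pow: "b + repeat_mset n w \<in> B" for n
  proof (induction n rule: induct_nat_012)
    case (ge2 n)
    have "(b + repeat_mset n w) + (w + w) \<in> B" by (rule pm_add[OF ge2(1) pm_double[OF w]])
    then show ?case by (simp add: ac_simps)
  qed (use ab a in simp_all)
  have "emb b \<otimes>\<^bsub>Q\<^esub> x [^]\<^bsub>Q\<^esub> n \<in> B'" for n :: nat
  proof -
    have "val (emb b \<otimes>\<^bsub>Q\<^esub> x [^]\<^bsub>Q\<^esub> n) g = int (count (b + repeat_mset n w) g)" for g
      using xQ ab(3) by (simp add: val_mult val_pow vx)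
    moreover have "emb b \<otimes>\<^bsub>Q\<^esub> x [^]\<^bsub>Q\<^esub> n \<in> carrier Q" using xQ ab(3) by simp
    ultimately show ?thesis using embedded_iff pow by blast
  qed
  then show "x \<in> K"
    unfolding complete_integral_closure_def using xQ emb_in_embedded[OF ab(3)] by blast
qed

end

section \<open>Divisorial ideals in a submonoid of an abelian group\<close>

lemma ideal_colon_iff: "x \<in> ideal_colon Q I J \<longleftrightarrow> x \<in> carrier Q \<and> (\<forall>y\<in>J. x \<otimes>\<^bsub>Q\<^esub> y \<in> I)"
  by (auto simp: ideal_colon_def l_coset_def)

lemma set_mult_mem: "x \<in> I <#>\<^bsub>Q\<^esub> J \<longleftrightarrow> (\<exists>i\<in>I. \<exists>j\<in>J. x = i \<otimes>\<^bsub>Q\<^esub> j)"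
  by (auto simp: set_mult_def)

lemma l_coset_mem: "x \<in> c <#\<^bsub>Q\<^esub> I \<longleftrightarrow> (\<exists>i\<in>I. x = c \<otimes>\<^bsub>Q\<^esub> i)"
  by (auto simp: l_coset_def)

locale submonoid_of_group = comm_group Q for Q :: "('q, 'm) monoid_scheme" (structure) +
  fixes H :: "'q set"
  assumes submonoid_H: "submonoid H Q"
begin

abbreviation "dual \<equiv> ideal_colon Q H"
abbreviation "vc \<equiv> v_closure Q H"

lemma H_sub: "H \<subseteq> carrier Q" and H_one: "\<one> \<in> H"
  and H_mult: "x \<in> H \<Longrightarrow> y \<in> H \<Longrightarrow> x \<otimes> y \<in> H"
  using submonoid_H by (auto simp: submonoid_def)

lemma vc_def: "vc I = dual (dual I)"
  by (simp add: v_closure_def)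

lemma dual_sub: "dual I \<subseteq> carrier Q"
  by (auto simp: ideal_colon_iff)

lemma vc_sub: "vc I \<subseteq> carrier Q"
  unfolding vc_def by (rule dual_sub)

lemma dual_antimono: "I \<subseteq> J \<Longrightarrow> dual J \<subseteq> dual I"
  unfolding ideal_colon_def l_coset_def by blast

lemma vc_mono: "I \<subseteq> J \<Longrightarrow> vc I \<subseteq> vc J"
  unfolding vc_def by (intro dual_antimono)

lemma vc_extensive:
  assumes "I \<subseteq> carrier Q"
  shows "I \<subseteq> vc I"
proof
  fix x assume x: "x \<in> I"
  then have "x \<in> carrier Q" using assms by blast
  moreover have "x \<otimes> y \<in> H" if y: "y \<in> dual I" for y
  proof -
    have "y \<otimes> x \<in> H" "y \<in> carrier Q" using y x by (simp_all add: ideal_colon_iff)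
    then show ?thesis using \<open>x \<in> carrier Q\<close> by (simp add: m_comm)
  qed
  ultimately show "x \<in> vc I" by (simp add: vc_def ideal_colon_iff)
qed

lemma dual_vc:
  assumes "I \<subseteq> carrier Q"
  shows "dual (vc I) = dual I"
proof
  show "dual (vc I) \<subseteq> dual I" by (rule dual_antimono[OF vc_extensive[OF assms]])
  have "dual I \<subseteq> vc (dual I)" by (rule vc_extensive[OF dual_sub])
  then show "dual I \<subseteq> dual (vc I)" by (simp add: vc_def)
qed

lemma vc_idem: "I \<subseteq> carrier Q \<Longrightarrow> vc (vc I) = vc I"
  using dual_vc[of I] by (simp add: vc_def)

lemma dual_H: "dual H = H"
proof
  show "dual H \<subseteq> H"
  proof
    fix x assume "x \<in> dual H"
    then have "x \<in> carrier Q" "x \<otimes> \<one> \<in> H" using H_one unfolding ideal_colon_iff by blast+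
    then show "x \<in> H" by simp
  qed
  show "H \<subseteq> dual H" using H_sub H_mult by (auto simp: ideal_colon_iff)
qed

lemma vc_H: "vc H = H"
  by (simp add: vc_def dual_H)

text \<open>The key property of the \<open>v\<close>-operation, from which associativity of \<open>v\<close>-multiplication follows.\<close>

lemma dual_vc_mult:
  assumes I: "I \<subseteq> carrier Q" and J: "J \<subseteq> carrier Q"
  shows "dual (vc I <#> J) = dual (I <#> J)"
proof
  have "I <#> J \<subseteq> vc I <#> J" using vc_extensive[OF I] unfolding set_mult_def by blast
  then show "dual (vc I <#> J) \<subseteq> dual (I <#> J)" by (rule dual_antimono)
  show "dual (I <#> J) \<subseteq> dual (vc I <#> J)"
  proof
    fix x assume x: "x \<in> dual (I <#> J)"
    then have xQ: "x \<in> carrier Q" by (simp add: ideal_colon_iff)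
    have "x \<otimes> (i \<otimes> j) \<in> H" if i: "i \<in> vc I" and j: "j \<in> J" for i j
    proof -
      have jQ: "j \<in> carrier Q" using j J by blast
      have iQ: "i \<in> carrier Q" using i vc_sub by blast
      have "(x \<otimes> j) \<otimes> i' \<in> H" if i': "i' \<in> I" for i'
      proof -
        have "i' \<otimes> j \<in> I <#> J" using i' j by (auto simp: set_mult_mem)
        then have "x \<otimes> (i' \<otimes> j) \<in> H" using x by (simp add: ideal_colon_iff)
        moreover have "i' \<in> carrier Q" using i' I by blast
        ultimately show ?thesis using xQ jQ by (simp add: m_ac)
      qed
      then have "x \<otimes> j \<in> dual I" using xQ jQ by (simp add: ideal_colon_iff)
      then have "x \<otimes> j \<in> dual (vc I)" by (simp add: dual_vc[OF I])
      then have "(x \<otimes> j) \<otimes> i \<in> H" using i by (simp add: ideal_colon_iff)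
      then show ?thesis using xQ jQ iQ by (simp add: m_ac)
    qed
    then show "x \<in> dual (vc I <#> J)" using xQ by (auto simp: ideal_colon_iff set_mult_mem)
  qed
qed

lemma vc_mult_left:
  "I \<subseteq> carrier Q \<Longrightarrow> J \<subseteq> carrier Q \<Longrightarrow> vc (vc I <#> J) = vc (I <#> J)"
  using dual_vc_mult[of I J] by (simp add: vc_def)

lemma set_mult_comm: "I \<subseteq> carrier Q \<Longrightarrow> J \<subseteq> carrier Q \<Longrightarrow> I <#> J = J <#> I"
proof (intro equalityI subsetI)
  have comm: "x \<in> B' <#> A'" if A: "A' \<subseteq> carrier Q" "B' \<subseteq> carrier Q" "x \<in> A' <#> B'" for A' B' x
  proof -
    obtain a b where ab: "a \<in> A'" "b \<in> B'" "x = a \<otimes> b" using A(3) unfolding set_mult_mem by blast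
    then have "x = b \<otimes> a" using A(1,2) m_comm by blast
    then show ?thesis using ab(1,2) unfolding set_mult_mem by blast
  qed
  show "x \<in> J <#> I" if "I \<subseteq> carrier Q" "J \<subseteq> carrier Q" "x \<in> I <#> J" for x using comm that by blast
  show "x \<in> I <#> J" if "I \<subseteq> carrier Q" "J \<subseteq> carrier Q" "x \<in> J <#> I" for x using comm that by blast
qed

lemma vc_mult_right:
  "I \<subseteq> carrier Q \<Longrightarrow> J \<subseteq> carrier Q \<Longrightarrow> vc (I <#> vc J) = vc (I <#> J)"
  using vc_mult_left[of J I] set_mult_comm[of I J] set_mult_comm[of I "vc J"] vc_sub by simp

lemma dual_translate:
  assumes c: "c \<in> carrier Q" and I: "I \<subseteq> carrier Q"
  shows "dual (c <# I) = inv c <# dual I"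
proof (intro equalityI subsetI)
  fix x assume x: "x \<in> dual (c <# I)"
  then have xQ: "x \<in> carrier Q" by (simp add: ideal_colon_iff)
  have "(c \<otimes> x) \<otimes> i \<in> H" if i: "i \<in> I" for i
  proof -
    have "c \<otimes> i \<in> c <# I" using i by (auto simp: l_coset_mem)
    then have "x \<otimes> (c \<otimes> i) \<in> H" using x by (simp add: ideal_colon_iff)
    moreover have "i \<in> carrier Q" using i I by blast
    ultimately show ?thesis using c xQ by (simp add: m_ac)
  qed
  then have "c \<otimes> x \<in> dual I" using c xQ by (simp add: ideal_colon_iff)
  moreover have "x = inv c \<otimes> (c \<otimes> x)" using c xQ by (simp flip: m_assoc)
  ultimately show "x \<in> inv c <# dual I" unfolding l_coset_mem by blast
next
  fix x assume "x \<in> inv c <# dual I"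
  then obtain y where y: "y \<in> dual I" "x = inv c \<otimes> y" unfolding l_coset_mem by blast
  then have yQ: "y \<in> carrier Q" by (simp add: ideal_colon_iff)
  have "x \<otimes> (c \<otimes> i) \<in> H" if i: "i \<in> I" for i
  proof -
    have iQ: "i \<in> carrier Q" using i I by blast
    have "x \<otimes> (c \<otimes> i) = (y \<otimes> inv c) \<otimes> (i \<otimes> c)" using c iQ yQ y(2) by (simp add: m_comm)
    also have "\<dots> = y \<otimes> i" using c iQ yQ by (simp add: mult_inv_cancel_middle)
    finally show ?thesis using y(1) i by (simp add: ideal_colon_iff)
  qed
  then show "x \<in> dual (c <# I)" using c yQ y(2) by (auto simp: ideal_colon_iff l_coset_mem)
qed

lemma l_coset_sub: "c \<in> carrier Q \<Longrightarrow> I \<subseteq> carrier Q \<Longrightarrow> c <# I \<subseteq> carrier Q"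
  by (auto simp: l_coset_def)

lemma vc_translate:
  assumes c: "c \<in> carrier Q" and I: "I \<subseteq> carrier Q"
  shows "vc (c <# I) = c <# vc I"
proof -
  have "vc (c <# I) = dual (inv c <# dual I)" by (simp add: vc_def dual_translate c I)
  also have "\<dots> = inv (inv c) <# dual (dual I)" by (rule dual_translate) (use c dual_sub in auto)
  finally show ?thesis using c by (simp add: vc_def)
qed

lemma inv_translate:
  assumes "c \<in> carrier Q" "I \<subseteq> carrier Q"
  shows "inv c <# (c <# I) = I"
  using assms by (simp add: lcos_m_assoc lcos_mult_one)

lemma translate_inv:
  assumes "c \<in> carrier Q" "I \<subseteq> carrier Q"
  shows "c <# (inv c <# I) = I"
  using inv_translate[of "inv c" I] assms by simp

text \<open>In this form, closedness and the existence of a denominator are separate conditions, which makes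
  stability under \<open>v\<close>-multiplication easy to check.\<close>

lemma fractional_iff:
  "J \<in> carrier (fractional_v_ideals Q H) \<longleftrightarrow>
     J \<subseteq> carrier Q \<and> vc J = J \<and> (\<exists>c\<in>carrier Q. c <# J \<subseteq> H)"
proof
  assume "J \<in> carrier (fractional_v_ideals Q H)"
  then obtain c I where cI: "J = c <# I" "c \<in> carrier Q" "I \<subseteq> H" "vc I = I"
    unfolding fractional_v_ideals_def divisorial_ideal_def by auto
  have I: "I \<subseteq> carrier Q" using cI(3) H_sub by blast
  have "inv c <# J \<subseteq> H" unfolding cI(1) inv_translate[OF cI(2) I] by (rule cI(3))
  moreover have "vc J = J" unfolding cI(1) vc_translate[OF cI(2) I] cI(4) ..
  moreover have "J \<subseteq> carrier Q" unfolding cI(1) by (rule l_coset_sub[OF cI(2) I])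
  ultimately show "J \<subseteq> carrier Q \<and> vc J = J \<and> (\<exists>c\<in>carrier Q. c <# J \<subseteq> H)"
    using inv_closed[OF cI(2)] by blast
next
  assume "J \<subseteq> carrier Q \<and> vc J = J \<and> (\<exists>c\<in>carrier Q. c <# J \<subseteq> H)"
  then obtain c where J: "J \<subseteq> carrier Q" "vc J = J" and c: "c \<in> carrier Q" "c <# J \<subseteq> H" by blast
  have "divisorial_ideal Q H (c <# J)"
    unfolding divisorial_ideal_def vc_translate[OF c(1) J(1)] J(2) using c(2) by simp
  moreover have "J = inv c <# (c <# J)" using inv_translate[OF c(1) J(1)] by simp
  ultimately show "J \<in> carrier (fractional_v_ideals Q H)"
    unfolding fractional_v_ideals_def using inv_closed[OF c(1)] by auto
qed

lemma fractional_simps: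
  "I \<otimes>\<^bsub>fractional_v_ideals Q H\<^esub> J = vc (I <#> J)"
  "\<one>\<^bsub>fractional_v_ideals Q H\<^esub> = H"
  by (simp_all add: fractional_v_ideals_def)

lemma vc_absorb:
  assumes I: "I \<subseteq> carrier Q" "vc I = I" and h: "h \<in> H" and i: "i \<in> I"
  shows "h \<otimes> i \<in> I"
proof -
  have q: "h \<in> carrier Q" "i \<in> carrier Q" using H_sub I h i by blast+
  have "h \<otimes> i \<otimes> y \<in> H" if y: "y \<in> dual I" for y
  proof -
    have yQ: "y \<in> carrier Q" using y dual_sub by blast
    have "y \<otimes> i \<in> H" using y i by (simp add: ideal_colon_iff)
    then have "h \<otimes> (y \<otimes> i) \<in> H" using H_mult h by blast
    then show ?thesis using q yQ by (simp add: m_ac)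
  qed
  then have "h \<otimes> i \<in> vc I" using q by (simp add: vc_def ideal_colon_iff)
  then show ?thesis using I by simp
qed

lemma vc_H_mult:
  assumes I: "I \<subseteq> carrier Q" "vc I = I"
  shows "vc (H <#> I) = I"
proof -
  have "H <#> I \<subseteq> I"
  proof
    fix x assume "x \<in> H <#> I"
    then obtain h i where hi: "h \<in> H" "i \<in> I" "x = h \<otimes> i" unfolding set_mult_mem by blast
    show "x \<in> I" unfolding hi(3) by (rule vc_absorb[OF I hi(1,2)])
  qed
  moreover have "I \<subseteq> H <#> I"
  proof
    fix i assume i: "i \<in> I"
    then have "i = \<one> \<otimes> i" using I by auto
    then show "i \<in> H <#> I" using i H_one unfolding set_mult_mem by blast
  qed
  ultimately show ?thesis using I by simp
qed

lemma comm_monoid_fractional: "comm_monoid (fractional_v_ideals Q H)"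
proof (rule comm_monoidI)
  let ?F = "fractional_v_ideals Q H"
  have sub: "I \<subseteq> carrier Q" if "I \<in> carrier ?F" for I using that by (simp add: fractional_iff)
  have msub: "I <#> J \<subseteq> carrier Q" if "I \<in> carrier ?F" "J \<in> carrier ?F" for I J
    by (intro set_mult_closed sub that)
  show "I \<otimes>\<^bsub>?F\<^esub> J \<in> carrier ?F" if I: "I \<in> carrier ?F" and J: "J \<in> carrier ?F" for I J
  proof -
    obtain c where c: "c \<in> carrier Q" "c <# I \<subseteq> H" using I by (auto simp: fractional_iff)
    obtain d where d: "d \<in> carrier Q" "d <# J \<subseteq> H" using J by (auto simp: fractional_iff)
    have "(c \<otimes> d) <# (I <#> J) \<subseteq> H"
    proof
      fix x assume "x \<in> (c \<otimes> d) <# (I <#> J)"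
      then obtain i j where ij: "i \<in> I" "j \<in> J" "x = (c \<otimes> d) \<otimes> (i \<otimes> j)"
        unfolding l_coset_def set_mult_def by blast
      have q: "i \<in> carrier Q" "j \<in> carrier Q" using ij sub I J by blast+
      have "c \<otimes> i \<in> H" "d \<otimes> j \<in> H" using c(2) d(2) ij(1,2) by (auto simp: l_coset_def)
      then have "(c \<otimes> i) \<otimes> (d \<otimes> j) \<in> H" by (rule H_mult)
      then show "x \<in> H" using q c(1) d(1) ij(3) by (simp add: m_ac)
    qed
    then have "vc ((c \<otimes> d) <# (I <#> J)) \<subseteq> H" using vc_mono vc_H by blast
    then have "(c \<otimes> d) <# vc (I <#> J) \<subseteq> H"
      using vc_translate[OF m_closed[OF c(1) d(1)] msub[OF I J]] by simp
    then show ?thesis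
      unfolding fractional_simps fractional_iff
      using vc_sub vc_idem[OF msub[OF I J]] m_closed[OF c(1) d(1)] by blast
  qed
  show "\<one>\<^bsub>?F\<^esub> \<in> carrier ?F"
  proof -
    have "\<one> <# H \<subseteq> H" using H_sub by (simp add: lcos_mult_one)
    then show ?thesis unfolding fractional_simps fractional_iff using H_sub vc_H by blast
  qed
  show "I \<otimes>\<^bsub>?F\<^esub> J \<otimes>\<^bsub>?F\<^esub> L = I \<otimes>\<^bsub>?F\<^esub> (J \<otimes>\<^bsub>?F\<^esub> L)"
    if I: "I \<in> carrier ?F" and J: "J \<in> carrier ?F" and L: "L \<in> carrier ?F" for I J L
    unfolding fractional_simps vc_mult_left[OF msub[OF I J] sub[OF L]]
      vc_mult_right[OF sub[OF I] msub[OF J L]]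
    using set_mult_assoc sub I J L by simp
  show "\<one>\<^bsub>?F\<^esub> \<otimes>\<^bsub>?F\<^esub> I = I" if I: "I \<in> carrier ?F" for I
    unfolding fractional_simps using I by (simp add: fractional_iff vc_H_mult)
  show "I \<otimes>\<^bsub>?F\<^esub> J = J \<otimes>\<^bsub>?F\<^esub> I" if I: "I \<in> carrier ?F" and J: "J \<in> carrier ?F" for I J
    unfolding fractional_simps using set_mult_comm[OF sub[OF I] sub[OF J]] by simp
qed

sublocale Fv: comm_monoid "fractional_v_ideals Q H"
  by (rule comm_monoid_fractional)

abbreviation "U \<equiv> units_of (fractional_v_ideals Q H)"

lemma comm_group_U: "comm_group U"
  by (rule Fv.units_comm_group)

lemma U_simps: "carrier U = Units (fractional_v_ideals Q H)"
  "I \<otimes>\<^bsub>U\<^esub> J = vc (I <#> J)" "\<one>\<^bsub>U\<^esub> = H"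
  by (simp_all add: units_of_def fractional_simps)

lemma U_I:
  assumes "I \<in> carrier (fractional_v_ideals Q H)" "J \<in> carrier (fractional_v_ideals Q H)"
    "vc (I <#> J) = H"
  shows "I \<in> carrier U"
proof -
  have "vc (J <#> I) = H" using assms set_mult_comm[of I J] by (simp add: fractional_iff)
  then show ?thesis using assms unfolding U_simps Units_def fractional_simps by blast
qed

abbreviation "P \<equiv> {a <# H |a. a \<in> carrier Q}"

lemma vc_principal: "a \<in> carrier Q \<Longrightarrow> vc (a <# H) = a <# H"
  using vc_translate[OF _ H_sub] vc_H by simp

lemma translate_set_mult:
  assumes a: "a \<in> carrier Q" and I: "I \<subseteq> carrier Q" and J: "J \<subseteq> carrier Q"
  shows "(a <# I) <#> J = a <# (I <#> J)"
proof -
  have eq: "a \<otimes> i \<otimes> j = a \<otimes> (i \<otimes> j)" if "i \<in> I" "j \<in> J" for i j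
    using that I J a by (intro m_assoc) blast+
  show ?thesis
  proof (intro equalityI subsetI)
    fix x assume "x \<in> (a <# I) <#> J"
    then obtain i j where ij: "i \<in> I" "j \<in> J" "x = a \<otimes> i \<otimes> j"
      unfolding l_coset_def set_mult_def by blast
    then show "x \<in> a <# (I <#> J)" unfolding eq[OF ij(1,2)] l_coset_def set_mult_def by blast
  next
    fix x assume "x \<in> a <# (I <#> J)"
    then obtain i j where ij: "i \<in> I" "j \<in> J" "x = a \<otimes> (i \<otimes> j)"
      unfolding l_coset_def set_mult_def by blast
    then show "x \<in> (a <# I) <#> J"
      unfolding eq[OF ij(1,2), symmetric] l_coset_def set_mult_def by blast
  qed
qed

lemma principal_mult:
  assumes a: "a \<in> carrier Q" and J: "J \<subseteq> carrier Q" "vc J = J"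
  shows "vc ((a <# H) <#> J) = a <# J"
proof -
  have "H <#> J \<subseteq> carrier Q" by (intro set_mult_closed H_sub J(1))
  then show ?thesis
    unfolding translate_set_mult[OF a H_sub J(1)] using a vc_translate vc_H_mult[OF J] by simp
qed

lemma principal_fractional:
  assumes a: "a \<in> carrier Q"
  shows "a <# H \<in> carrier (fractional_v_ideals Q H)"
proof -
  have "inv a <# (a <# H) \<subseteq> H" using inv_translate[OF a H_sub] by simp
  then show ?thesis
    unfolding fractional_iff using vc_principal[OF a] l_coset_sub[OF a H_sub] inv_closed[OF a] by blast
qed

lemma principal_in_U:
  assumes a: "a \<in> carrier Q"
  shows "a <# H \<in> carrier U"
proof (rule U_I[of _ "inv a <# H"])
  show "vc ((a <# H) <#> (inv a <# H)) = H"
    using principal_mult[OF a l_coset_sub[OF inv_closed[OF a] H_sub] vc_principal[OF inv_closed[OF a]]]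
      translate_inv[OF a H_sub] by simp
qed (use principal_fractional a in auto)

lemma subgroup_P: "subgroup P U"
proof -
  interpret U: comm_group U by (rule comm_group_U)
  have mult: "(a <# H) \<otimes>\<^bsub>U\<^esub> (b <# H) = (a \<otimes> b) <# H" if "a \<in> carrier Q" "b \<in> carrier Q" for a b
    unfolding U_simps
    using principal_mult[OF that(1) l_coset_sub[OF that(2) H_sub] vc_principal[OF that(2)]] that
    by (simp add: lcos_m_assoc H_sub)
  have one: "\<one> <# H = H" using H_sub by (simp add: lcos_mult_one)
  have inv: "inv\<^bsub>U\<^esub> (a <# H) = inv a <# H" if "a \<in> carrier Q" for a
  proof (rule U.inv_equality)
    show "(inv a <# H) \<otimes>\<^bsub>U\<^esub> (a <# H) = \<one>\<^bsub>U\<^esub>"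
      unfolding mult[OF inv_closed[OF that] that] l_inv[OF that] U_simps(3) by (rule one)
  qed (intro principal_in_U inv_closed that)+
  show ?thesis
  proof (rule subgroup.intro)
    show "P \<subseteq> carrier U"
    proof
      fix x assume "x \<in> P"
      then obtain a where a: "a \<in> carrier Q" "x = a <# H" by blast
      show "x \<in> carrier U" unfolding a(2) by (rule principal_in_U[OF a(1)])
    qed
    show "x \<otimes>\<^bsub>U\<^esub> y \<in> P" if x: "x \<in> P" and y: "y \<in> P" for x y
    proof -
      obtain a where a: "a \<in> carrier Q" "x = a <# H" using x by blast
      obtain b where b: "b \<in> carrier Q" "y = b <# H" using y by blast
      show ?thesis unfolding a(2) b(2) mult[OF a(1) b(1)] using m_closed[OF a(1) b(1)] by blast
    qed
    show "\<one>\<^bsub>U\<^esub> \<in> P" unfolding U_simps(3) using one[symmetric] by blast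
    show "inv\<^bsub>U\<^esub> x \<in> P" if x: "x \<in> P" for x
    proof -
      obtain a where a: "a \<in> carrier Q" "x = a <# H" using x by blast
      show ?thesis unfolding a(2) inv[OF a(1)] using inv_closed[OF a(1)] by blast
    qed
  qed
qed

lemma normal_P: "P \<lhd> U"
  using comm_group.subgroup_imp_normal[OF comm_group_U subgroup_P] .

lemma group_v_class_group: "group (v_class_group Q H)"
  unfolding v_class_group_def by (rule normal.factorgroup_is_group[OF normal_P])

end

text \<open>The cosets of elements of \<open>M\<close> form a subgroup of the quotient; since it contains the generators, it is
  everything, and \<open>M\<close> contains a whole coset of \<open>H\<close> together with any of its elements.\<close>

lemma (in normal) subgroup_covers_if_quotient_generated:
  assumes gen: "generate (G Mod H) E = carrier (G Mod H)"
    and M: "subgroup M G" "H \<subseteq> M" and reps: "E \<subseteq> {H #> x |x. x \<in> M}"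
    and E: "E \<subseteq> carrier (G Mod H)"
  shows "carrier G \<subseteq> M"
proof -
  let ?M = "{H #> x |x. x \<in> M}"
  have Mc: "M \<subseteq> carrier G" by (rule subgroup.subset[OF M(1)])
  have E': "C \<in> ?M" if C: "C \<in> E" for C using reps C by blast
  have "C \<in> ?M" if "C \<in> generate (G Mod H) E" for C
    using that
  proof (induction rule: generate.induct)
    case one
    have "\<one>\<^bsub>G Mod H\<^esub> = H #> \<one>" using coset_mult_one[OF subset] by (simp add: FactGroup_def)
    then show ?case using subgroup.one_closed[OF M(1)] by blast
  next
    case (incl C)
    then show ?case by (rule E')
  next
    case (inv C)
    then obtain x where x: "x \<in> M" "C = H #> x" using E' by blast
    have "inv\<^bsub>G Mod H\<^esub> C = H #> inv x"
    proof -
      have xc: "x \<in> carrier G" using x(1) Mc by blast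
      have "C \<in> carrier (G Mod H)" using inv E by blast
      then have "inv\<^bsub>G Mod H\<^esub> C = set_inv C" by (rule inv_FactGroup)
      then show ?thesis using rcos_inv[OF xc] x(2) by simp
    qed
    then show ?case using subgroup.m_inv_closed[OF M(1) x(1)] by blast
  next
    case (eng C D)
    then obtain x y where x: "x \<in> M" "C = H #> x" and y: "y \<in> M" "D = H #> y" by blast
    have "C \<otimes>\<^bsub>G Mod H\<^esub> D = H #> (x \<otimes> y)"
      using rcos_sum[of x y] x y Mc by (auto simp: FactGroup_def)
    then show ?case using subgroup.m_closed[OF M(1) x(1) y(1)] by blast
  qed
  then have all: "carrier (G Mod H) \<subseteq> ?M" using gen by blast
  show ?thesis
  proof
    fix x assume x: "x \<in> carrier G"
    then have "H #> x \<in> carrier (G Mod H)" by (auto simp: FactGroup_def RCOSETS_def)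
    then obtain y where y: "y \<in> M" "H #> x = H #> y" using all by blast
    have "x \<in> H #> y" using y(2) rcos_self[OF x is_subgroup] by simp
    then obtain h where "h \<in> H" "x = h \<otimes> y" unfolding r_coset_def by blast
    then show "x \<in> M" using y(1) M(2) subgroup.m_closed[OF M(1)] by blast
  qed
qed

section \<open>The Mori property\<close>

text \<open>A nonincreasing sequence of natural numbers is constant once it has reached its minimum.\<close>

lemma nondecreasing_subsequence:
  fixes s :: "nat \<Rightarrow> nat"
  obtains r :: "nat \<Rightarrow> nat" where "strict_mono r" "\<forall>m n. m \<le> n \<longrightarrow> s (r m) \<le> s (r n)"
proof -
  obtain r :: "nat \<Rightarrow> nat" where r: "strict_mono r" "monoseq (\<lambda>n. s (r n))"
    using seq_monosub[of s] by blast
  show ?thesis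
  proof (cases "\<forall>m n. m \<le> n \<longrightarrow> s (r m) \<le> s (r n)")
    case True
    then show ?thesis using that r(1) by blast
  next
    case False
    then have dec: "s (r n) \<le> s (r m)" if "m \<le> n" for m n
      using r(2) that unfolding monoseq_def by blast
    obtain k where k: "\<forall>n. s (r k) \<le> s (r n)"
      using ex_has_least_nat[of "\<lambda>_. True" 0 "\<lambda>n. s (r n)"] by blast
    have const: "s (r (k + n)) = s (r k)" for n
      using k dec[of k "k + n"] by (simp add: le_antisym)
    have "strict_mono (\<lambda>n. r (k + n))" using r(1) by (simp add: strict_mono_def)
    then show ?thesis using that[of "\<lambda>n. r (k + n)"] const by simp
  qed
qed

text \<open>Dickson's lemma: thin out the sequence for one coordinate after the other.\<close>

lemma Dickson_subsequence:
  fixes f :: "nat \<Rightarrow> 'i \<Rightarrow> nat"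
  assumes "finite A"
  shows "\<exists>r :: nat \<Rightarrow> nat. strict_mono r \<and> (\<forall>i\<in>A. \<forall>m n. m \<le> n \<longrightarrow> f (r m) i \<le> f (r n) i)"
  using assms
proof (induction A)
  case empty
  show ?case by (intro exI[of _ "\<lambda>n. n"]) (simp add: strict_mono_def)
next
  case (insert i A)
  then obtain r :: "nat \<Rightarrow> nat" where r: "strict_mono r"
    "\<forall>i\<in>A. \<forall>m n. m \<le> n \<longrightarrow> f (r m) i \<le> f (r n) i" by blast
  obtain q :: "nat \<Rightarrow> nat" where q: "strict_mono q"
    "\<forall>m n. m \<le> n \<longrightarrow> f (r (q m)) i \<le> f (r (q n)) i"
    by (rule nondecreasing_subsequence[of "\<lambda>n. f (r n) i"])
  have "strict_mono (\<lambda>n. r (q n))" using r(1) q(1) by (simp add: strict_mono_def)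
  moreover have "f (r (q m)) j \<le> f (r (q n)) j" if "j \<in> A" "m \<le> n" for j m n
    using r(2) that strict_mono_less_eq[OF q(1), of m n] by blast
  ultimately show ?case using q(2) by (intro exI[of _ "\<lambda>n. r (q n)"]) simp
qed

context pm_monoid
begin

lemma submonoid_B': "submonoid B' Q"
proof (rule submonoid.intro)
  show "B' \<subseteq> carrier Q" by (rule embedded_subset)
  show "\<one>\<^bsub>Q\<^esub> \<in> B'" using embedded_iff[of "\<one>\<^bsub>Q\<^esub>" "{#}"] by simp
  show "x \<otimes>\<^bsub>Q\<^esub> y \<in> B'" if x: "x \<in> B'" and y: "y \<in> B'" for x y
  proof -
    obtain s where s: "s \<in> B" "x = emb s" using x by (rule embeddedE)
    obtain t where t: "t \<in> B" "y = emb t" using y by (rule embeddedE)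
    show ?thesis using embedded_iff[of "x \<otimes>\<^bsub>Q\<^esub> y" "s + t"] s t by (simp add: val_mult pm_add)
  qed
qed

sublocale SB: submonoid_of_group Q B'
  by (intro submonoid_of_group.intro submonoid_of_group_axioms.intro submonoid_B' Q.comm_group_axioms)

text \<open>For the separating sequences, let \<open>A\<^sub>n\<close> be the divisorial ideal generated by the \<open>c x\<^sub>k\<close> with \<open>k < n\<close>. The
  fraction \<open>b\<^sub>n / c\<close> multiplies these generators into \<open>B\<close>, but not \<open>c x\<^sub>n\<close>, so \<open>c x\<^sub>n\<close> is not in \<open>A\<^sub>n\<close>.\<close>

lemma finite_doubles_if_mori:
  assumes "mori_monoid (pm_zero_sum_monoid G)"
  shows "finite doubles"
proof (rule ccontr)
  assume "infinite doubles"
  then obtain c and b x :: "nat \<Rightarrow> 'a multiset" where s0: "c \<in> B"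
    "\<forall>n. b n \<in> B" "\<forall>n>0. b n \<noteq> {#}"
    "\<forall>n. set_mset (x n) \<subseteq> carrier G" "\<forall>n. c + x n \<in> B"
    "\<forall>n. \<forall>k<n. b n + x k \<in> B" "\<forall>n. b n + x n \<notin> B"
    by (rule separating_sequences)
  define w where "w k = emb (c + x k)" for k
  have wB: "w k \<in> B'" and wQ: "w k \<in> carrier Q" for k
    using s0(5) by (simp_all add: w_def emb_in_embedded)
  define A where "A n = SB.vc (w ` {..<n})" for n
  have WQ: "w ` {..<n} \<subseteq> carrier Q" for n using wQ by blast
  have "divisorial_ideal Q B' (A n)" for n
    unfolding divisorial_ideal_def A_def
  proof
    have "SB.vc (w ` {..<n}) \<subseteq> SB.vc B'" by (rule SB.vc_mono) (use wB in blast)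
    then show "SB.vc (w ` {..<n}) \<subseteq> B'" unfolding SB.vc_H .
    show "SB.vc (SB.vc (w ` {..<n})) = SB.vc (w ` {..<n})" by (rule SB.vc_idem[OF WQ])
  qed
  moreover have "A n \<subseteq> A (Suc n)" for n unfolding A_def by (rule SB.vc_mono) auto
  ultimately obtain N where N: "\<forall>n\<ge>N. A n = A N"
    using assms unfolding mori_monoid_def by blast
  have "w N \<in> A (Suc N)" unfolding A_def using SB.vc_extensive[OF WQ[of "Suc N"]] by blast
  then have wN: "w N \<in> A N" using N[rule_format, of "Suc N"] by simp
  define y where "y = emb (b N) \<otimes>\<^bsub>Q\<^esub> inv\<^bsub>Q\<^esub> (emb c)"
  have yQ: "y \<in> carrier Q" using s0(1,2) by (simp add: y_def)
  have vy: "val (y \<otimes>\<^bsub>Q\<^esub> w k) g = int (count (b N + x k) g)" for k g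
    using s0(1,2,5) wQ by (simp add: y_def w_def val_mult val_inv)
  have mem: "y \<otimes>\<^bsub>Q\<^esub> w k \<in> B' \<longleftrightarrow> b N + x k \<in> B" for k
    by (rule embedded_iff[OF _ vy]) (use yQ wQ in simp)
  have yd: "y \<in> SB.dual (w ` {..<N})"
    unfolding ideal_colon_iff using yQ mem s0(6) by simp
  have "w N \<in> SB.dual (SB.dual (w ` {..<N}))" using wN by (simp only: A_def SB.vc_def)
  then have "\<forall>z\<in>SB.dual (w ` {..<N}). w N \<otimes>\<^bsub>Q\<^esub> z \<in> B'"
    by (subst (asm) ideal_colon_iff) simp
  then have "w N \<otimes>\<^bsub>Q\<^esub> y \<in> B'" using yd by (rule bspec)
  then have "y \<otimes>\<^bsub>Q\<^esub> w N \<in> B'" using Q.m_comm[OF yQ wQ] by simp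
  then show False using mem s0(7) by blast
qed

text \<open>The cofactor of \<open>S\<close> in \<open>T\<close> is a square, so it lies in \<open>B\<close> and is absorbed by the ideal.\<close>

lemma emb_mem_if_even_difference:
  assumes I: "divisorial_ideal Q B' I" and S: "S \<in> B" "emb S \<in> I"
    and T: "S \<subseteq># T" "\<And>g. even (count T g - count S g)" "T \<in> B"
  shows "emb T \<in> I"
proof -
  define D where "D = T - S"
  have D2: "count D g = 2 * (count D g div 2)" for g
    unfolding D_def count_diff by (rule even_two_times_div_two[OF T(2), symmetric])
  define R where "R = Abs_multiset (\<lambda>g. count D g div 2)"
  have fin: "finite {g. 0 < count D g div 2}"
  proof (rule finite_subset[of _ "set_mset D"])
    show "{g. 0 < count D g div 2} \<subseteq> set_mset D"
    proof
      fix g assume "g \<in> {g. 0 < count D g div 2}"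
      then have "count D g \<noteq> 0" by (intro notI) simp
      then show "g \<in># D" by (simp add: count_eq_zero_iff)
    qed
  qed simp
  have cR: "count R g = count D g div 2" for g using fin by (simp add: R_def)
  have DR: "D = R + R" 
  proof (rule multiset_eqI)
    show "count D g = count (R + R) g" for g using D2[of g] cR[of g] by simp
  qed
  have TS: "T = S + D" using T(1) by (simp add: D_def)
  have "set_mset R \<subseteq> carrier G" using pm_carrier[OF T(3)] TS DR by auto
  then have DB: "D \<in> B" unfolding DR by (rule pm_double)
  have IQ: "I \<subseteq> carrier Q" "SB.vc I = I"
    using I embedded_subset unfolding divisorial_ideal_def by blast+
  have "emb D \<otimes>\<^bsub>Q\<^esub> emb S \<in> I" by (rule SB.vc_absorb[OF IQ emb_in_embedded[OF DB] S(2)])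
  moreover have "emb D \<otimes>\<^bsub>Q\<^esub> emb S = emb T"
    by (rule val_eqI) (use DB S(1) T(3) TS in \<open>simp_all add: val_mult\<close>)
  ultimately show ?thesis by simp
qed

text \<open>In a chain that does not stabilize choose \<open>S\<^sub>N\<close> outside the \<open>N\<close>-th ideal but in the union. By Dickson's lemma,
  some \<open>S\<^sub>N\<close> divides infinitely many later ones with a square as cofactor; these all lie in the first ideal
  that contains \<open>S\<^sub>N\<close>, contradicting their choice.\<close>

theorem mori_if_finite:
  assumes fin: "finite (carrier G)"
  shows "mori_monoid (pm_zero_sum_monoid G)"
  unfolding mori_monoid_def
proof (intro conjI allI impI)
  show "comm_monoid_cancel (pm_zero_sum_monoid G)" by (rule comm_monoid_cancel_pm)
  fix I :: "nat \<Rightarrow> ('a multiset \<times> 'a multiset) set set"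
  assume "(\<forall>n. divisorial_ideal Q B' (I n)) \<and> (\<forall>n. I n \<subseteq> I (Suc n))"
  then have div: "\<And>n. divisorial_ideal Q B' (I n)" and suc: "\<And>n. I n \<subseteq> I (Suc n)" by blast+
  have mono: "I m \<subseteq> I n" if "m \<le> n" for m n using lift_Suc_mono_le[of I, OF suc that] .
  show "\<exists>N. \<forall>n\<ge>N. I n = I N"
  proof (rule ccontr)
    assume neg: "\<not> (\<exists>N. \<forall>n\<ge>N. I n = I N)"
    have "\<exists>S n. S \<in> B \<and> emb S \<in> I n \<and> emb S \<notin> I N" for N
    proof -
      obtain n where n: "n \<ge> N" "I n \<noteq> I N" using neg by blast
      then obtain x where x: "x \<in> I n" "x \<notin> I N" using mono[OF n(1)] by blast
      have "x \<in> B'" using x(1) div[of n] unfolding divisorial_ideal_def by blast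
      then obtain S where "S \<in> B" "x = emb S" by (rule embeddedE)
      then show ?thesis using x by blast
    qed
    then obtain S M where S: "\<And>N. S N \<in> B" "\<And>N. emb (S N) \<in> I (M N)" "\<And>N. emb (S N) \<notin> I N"
      by metis
    \<comment> \<open>Besides the multiplicities, \<open>f\<close> records the parities and the opposite parities: a subsequence on which
      both are nondecreasing has constant parities.\<close>
    define f where "f N p = (case p of (g, k) \<Rightarrow>
        if k = 0 then count (S N) g else if k = 1 then count (S N) g mod 2
        else 1 - count (S N) g mod 2)" for N :: nat and p :: "'a \<times> nat"
    have "finite (carrier G \<times> {0, 1, 2::nat})" using fin by simp
    then obtain r :: "nat \<Rightarrow> nat" where r: "strict_mono r"
      "\<forall>p\<in>carrier G \<times> {0, 1, 2}. \<forall>m n. m \<le> n \<longrightarrow> f (r m) p \<le> f (r n) p"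
      using Dickson_subsequence by blast
    define m where "m = M (r 0)"
    have cmp: "count (S (r 0)) g \<le> count (S (r m)) g \<and> even (count (S (r m)) g - count (S (r 0)) g)" for g
    proof (cases "g \<in> carrier G")
      case True
      have le: "f (r 0) (g, k) \<le> f (r m) (g, k)" if "k \<in> {0, 1, 2}" for k
        using r(2) True that by blast
      have 0: "count (S (r 0)) g \<le> count (S (r m)) g" using le[of 0] by (simp add: f_def)
      have "count (S (r 0)) g mod 2 = count (S (r m)) g mod 2"
        using le[of 1] le[of 2] by (simp add: f_def)
      then have "2 dvd (count (S (r m)) g - count (S (r 0)) g)"
        using mod_eq_dvd_iff_nat[OF 0, of 2] by (simp del: even_diff_nat)
      then show ?thesis using 0 by simp
    next
      case False
      then have "count (S N) g = 0" for N using pm_carrier[OF S(1), of N] by (meson count_inI subsetD)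
      then show ?thesis by simp
    qed
    have "emb (S (r m)) \<in> I m"
      by (rule emb_mem_if_even_difference[OF div S(1)[of "r 0"]]) (use S cmp in \<open>auto simp: m_def intro: mset_subset_eqI\<close>)
    moreover have "m \<le> r m" using r(1) by (rule strict_mono_imp_increasing)
    ultimately show False using mono S(3) by blast
  qed
qed

end

section \<open>The class group of the complete integral closure\<close>

context pm_monoid
begin

lemma submonoid_K: "submonoid K Q"
  by (rule submonoid.intro) (auto simp: K_iff val_mult)

sublocale SK: submonoid_of_group Q K
  by (intro submonoid_of_group.intro submonoid_of_group_axioms.intro submonoid_K Q.comm_group_axioms)

abbreviation "Fv \<equiv> fractional_v_ideals Q K"

text \<open>The fraction \<open>s / t\<close> of arbitrary sequences stands for an element of the quotient group of the free
  monoid, and the set consists of the products of \<open>s / t\<close> with sequences that lie in the quotient group of \<open>B\<close>.\<close>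

definition ideal_above :: "'a multiset \<Rightarrow> 'a multiset \<Rightarrow> ('a multiset \<times> 'a multiset) set set" where
  "ideal_above s t = {x \<in> carrier Q. \<forall>g. int (count s g) \<le> val x g + int (count t g)}"

text \<open>The fraction \<open>s / t\<close> is the greatest common divisor of \<open>J\<close> in the quotient group of the free monoid,
  that is, the pointwise minimum of the valuations.\<close>

definition content :: "('a multiset \<times> 'a multiset) set set \<Rightarrow> 'a multiset \<Rightarrow> 'a multiset \<Rightarrow> bool" where
  "content J s t \<longleftrightarrow> J \<subseteq> carrier Q \<and> set_mset s \<subseteq> carrier G \<and> set_mset t \<subseteq> carrier G \<and>
     (\<forall>g. (\<forall>x\<in>J. int (count s g) \<le> val x g + int (count t g)) \<and>
          (\<exists>x\<in>J. int (count s g) = val x g + int (count t g)))"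

lemma above_sub: "ideal_above s t \<subseteq> carrier Q"
  by (auto simp: ideal_above_def)

lemma contentD:
  assumes "content J s t"
  shows "J \<subseteq> carrier Q" "set_mset s \<subseteq> carrier G" "set_mset t \<subseteq> carrier G"
    "x \<in> J \<Longrightarrow> int (count s g) \<le> val x g + int (count t g)"
    "\<exists>x\<in>J. int (count s g) = val x g + int (count t g)"
  using assms unfolding content_def by blast+

lemma contentI:
  assumes "J \<subseteq> carrier Q" "set_mset s \<subseteq> carrier G" "set_mset t \<subseteq> carrier G"
    "\<And>x g. x \<in> J \<Longrightarrow> int (count s g) \<le> val x g + int (count t g)"
    "\<And>g. \<exists>x\<in>J. int (count s g) = val x g + int (count t g)"
  shows "content J s t"
  using assms unfolding content_def by blast

lemma dual_K_iff:
  assumes "J \<subseteq> carrier Q"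
  shows "x \<in> SK.dual J \<longleftrightarrow> x \<in> carrier Q \<and> (\<forall>y\<in>J. \<forall>g. 0 \<le> val x g + val y g)"
proof -
  have "x \<otimes>\<^bsub>Q\<^esub> y \<in> K \<longleftrightarrow> (\<forall>g. 0 \<le> val x g + val y g)" if "x \<in> carrier Q" "y \<in> J" for y
  proof -
    have "y \<in> carrier Q" using that(2) assms by blast
    then show ?thesis using that(1) by (simp add: K_iff val_mult)
  qed
  then show ?thesis unfolding ideal_colon_iff by blast
qed

text \<open>Only the minima of the valuations on \<open>J\<close> matter for membership in the dual.\<close>

lemma dual_if_content:
  assumes c: "content J s t"
  shows "SK.dual J = ideal_above t s"
proof (intro equalityI subsetI)
  fix x assume x: "x \<in> SK.dual J"
  then have xQ: "x \<in> carrier Q" using SK.dual_sub by blast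
  have "int (count t g) \<le> val x g + int (count s g)" for g
  proof -
    obtain y where y: "y \<in> J" "int (count s g) = val y g + int (count t g)"
      using contentD(5)[OF c, of g] by blast
    have "0 \<le> val x g + val y g" using x y(1) unfolding dual_K_iff[OF contentD(1)[OF c]] by blast
    then show ?thesis using y(2) by linarith
  qed
  then show "x \<in> ideal_above t s" using xQ by (simp add: ideal_above_def)
next
  fix x assume "x \<in> ideal_above t s"
  then have x: "x \<in> carrier Q" "\<And>g. int (count t g) \<le> val x g + int (count s g)"
    by (simp_all add: ideal_above_def)
  have "0 \<le> val x g + val y g" if "y \<in> J" for y g
    using x(2)[of g] contentD(4)[OF c that, of g] by linarith
  then show "x \<in> SK.dual J" unfolding dual_K_iff[OF contentD(1)[OF c]] using x(1) by blast
qed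

lemma val_bound:
  assumes "x \<in> carrier Q"
  obtains p q where "p \<in> B" "q \<in> B" "\<And>g. val x g = int (count p g) - int (count q g)"
proof -
  obtain p q where pq: "x = pm.fraction p q" "p \<in> B" "q \<in> B" by (rule Q_cases[OF assms])
  show ?thesis by (rule that[OF pq(2,3)]) (simp add: pq(1) val_frac[OF pq(2,3)])
qed

text \<open>The denominator \<open>c\<close> makes all valuations nonnegative, so the minima exist; they vanish almost everywhere,
  being bounded by the valuations of one element of \<open>J\<close>.\<close>

lemma content_exists:
  assumes J: "J \<subseteq> carrier Q" "J \<noteq> {}" and c: "c \<in> carrier Q" "c <#\<^bsub>Q\<^esub> J \<subseteq> K"
  shows "\<exists>s t. content J s t"
proof -
  obtain p q where pq: "p \<in> B" "q \<in> B" "\<And>g. val c g = int (count p g) - int (count q g)"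
    using val_bound[OF c(1)] by metis
  have nn: "0 \<le> val c g + val x g" if x: "x \<in> J" for x g
  proof -
    have "c \<otimes>\<^bsub>Q\<^esub> x \<in> K" using c(2) x unfolding l_coset_def by blast
    moreover have "x \<in> carrier Q" using x J by blast
    ultimately show ?thesis using c(1) by (simp add: K_iff val_mult)
  qed
  obtain x0 where x0: "x0 \<in> J" using J by blast
  define n where "n x g = nat (val c g + val x g)" for x g
  define m where "m g = (LEAST k. \<exists>x\<in>J. n x g = k)" for g
  have ex: "\<exists>k. \<exists>x\<in>J. n x g = k" for g using x0 by blast
  have m1: "\<exists>x\<in>J. n x g = m g" for g unfolding m_def by (rule LeastI_ex[OF ex])
  have m2: "m g \<le> n x g" if "x \<in> J" for x g
    unfolding m_def by (rule Least_le) (use that in blast)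
  obtain a b where ab: "a \<in> B" "b \<in> B" "\<And>g. val x0 g = int (count a g) - int (count b g)"
    using val_bound[of x0] x0 J by (metis subsetD)
  have small: "m g \<le> count p g + count a g" for g
    using m2[OF x0, of g] pq(3)[of g] ab(3)[of g] by (simp add: n_def)
  have fin: "finite {g. 0 < m g}"
  proof (rule finite_subset[of _ "set_mset (p + a)"])
    show "{g. 0 < m g} \<subseteq> set_mset (p + a)"
    proof
      fix g assume "g \<in> {g. 0 < m g}"
      then have "0 < m g" by simp
      then have "count p g + count a g \<noteq> 0" using small[of g] by linarith
      then show "g \<in># p + a" by simp
    qed
  qed simp
  define u where "u = Abs_multiset m"
  have cu: "count u g = m g" for g using fin by (simp add: u_def)
  have uG: "set_mset u \<subseteq> carrier G"
  proof
    fix g assume "g \<in># u"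
    then have "0 < m g" unfolding cu[symmetric] by (simp only: count_greater_zero_iff)
    then have "count p g + count a g \<noteq> 0" using small[of g] by linarith
    then have "g \<in># p + a" by simp
    then show "g \<in> carrier G" using pm_carrier[OF pq(1)] pm_carrier[OF ab(1)] by auto
  qed
  have nx: "int (n x g) = val c g + val x g" if "x \<in> J" for x g using nn[OF that, of g] by (simp add: n_def)
  have "content J (u + q) p"
  proof (rule contentI)
    show "J \<subseteq> carrier Q" by (rule J(1))
    show "set_mset (u + q) \<subseteq> carrier G" using uG pm_carrier[OF pq(2)] by simp
    show "set_mset p \<subseteq> carrier G" by (rule pm_carrier[OF pq(1)])
    show "int (count (u + q) g) \<le> val x g + int (count p g)" if "x \<in> J" for x g
      using m2[OF that, of g] nx[OF that, of g] pq(3)[of g] cu[of g] by simp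
    show "\<exists>x\<in>J. int (count (u + q) g) = val x g + int (count p g)" for g
    proof -
      obtain x where x: "x \<in> J" "n x g = m g" using m1 by blast
      have "int (count (u + q) g) = val x g + int (count p g)"
        using x(2) nx[OF x(1), of g] pq(3)[of g] cu[of g] by simp
      then show ?thesis using x(1) by blast
    qed
  qed
  then show ?thesis by blast
qed

lemma content_of_fractional:
  assumes "J \<in> carrier Fv" "J \<noteq> {}"
  shows "\<exists>s t. content J s t"
  using assms content_exists unfolding SK.fractional_iff by blast

text \<open>The empty set may be a divisorial ideal. Its product with any ideal is its own closure, the dual of the
  whole quotient group; if this were \<open>K\<close>, then \<open>K\<close> would contain the inverse of \<open>0\<^sup>2\<close>.\<close>

lemma unit_nonempty:
  assumes "J \<in> carrier SK.U"
  shows "J \<noteq> {}"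
proof
  assume e: "J = {}"
  have "J \<in> Units Fv" using assms by (simp add: SK.U_simps)
  then obtain I where "SK.vc (J <#>\<^bsub>Q\<^esub> I) = K" unfolding Units_def SK.fractional_simps by blast
  moreover have "J <#>\<^bsub>Q\<^esub> I = {}" unfolding e set_mult_def by blast
  ultimately have v: "SK.dual (SK.dual {}) = K" by (simp add: SK.vc_def)
  have d: "SK.dual {} = carrier Q" by (auto simp: ideal_colon_iff)
  have "\<one>\<^bsub>Q\<^esub> \<in> SK.dual (carrier Q)" using v SK.H_one unfolding d by simp
  moreover define z where "z = inv\<^bsub>Q\<^esub> (emb {#\<one>, \<one>#})"
  have p: "{#\<one>, \<one>#} \<in> B" using pm_double[of "{#\<one>#}"] by simp
  have zQ: "z \<in> carrier Q" using p by (simp add: z_def)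
  ultimately have "\<one>\<^bsub>Q\<^esub> \<otimes>\<^bsub>Q\<^esub> z \<in> K" by (simp add: ideal_colon_iff)
  then have "0 \<le> val z \<one>" using zQ by (simp add: K_iff)
  then show False using p by (simp add: z_def val_inv)
qed

lemma content_of_unit:
  assumes "J \<in> carrier SK.U"
  shows "\<exists>s t. content J s t"
proof (rule content_of_fractional)
  show "J \<in> carrier Fv" using assms by (auto simp: SK.U_simps Units_def)
  show "J \<noteq> {}" by (rule unit_nonempty[OF assms])
qed

text \<open>Bidualize: the ideal is the dual of its dual, and a dual is determined by a content.\<close>

lemma unit_eq_above:
  assumes "J \<in> carrier SK.U"
  obtains s t where "J = ideal_above s t" "set_mset s \<subseteq> carrier G" "set_mset t \<subseteq> carrier G"
proof -
  have "J \<in> carrier Fv" using assms by (auto simp: SK.U_simps Units_def)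
  then have J: "J \<subseteq> carrier Q" "SK.vc J = J" "\<exists>c\<in>carrier Q. c <#\<^bsub>Q\<^esub> J \<subseteq> K"
    unfolding SK.fractional_iff by blast+
  obtain c where c: "c \<in> carrier Q" "c <#\<^bsub>Q\<^esub> J \<subseteq> K" using J(3) by blast
  obtain x0 where x0: "x0 \<in> J" using unit_nonempty[OF assms] by blast
  have x0Q: "x0 \<in> carrier Q" using x0 J by blast
  have "c \<in> SK.dual J" using c unfolding ideal_colon_def by blast
  then have "SK.dual J \<noteq> {}" by blast
  moreover have "x0 <#\<^bsub>Q\<^esub> SK.dual J \<subseteq> K"
  proof
    fix z assume "z \<in> x0 <#\<^bsub>Q\<^esub> SK.dual J"
    then obtain y where y: "y \<in> SK.dual J" "z = x0 \<otimes>\<^bsub>Q\<^esub> y" unfolding l_coset_def by blast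
    have "y \<in> carrier Q" "y \<otimes>\<^bsub>Q\<^esub> x0 \<in> K" using y(1) x0 by (simp_all add: ideal_colon_iff)
    then show "z \<in> K" using y(2) x0Q by (simp add: Q.m_comm)
  qed
  ultimately obtain s t where st: "content (SK.dual J) s t"
    using content_exists[OF SK.dual_sub _ x0Q] by blast
  have "J = ideal_above t s" using dual_if_content[OF st] J(2) by (simp add: SK.vc_def)
  then show ?thesis using that contentD(2,3)[OF st] by blast
qed

lemma above_translate:
  assumes a: "a \<in> carrier Q"
    and v: "\<And>g. val a g = (int (count s g) - int (count t g)) - (int (count s' g) - int (count t' g))"
  shows "ideal_above s t = a <#\<^bsub>Q\<^esub> ideal_above s' t'"
proof (intro equalityI subsetI)
  fix x assume "x \<in> ideal_above s t"
  then have x: "x \<in> carrier Q" "\<And>g. int (count s g) \<le> val x g + int (count t g)"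
    by (simp_all add: ideal_above_def)
  define y where "y = inv\<^bsub>Q\<^esub> a \<otimes>\<^bsub>Q\<^esub> x"
  have yQ: "y \<in> carrier Q" using a x by (simp add: y_def)
  have "int (count s' g) \<le> val y g + int (count t' g)" for g
    using x(2)[of g] v[of g] a x(1) by (simp add: y_def val_mult val_inv)
  then have "y \<in> ideal_above s' t'" using yQ by (simp add: ideal_above_def)
  moreover have "x = a \<otimes>\<^bsub>Q\<^esub> y" using a x(1) by (simp add: y_def flip: Q.m_assoc)
  ultimately show "x \<in> a <#\<^bsub>Q\<^esub> ideal_above s' t'" unfolding l_coset_mem by blast
next
  fix x assume "x \<in> a <#\<^bsub>Q\<^esub> ideal_above s' t'"
  then obtain y where y: "y \<in> ideal_above s' t'" "x = a \<otimes>\<^bsub>Q\<^esub> y" unfolding l_coset_mem by blast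
  then have y': "y \<in> carrier Q" "\<And>g. int (count s' g) \<le> val y g + int (count t' g)"
    by (simp_all add: ideal_above_def)
  have "int (count s g) \<le> val x g + int (count t g)" for g
    using y'(2)[of g] v[of g] a y'(1) y(2) by (simp add: val_mult)
  then show "x \<in> ideal_above s t" using a y(2) y'(1) by (simp add: ideal_above_def)
qed

text \<open>If the sums of \<open>s / t\<close> and \<open>s' / t'\<close> agree, their quotient has sum zero and so lies in the quotient group
  of \<open>B\<close>; the ideals differ by this principal factor.\<close>

lemma same_class:
  assumes J: "J \<in> carrier SK.U" "J = ideal_above s t" and J': "J' \<in> carrier SK.U" "J' = ideal_above s' t'"
    and c: "set_mset s \<subseteq> carrier G" "set_mset t \<subseteq> carrier G"
      "set_mset s' \<subseteq> carrier G" "set_mset t' \<subseteq> carrier G"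
    and eq: "sigma s \<otimes> inv (sigma t) = sigma s' \<otimes> inv (sigma t')"
  shows "SK.P #>\<^bsub>SK.U\<^esub> J = SK.P #>\<^bsub>SK.U\<^esub> J'"
proof -
  interpret U: comm_group SK.U by (rule SK.comm_group_U)
  have m: "sigma s \<in> carrier G" "sigma t \<in> carrier G" "sigma s' \<in> carrier G" "sigma t' \<in> carrier G"
    using c by simp_all
  have "sigma (s + t') \<otimes> inv (sigma (t + s'))
      = (sigma s \<otimes> inv (sigma t)) \<otimes> inv (sigma s' \<otimes> inv (sigma t'))"
    using c m by (simp add: inv_mult m_ac)
  also have "\<dots> = \<one>" unfolding eq using m by simp
  finally have "sigma (s + t') \<otimes> inv (sigma (t + s')) \<in> doubles"
    using subgroup.one_closed[OF subgroup_doubles] by simp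
  then obtain a where a: "a \<in> carrier Q"
    "\<And>g. val a g = int (count (s + t') g) - int (count (t + s') g)"
    using exists_with_val[of "s + t'" "t + s'"] c by (metis Un_least set_mset_union)
  have tr: "J = a <#\<^bsub>Q\<^esub> J'"
    unfolding J(2) J'(2) by (rule above_translate[OF a(1)]) (simp add: a(2))
  have "J' \<in> carrier Fv" using J'(1) by (auto simp: SK.U_simps Units_def)
  then have f: "J' \<subseteq> carrier Q" "SK.vc J' = J'" unfolding SK.fractional_iff by blast+
  have "(a <#\<^bsub>Q\<^esub> K) \<otimes>\<^bsub>SK.U\<^esub> J' = J"
    unfolding SK.U_simps tr by (rule SK.principal_mult[OF a(1) f])
  then have "J \<in> SK.P #>\<^bsub>SK.U\<^esub> J'" unfolding r_coset_def using a(1) by blast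
  then show ?thesis using U.repr_independence[OF _ J'(1) SK.subgroup_P] by simp
qed

text \<open>Each class is given by some \<open>s / t\<close> and depends only on the sum of \<open>s / t\<close>, so there are at most \<open>|G|\<close>
  classes.\<close>

theorem fin_gen_class_group_if_finite:
  assumes fin: "finite (carrier G)"
  shows "fin_gen_group (v_class_group Q K)"
proof -
  let ?C = "v_class_group Q K"
  interpret C: group ?C by (rule SK.group_v_class_group)
  define T where "T v = {C. \<exists>J s t. J \<in> carrier SK.U \<and> C = SK.P #>\<^bsub>SK.U\<^esub> J \<and> J = ideal_above s t \<and>
      set_mset s \<subseteq> carrier G \<and> set_mset t \<subseteq> carrier G \<and> v = sigma s \<otimes> inv (sigma t)}" for v
  have T1: "C = D" if C: "C \<in> T v" and D: "D \<in> T v" for C D v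
  proof -
    obtain J s t where J: "J \<in> carrier SK.U" "C = SK.P #>\<^bsub>SK.U\<^esub> J" "J = ideal_above s t"
      "set_mset s \<subseteq> carrier G" "set_mset t \<subseteq> carrier G" "v = sigma s \<otimes> inv (sigma t)"
      using C unfolding T_def by blast
    obtain I p q where I: "I \<in> carrier SK.U" "D = SK.P #>\<^bsub>SK.U\<^esub> I" "I = ideal_above p q"
      "set_mset p \<subseteq> carrier G" "set_mset q \<subseteq> carrier G" "v = sigma p \<otimes> inv (sigma q)"
      using D unfolding T_def by blast
    show ?thesis
      unfolding J(2) I(2)
      by (rule same_class[OF J(1,3) I(1,3) J(4,5) I(4,5)]) (simp only: J(6)[symmetric] I(6)[symmetric])
  qed
  have "finite (T v)" for v
  proof (cases "T v = {}")
    case False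
    then obtain C where "C \<in> T v" by blast
    then have "T v \<subseteq> {C}" using T1 by blast
    then show ?thesis by (rule finite_subset) simp
  qed simp
  then have "finite (\<Union>v\<in>carrier G. T v)" using fin by blast
  moreover have "carrier ?C \<subseteq> (\<Union>v\<in>carrier G. T v)"
  proof
    fix C assume "C \<in> carrier ?C"
    then have "C \<in> rcosets\<^bsub>SK.U\<^esub> SK.P" by (simp add: v_class_group_def FactGroup_def)
    then obtain J where J: "J \<in> carrier SK.U" "C = SK.P #>\<^bsub>SK.U\<^esub> J" unfolding RCOSETS_def by blast
    obtain s t where st: "J = ideal_above s t" "set_mset s \<subseteq> carrier G" "set_mset t \<subseteq> carrier G"
      by (rule unit_eq_above[OF J(1)])
    have "C \<in> T (sigma s \<otimes> inv (sigma t))" unfolding T_def using J st by blast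
    moreover have "sigma s \<otimes> inv (sigma t) \<in> carrier G" using st(2,3) by simp
    ultimately show "C \<in> (\<Union>v\<in>carrier G. T v)" by blast
  qed
  ultimately have finC: "finite (carrier ?C)" by (rule finite_subset[rotated])
  have "generate ?C (carrier ?C) = carrier ?C"
    using C.generate_incl[of "carrier ?C"] generate.incl[of _ "carrier ?C" ?C] by blast
  then show ?thesis unfolding fin_gen_group_def using finC by blast
qed

lemma content_unique:
  assumes 1: "content J s t" and 2: "content J s' t'"
  shows "s + t' = s' + t"
proof (rule multiset_eqI)
  fix g
  obtain x where x: "x \<in> J" "int (count s g) = val x g + int (count t g)" using contentD(5)[OF 1] by blast
  obtain y where y: "y \<in> J" "int (count s' g) = val y g + int (count t' g)" using contentD(5)[OF 2] by blast
  show "count (s + t') g = count (s' + t) g"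
    using x(2) y(2) contentD(4)[OF 1 y(1), of g] contentD(4)[OF 2 x(1), of g] by simp
qed

text \<open>Each \<open>s / t\<close> is the greatest common divisor of its multiples in the quotient group of \<open>B\<close>, and each
  valuation is attained: \<open>s / t\<close> is multiplied by a sequence \<open>u v\<close> with \<open>u \<noteq> g\<close>, \<open>v \<noteq> g\<close> that brings its sum to zero. In
  a small group there may be no such \<open>u\<close> and \<open>v\<close>.\<close>

lemma divisor_theory:
  assumes inf: "infinite (carrier G)"
    and s: "set_mset s \<subseteq> carrier G" and t: "set_mset t \<subseteq> carrier G"
  shows "\<exists>x\<in>ideal_above s t. int (count s g) = val x g + int (count t g)"
proof -
  define z where "z = sigma t \<otimes> inv (sigma s)"
  have z: "z \<in> carrier G" using s t by (simp add: z_def)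
  have "{u \<in> carrier G. u = g \<or> inv u \<otimes> z = g} \<subseteq> {g, z \<otimes> inv g}"
  proof
    fix u assume u: "u \<in> {u \<in> carrier G. u = g \<or> inv u \<otimes> z = g}"
    show "u \<in> {g, z \<otimes> inv g}"
    proof (cases "u = g")
      case False
      then have uG: "u \<in> carrier G" and e: "g = inv u \<otimes> z" using u by auto
      have "z \<otimes> inv g = z \<otimes> (u \<otimes> inv z)" unfolding e using uG z by (simp add: inv_mult)
      also have "\<dots> = u" using uG z m_lcomm[of z u "inv z"] by simp
      finally show ?thesis by simp
    qed simp
  qed
  then have "finite {u \<in> carrier G. u = g \<or> inv u \<otimes> z = g}" by (rule finite_subset) simp
  then have "infinite (carrier G - {u \<in> carrier G. u = g \<or> inv u \<otimes> z = g})"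
    using inf by (rule Diff_infinite_finite)
  then obtain u where "u \<in> carrier G - {u \<in> carrier G. u = g \<or> inv u \<otimes> z = g}"
    by (metis finite.emptyI ex_in_conv)
  then have u: "u \<in> carrier G" "u \<noteq> g" "inv u \<otimes> z \<noteq> g" by simp_all
  define r where "r = {#u, inv u \<otimes> z#}"
  have r: "set_mset r \<subseteq> carrier G" "count r g = 0" using u z by (auto simp: r_def)
  have "u \<otimes> (inv u \<otimes> z) = z" using u(1) z by (simp flip: m_assoc)
  then have sr: "sigma r = z" using u z by (simp add: r_def)
  have "sigma (s + r) \<otimes> inv (sigma t) = \<one>"
  proof -
    have "sigma s \<otimes> (sigma t \<otimes> inv (sigma s)) = sigma t"
      using s t m_lcomm[of "sigma s" "sigma t" "inv (sigma s)"] by simp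
    then show ?thesis using s t r(1) sr by (simp add: z_def)
  qed
  then have d: "sigma (s + r) \<otimes> inv (sigma t) \<in> doubles"
    using subgroup.one_closed[OF subgroup_doubles] by simp
  have sr': "set_mset (s + r) \<subseteq> carrier G" using s r by simp
  obtain x where x: "x \<in> carrier Q" "\<And>g. val x g = int (count (s + r) g) - int (count t g)"
    using exists_with_val[OF sr' t d] by metis
  have "x \<in> ideal_above s t" using x by (simp add: ideal_above_def)
  moreover have "int (count s g) = val x g + int (count t g)" using x(2)[of g] r(2) by simp
  ultimately show ?thesis by blast
qed

lemma content_above:
  assumes "infinite (carrier G)" "set_mset s \<subseteq> carrier G" "set_mset t \<subseteq> carrier G"
  shows "content (ideal_above s t) s t"
proof (rule contentI)
  show "int (count s g) \<le> val x g + int (count t g)" if "x \<in> ideal_above s t" for x g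
    using that by (simp add: ideal_above_def)
qed (use assms above_sub divisor_theory in auto)

text \<open>Contents are multiplicative, also after \<open>v\<close>-closure, since each bound on valuations is realized by an
  element \<open>x\<close> of the dual.\<close>

lemma content_mult:
  assumes inf: "infinite (carrier G)" and 1: "content I s t" and 2: "content J s' t'"
  shows "content (SK.vc (I <#>\<^bsub>Q\<^esub> J)) (s + s') (t + t')"
proof (rule contentI)
  have IJ: "I <#>\<^bsub>Q\<^esub> J \<subseteq> carrier Q"
    by (rule Q.set_mult_closed[OF contentD(1)[OF 1] contentD(1)[OF 2]])
  show "SK.vc (I <#>\<^bsub>Q\<^esub> J) \<subseteq> carrier Q" by (rule SK.vc_sub)
  show ss: "set_mset (s + s') \<subseteq> carrier G" and tt: "set_mset (t + t') \<subseteq> carrier G"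
    using contentD(2,3)[OF 1] contentD(2,3)[OF 2] by simp_all
  show "int (count (s + s') g) \<le> val y g + int (count (t + t') g)"
    if y: "y \<in> SK.vc (I <#>\<^bsub>Q\<^esub> J)" for y g
  proof -
    obtain x where x: "x \<in> ideal_above (t + t') (s + s')"
      "int (count (t + t') g) = val x g + int (count (s + s') g)"
      using divisor_theory[OF inf tt ss] by blast
    have xQ: "x \<in> carrier Q" using x(1) above_sub by blast
    have "0 \<le> val x h + val k h" if k: "k \<in> I <#>\<^bsub>Q\<^esub> J" for k h
    proof -
      obtain i j where ij: "i \<in> I" "j \<in> J" "k = i \<otimes>\<^bsub>Q\<^esub> j" using k unfolding set_mult_mem by blast
      have "i \<in> carrier Q" "j \<in> carrier Q" using ij contentD(1)[OF 1] contentD(1)[OF 2] by blast+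
      then have "val k h = val i h + val j h" using ij(3) by (simp add: val_mult)
      moreover have "int (count (t + t') h) \<le> val x h + int (count (s + s') h)"
        using x(1) by (simp add: ideal_above_def)
      ultimately show ?thesis
        using contentD(4)[OF 1 ij(1), of h] contentD(4)[OF 2 ij(2), of h] by simp
    qed
    then have xd: "x \<in> SK.dual (I <#>\<^bsub>Q\<^esub> J)" unfolding dual_K_iff[OF IJ] using xQ by blast
    have "y \<in> SK.dual (SK.dual (I <#>\<^bsub>Q\<^esub> J))" using y by (simp only: SK.vc_def)
    then have "0 \<le> val y g + val x g" unfolding dual_K_iff[OF SK.dual_sub] using xd by blast
    then show ?thesis using x(2) by linarith
  qed
  show "\<exists>x\<in>SK.vc (I <#>\<^bsub>Q\<^esub> J). int (count (s + s') g) = val x g + int (count (t + t') g)" for g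
  proof -
    obtain i where i: "i \<in> I" "int (count s g) = val i g + int (count t g)" using contentD(5)[OF 1] by blast
    obtain j where j: "j \<in> J" "int (count s' g) = val j g + int (count t' g)" using contentD(5)[OF 2] by blast
    have q: "i \<in> carrier Q" "j \<in> carrier Q" using i(1) j(1) contentD(1)[OF 1] contentD(1)[OF 2] by blast+
    have "i \<otimes>\<^bsub>Q\<^esub> j \<in> I <#>\<^bsub>Q\<^esub> J" unfolding set_mult_mem using i(1) j(1) by blast
    then have mem: "i \<otimes>\<^bsub>Q\<^esub> j \<in> SK.vc (I <#>\<^bsub>Q\<^esub> J)" using SK.vc_extensive[OF IJ] by blast
    have "int (count (s + s') g) = val (i \<otimes>\<^bsub>Q\<^esub> j) g + int (count (t + t') g)"
      using i(2) j(2) q by (simp add: val_mult)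
    then show ?thesis using mem by blast
  qed
qed

lemma content_principal:
  assumes a: "a \<in> carrier Q" and v: "\<And>g. val a g = int (count p g) - int (count q g)"
    and pq: "set_mset p \<subseteq> carrier G" "set_mset q \<subseteq> carrier G"
  shows "content (a <#\<^bsub>Q\<^esub> K) p q"
proof (rule contentI)
  show "a <#\<^bsub>Q\<^esub> K \<subseteq> carrier Q" by (rule SK.l_coset_sub[OF a SK.H_sub])
  show "int (count p g) \<le> val x g + int (count q g)" if x: "x \<in> a <#\<^bsub>Q\<^esub> K" for x g
  proof -
    obtain y where y: "y \<in> K" "x = a \<otimes>\<^bsub>Q\<^esub> y" using x unfolding l_coset_mem by blast
    then show ?thesis using a v[of g] by (simp add: K_iff val_mult)
  qed
  show "\<exists>x\<in>a <#\<^bsub>Q\<^esub> K. int (count p g) = val x g + int (count q g)" for g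
  proof -
    have "a \<otimes>\<^bsub>Q\<^esub> \<one>\<^bsub>Q\<^esub> \<in> a <#\<^bsub>Q\<^esub> K" using SK.H_one unfolding l_coset_mem by blast
    then have "a \<in> a <#\<^bsub>Q\<^esub> K" using a by simp
    then show ?thesis using v[of g] by force
  qed
qed (use pq in auto)

lemma above_in_U:
  assumes inf: "infinite (carrier G)"
    and s: "set_mset s \<subseteq> carrier G" and t: "set_mset t \<subseteq> carrier G"
  shows "ideal_above s t \<in> carrier SK.U"
proof (rule SK.U_I[of _ "ideal_above t s"])
  have dual: "SK.dual (ideal_above s t) = ideal_above t s"
    if "set_mset s \<subseteq> carrier G" "set_mset t \<subseteq> carrier G" for s t
    by (rule dual_if_content[OF content_above[OF inf that]])
  have frac: "ideal_above s t \<in> carrier Fv"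
    if s: "set_mset s \<subseteq> carrier G" and t: "set_mset t \<subseteq> carrier G" for s t
    unfolding SK.fractional_iff
  proof (intro conjI bexI)
    show "ideal_above s t \<subseteq> carrier Q" by (rule above_sub)
    show "SK.vc (ideal_above s t) = ideal_above s t" unfolding SK.vc_def dual[OF s t] dual[OF t s] ..
    \<comment> \<open>Not \<open>t\<close> itself but its square is certain to lie in \<open>B\<close>.\<close>
    show "emb (t + t) \<in> carrier Q" by (rule emb_in_Q[OF pm_double[OF t]])
    show "emb (t + t) <#\<^bsub>Q\<^esub> ideal_above s t \<subseteq> K"
    proof
      fix x assume "x \<in> emb (t + t) <#\<^bsub>Q\<^esub> ideal_above s t"
      then obtain y where y: "y \<in> ideal_above s t" "x = emb (t + t) \<otimes>\<^bsub>Q\<^esub> y" unfolding l_coset_mem by blast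
      have y': "y \<in> carrier Q" "\<And>g. int (count s g) \<le> val y g + int (count t g)"
        using y(1) by (simp_all add: ideal_above_def)
      have "0 \<le> val x g" for g
        using y'(2)[of g] y'(1) y(2) pm_double[OF t] by (simp add: val_mult)
      then show "x \<in> K" using y(2) y'(1) pm_double[OF t] by (simp add: K_iff)
    qed
  qed
  show "ideal_above s t \<in> carrier Fv" "ideal_above t s \<in> carrier Fv" using frac s t by blast+
  have c: "content (SK.vc (ideal_above s t <#>\<^bsub>Q\<^esub> ideal_above t s)) (s + t) (t + s)"
    by (rule content_mult[OF inf content_above[OF inf s t] content_above[OF inf t s]])
  have IJ: "ideal_above s t <#>\<^bsub>Q\<^esub> ideal_above t s \<subseteq> carrier Q" by (rule Q.set_mult_closed[OF above_sub above_sub])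
  have "SK.dual (SK.vc (ideal_above s t <#>\<^bsub>Q\<^esub> ideal_above t s)) = ideal_above (t + s) (s + t)"
    by (rule dual_if_content[OF c])
  also have "\<dots> = K" by (auto simp: ideal_above_def K_iff)
  finally have "SK.dual (ideal_above s t <#>\<^bsub>Q\<^esub> ideal_above t s) = K" unfolding SK.dual_vc[OF IJ] .
  then show "SK.vc (ideal_above s t <#>\<^bsub>Q\<^esub> ideal_above t s) = K" unfolding SK.vc_def by (simp add: SK.dual_H)
qed

end

text \<open>Since \<open>2a\<close> lies in \<open>2G\<close>, adjoining \<open>a\<close> to a subgroup that contains \<open>2G\<close> at most doubles it.\<close>

lemma (in comm_group) finite_subgroup_containing:
  assumes fin: "finite doubles" and A: "finite A" "A \<subseteq> carrier G"
  shows "\<exists>N. subgroup N G \<and> finite N \<and> doubles \<subseteq> N \<and> A \<subseteq> N"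
  using A
proof (induction A)
  case empty
  show ?case using subgroup_doubles fin by blast
next
  case (insert a A)
  then obtain N where N: "subgroup N G" "finite N" "doubles \<subseteq> N" "A \<subseteq> N" by blast
  have a: "a \<in> carrier G" using insert by simp
  have Nc: "N \<subseteq> carrier G" by (rule subgroup.subset[OF N(1)])
  have aa: "a \<otimes> a \<in> N" using N(3) doublesI[OF a] by blast
  let ?M = "N \<union> (\<lambda>x. a \<otimes> x) ` N"
  have Mc: "?M \<subseteq> carrier G" using Nc a by auto
  have left: "a \<otimes> x \<in> ?M" if x: "x \<in> ?M" for x
  proof (cases "x \<in> N")
    case False
    then obtain y where y: "y \<in> N" "x = a \<otimes> y" using x by blast
    have "a \<otimes> x = (a \<otimes> a) \<otimes> y" using y a Nc by (simp add: m_assoc subsetD)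
    then show ?thesis using subgroup.m_closed[OF N(1) aa y(1)] by simp
  qed simp
  have mult: "n \<otimes> x \<in> ?M" if n: "n \<in> N" and x: "x \<in> ?M" for n x
  proof (cases "x \<in> N")
    case True
    then show ?thesis using subgroup.m_closed[OF N(1) n] by simp
  next
    case False
    then obtain y where y: "y \<in> N" "x = a \<otimes> y" using x by blast
    have "n \<otimes> x = a \<otimes> (n \<otimes> y)" unfolding y(2) using y(1) a Nc n by (intro m_lcomm) blast+
    then show ?thesis using subgroup.m_closed[OF N(1) n y(1)] by simp
  qed
  have "subgroup ?M G"
  proof (rule subgroup.intro)
    show "?M \<subseteq> carrier G" by (rule Mc)
    show "\<one> \<in> ?M" using subgroup.one_closed[OF N(1)] by simp
    show "x \<otimes> y \<in> ?M" if x: "x \<in> ?M" and y: "y \<in> ?M" for x y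
    proof (cases "x \<in> N")
      case True
      then show ?thesis using mult y by blast
    next
      case False
      then obtain n where n: "n \<in> N" "x = a \<otimes> n" using x by blast
      have "x \<otimes> y = a \<otimes> (n \<otimes> y)" unfolding n(2) using n(1) a Nc Mc y by (intro m_assoc) blast+
      then show ?thesis using left[OF mult[OF n(1) y]] by simp
    qed
    show "inv x \<in> ?M" if x: "x \<in> ?M" for x
    proof (cases "x \<in> N")
      case True
      then show ?thesis using subgroup.m_inv_closed[OF N(1)] by simp
    next
      case False
      then obtain n where n: "n \<in> N" "x = a \<otimes> n" using x by blast
      have nc: "n \<in> carrier G" using n(1) Nc by blast
      have "inv x = a \<otimes> (inv (a \<otimes> a) \<otimes> inv n)"
        unfolding n(2) using a nc by (simp add: inv_mult flip: m_assoc)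
      then show ?thesis
        using subgroup.m_closed[OF N(1) subgroup.m_inv_closed[OF N(1) aa] subgroup.m_inv_closed[OF N(1) n(1)]]
        by simp
    qed
  qed
  moreover have "a \<in> ?M"
  proof -
    have "a \<otimes> \<one> \<in> ?M" using subgroup.one_closed[OF N(1)] by blast
    then show ?thesis using a by simp
  qed
  ultimately show ?case using N(2-4) by (intro exI[of _ ?M]) auto
qed

context pm_monoid
begin

text \<open>Let \<open>N\<close> be a finite subgroup that contains \<open>2G\<close> and the sums of the contents of representatives of the
  generators. The invertible ideals whose content has sum in \<open>N\<close> form a subgroup that contains the
  principal ideals, hence all invertible ideals, in particular the multiples of \<open>g\<close>, whose content is \<open>g\<close>.
  So \<open>G = N\<close>.\<close>

theorem finite_if_fin_gen_class_group:
  assumes dbl: "finite doubles" and fg: "fin_gen_group (v_class_group Q K)"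
  shows "finite (carrier G)"
proof (rule ccontr)
  assume inf: "infinite (carrier G)"
  interpret U: comm_group SK.U by (rule SK.comm_group_U)
  obtain E where E: "finite E" "E \<subseteq> carrier (SK.U Mod SK.P)"
    "generate (SK.U Mod SK.P) E = carrier (SK.U Mod SK.P)"
    using fg unfolding fin_gen_group_def v_class_group_def by blast
  have "\<forall>C\<in>E. \<exists>p. fst p \<in> carrier SK.U \<and> C = SK.P #>\<^bsub>SK.U\<^esub> fst p \<and>
      content (fst p) (fst (snd p)) (snd (snd p))"
  proof
    fix C assume "C \<in> E"
    then have "C \<in> rcosets\<^bsub>SK.U\<^esub> SK.P" using E(2) by (auto simp: FactGroup_def)
    then obtain J where J: "J \<in> carrier SK.U" "C = SK.P #>\<^bsub>SK.U\<^esub> J" unfolding RCOSETS_def by blast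
    obtain s t where st: "content J s t" using content_of_unit[OF J(1)] by blast
    show "\<exists>p. fst p \<in> carrier SK.U \<and> C = SK.P #>\<^bsub>SK.U\<^esub> fst p \<and>
      content (fst p) (fst (snd p)) (snd (snd p))"
      by (rule exI[of _ "(J, s, t)"]) (use J st in simp)
  qed
  from bchoice[OF this] obtain f where f: "\<And>C. C \<in> E \<Longrightarrow> fst (f C) \<in> carrier SK.U"
    "\<And>C. C \<in> E \<Longrightarrow> C = SK.P #>\<^bsub>SK.U\<^esub> fst (f C)"
    "\<And>C. C \<in> E \<Longrightarrow> content (fst (f C)) (fst (snd (f C))) (snd (snd (f C)))" by blast
  define A where "A = (\<lambda>C. sigma (fst (snd (f C))) \<otimes> inv (sigma (snd (snd (f C))))) ` E"
  have "A \<subseteq> carrier G"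
  proof
    fix a assume "a \<in> A"
    then obtain C where C: "C \<in> E" "a = sigma (fst (snd (f C))) \<otimes> inv (sigma (snd (snd (f C))))"
      unfolding A_def by blast
    show "a \<in> carrier G" unfolding C(2) using contentD(2,3)[OF f(3)[OF C(1)]] by simp
  qed
  moreover have "finite A" unfolding A_def using E(1) by (rule finite_imageI)
  ultimately obtain N where N: "subgroup N G" "finite N" "doubles \<subseteq> N" "A \<subseteq> N"
    using finite_subgroup_containing[OF dbl, of A] by blast
  define M where "M = {J \<in> carrier SK.U. \<exists>s t. content J s t \<and> sigma s \<otimes> inv (sigma t) \<in> N}"
  have MI: "J \<in> M" if "J \<in> carrier SK.U" "content J s t" "sigma s \<otimes> inv (sigma t) \<in> N" for J s t
    using that unfolding M_def by blast
  have PM: "SK.P \<subseteq> M"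
  proof
    fix J assume "J \<in> SK.P"
    then obtain a where a: "a \<in> carrier Q" "J = a <#\<^bsub>Q\<^esub> K" by blast
    obtain p q where pq: "p \<in> B" "q \<in> B" "\<And>g. val a g = int (count p g) - int (count q g)"
      using val_bound[OF a(1)] by metis
    have "sigma p \<otimes> inv (sigma q) \<in> N"
      using sigma_pm[OF pq(1)] sigma_pm[OF pq(2)] N(3)
        subgroup.m_closed[OF N(1)] subgroup.m_inv_closed[OF N(1)] by blast
    then show "J \<in> M"
      unfolding a(2)
      by (rule MI[OF SK.principal_in_U[OF a(1)]
            content_principal[OF a(1) pq(3) pm_carrier[OF pq(1)] pm_carrier[OF pq(2)]]])
  qed
  have sgM: "subgroup M SK.U"
  proof (rule subgroup.intro)
    show "M \<subseteq> carrier SK.U" unfolding M_def by blast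
    show "\<one>\<^bsub>SK.U\<^esub> \<in> M" using PM subgroup.one_closed[OF SK.subgroup_P] by blast
    show "I \<otimes>\<^bsub>SK.U\<^esub> J \<in> M" if I: "I \<in> M" and J: "J \<in> M" for I J
    proof -
      obtain s t where st: "I \<in> carrier SK.U" "content I s t" "sigma s \<otimes> inv (sigma t) \<in> N"
        using I unfolding M_def by blast
      obtain s' t' where st': "J \<in> carrier SK.U" "content J s' t'" "sigma s' \<otimes> inv (sigma t') \<in> N"
        using J unfolding M_def by blast
      have "content (I \<otimes>\<^bsub>SK.U\<^esub> J) (s + s') (t + t')"
        unfolding SK.U_simps(2) by (rule content_mult[OF inf st(2) st'(2)])
      moreover have "sigma (s + s') \<otimes> inv (sigma (t + t'))
          = (sigma s \<otimes> inv (sigma t)) \<otimes> (sigma s' \<otimes> inv (sigma t'))"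
        using contentD(2,3)[OF st(2)] contentD(2,3)[OF st'(2)] by (simp add: inv_mult m_ac)
      ultimately show ?thesis
        using MI[OF U.m_closed[OF st(1) st'(1)]] subgroup.m_closed[OF N(1) st(3) st'(3)] by simp
    qed
    show "inv\<^bsub>SK.U\<^esub> J \<in> M" if J: "J \<in> M" for J
    proof -
      obtain s t where st: "J \<in> carrier SK.U" "content J s t" "sigma s \<otimes> inv (sigma t) \<in> N"
        using J unfolding M_def by blast
      have JU: "inv\<^bsub>SK.U\<^esub> J \<in> carrier SK.U" using st(1) by simp
      obtain s' t' where st': "content (inv\<^bsub>SK.U\<^esub> J) s' t'" using content_of_unit[OF JU] by blast
      have "content (J \<otimes>\<^bsub>SK.U\<^esub> inv\<^bsub>SK.U\<^esub> J) (s + s') (t + t')"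
        unfolding SK.U_simps(2) by (rule content_mult[OF inf st(2) st'])
      then have c1: "content K (s + s') (t + t')" using st(1) by (simp add: SK.U_simps(3))
      have "content (\<one>\<^bsub>Q\<^esub> <#\<^bsub>Q\<^esub> K) {#} {#}" by (rule content_principal) simp_all
      then have c2: "content K {#} {#}" using SK.H_sub by (simp add: Q.lcos_mult_one)
      have "s + s' = t + t'" using content_unique[OF c1 c2] by simp
      then have "sigma (s + s') = sigma (t + t')" by (rule arg_cong)
      then have eq: "sigma s \<otimes> sigma s' = sigma t \<otimes> sigma t'"
        using contentD(2,3)[OF st(2)] contentD(2,3)[OF st'] by simp
      have m: "sigma s \<in> carrier G" "sigma t \<in> carrier G" "sigma s' \<in> carrier G" "sigma t' \<in> carrier G"
        using contentD(2,3)[OF st(2)] contentD(2,3)[OF st'] by simp_all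
      have "(sigma s' \<otimes> inv (sigma t')) \<otimes> (sigma s \<otimes> inv (sigma t))
          = (sigma s \<otimes> sigma s') \<otimes> inv (sigma t \<otimes> sigma t')"
        using m by (simp add: inv_mult m_ac)
      also have "\<dots> = \<one>" unfolding eq using m by simp
      finally have "inv (sigma s \<otimes> inv (sigma t)) = sigma s' \<otimes> inv (sigma t')"
        by (rule inv_equality) (use m in simp_all)
      then show ?thesis
        using MI[OF JU st'] subgroup.m_inv_closed[OF N(1) st(3)] by simp
    qed
  qed
  have reps: "E \<subseteq> {SK.P #>\<^bsub>SK.U\<^esub> x |x. x \<in> M}"
  proof
    fix C assume C: "C \<in> E"
    have "sigma (fst (snd (f C))) \<otimes> inv (sigma (snd (snd (f C)))) \<in> N"
      using N(4) C unfolding A_def by blast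
    then have "fst (f C) \<in> M" by (rule MI[OF f(1)[OF C] f(3)[OF C]])
    then show "C \<in> {SK.P #>\<^bsub>SK.U\<^esub> x |x. x \<in> M}" using f(2)[OF C] by blast
  qed
  have cover: "carrier SK.U \<subseteq> M"
    by (rule normal.subgroup_covers_if_quotient_generated[OF SK.normal_P E(3) sgM PM reps E(2)])
  have "carrier G \<subseteq> N"
  proof
    fix g assume g: "g \<in> carrier G"
    then have gs: "set_mset {#g#} \<subseteq> carrier G" "set_mset {#} \<subseteq> carrier G" by simp_all
    have "ideal_above {#g#} {#} \<in> M" using above_in_U[OF inf gs] cover by blast
    then obtain s t where st: "content (ideal_above {#g#} {#}) s t" "sigma s \<otimes> inv (sigma t) \<in> N"
      unfolding M_def by blast
    have "s + {#} = {#g#} + t" by (rule content_unique[OF st(1) content_above[OF inf gs]])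
    then have "sigma s = g \<otimes> sigma t" using g contentD(3)[OF st(1)] by simp
    then have "sigma s \<otimes> inv (sigma t) = g" using g contentD(3)[OF st(1)] by (simp add: m_assoc)
    then show "g \<in> N" using st(2) by simp
  qed
  then show False using N(2) inf finite_subset by blast
qed

end

section \<open>The equivalence\<close>

lemma (in comm_group) finite_if_C_monoid:
  assumes C: "C_monoid_defined_in F (\<phi> ` pm_zero_sum_sequences G)"
    and hom: "\<phi> \<in> hom (pm_zero_sum_monoid G) F" and inj: "inj_on \<phi> (pm_zero_sum_sequences G)"
  shows "finite (carrier G)"
proof -
  have F: "factorial_monoid F" using C by (simp add: C_monoid_defined_in_def)
  have "pm_in_C_monoid G F \<phi>"
    by (intro pm_in_C_monoid.intro pm_in_C_monoid_axioms.intro comm_group_axioms F C hom inj)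
  then show ?thesis by (rule pm_in_C_monoid.finite_carrier)
qed

theorem theorem3p7:
  fixes G :: "('a, 'm) monoid_scheme"
  assumes "comm_group G"
  shows "(fin_gen_monoid (pm_zero_sum_monoid G)
            \<longleftrightarrow> C_monoid_defined_in (free_abelian_monoid (carrier G)) (pm_zero_sum_sequences G))
       \<and> (C_monoid_defined_in (free_abelian_monoid (carrier G)) (pm_zero_sum_sequences G)
            \<longleftrightarrow> C_monoid TYPE('a multiset + 'f) (pm_zero_sum_monoid G))
       \<and> (C_monoid TYPE('a multiset + 'f) (pm_zero_sum_monoid G)
            \<longleftrightarrow> mori_monoid (pm_zero_sum_monoid G) \<and>
                fin_gen_group (v_class_group (quotient_group (pm_zero_sum_monoid G))
                  (complete_integral_closure (quotient_group (pm_zero_sum_monoid G)) (embedded (pm_zero_sum_monoid G)))))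
       \<and> (mori_monoid (pm_zero_sum_monoid G) \<and>
                fin_gen_group (v_class_group (quotient_group (pm_zero_sum_monoid G))
                  (complete_integral_closure (quotient_group (pm_zero_sum_monoid G)) (embedded (pm_zero_sum_monoid G))))
            \<longleftrightarrow> finite (carrier G))"
proof -
  interpret G: comm_group G by (rule assms)
  interpret pm_monoid G by unfold_locales
  have b: "C_monoid_defined_in (free_abelian_monoid (carrier G)) (pm_zero_sum_sequences G)
      \<longleftrightarrow> finite (carrier G)"
  proof
    assume C: "C_monoid_defined_in (free_abelian_monoid (carrier G)) (pm_zero_sum_sequences G)"
    have "id \<in> hom (pm_zero_sum_monoid G) (free_abelian_monoid (carrier G))"
      by (rule homI) (simp_all add: G.pm_carrier)
    then show "finite (carrier G)" using G.finite_if_C_monoid[of "free_abelian_monoid (carrier G)" id] C by simp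
  qed (rule G.C_monoid_in_free_if_finite)
  have c: "C_monoid TYPE('a multiset + 'f) (pm_zero_sum_monoid G) \<longleftrightarrow> finite (carrier G)"
  proof
    assume "C_monoid TYPE('a multiset + 'f) (pm_zero_sum_monoid G)"
    then obtain F :: "('a multiset + 'f) monoid" and \<phi> where
      "\<phi> \<in> hom (pm_zero_sum_monoid G) F" "inj_on \<phi> (pm_zero_sum_sequences G)"
      "C_monoid_defined_in F (\<phi> ` pm_zero_sum_sequences G)"
      unfolding C_monoid_def pm_monoid_simps by blast
    then show "finite (carrier G)" by (intro G.finite_if_C_monoid)
  qed (rule G.C_monoid_pm_if_finite)
  have d: "mori_monoid (pm_zero_sum_monoid G) \<and>
                fin_gen_group (v_class_group (quotient_group (pm_zero_sum_monoid G))
                  (complete_integral_closure (quotient_group (pm_zero_sum_monoid G)) (embedded (pm_zero_sum_monoid G))))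
            \<longleftrightarrow> finite (carrier G)"
    using mori_if_finite fin_gen_class_group_if_finite finite_doubles_if_mori
      finite_if_fin_gen_class_group by blast
  show ?thesis unfolding G.fin_gen_pm_iff b c d by blast
qed

end
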